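(* Let $S$ be a local set theory in a local language $\mathcal{L}$ satisfying the Nullstellensatz. Let $f:X\rightarrow Y$ be an $S$-function with $X$ of type $\mathbf{PA}$ and $Y$ of type $\mathbf{PB}$, and fix variables $x$ and $y$ of types $\mathbf{A}$ and $\mathbf{B}$ respectively. Then the $f$-translation $\vartheta\mapsto\vartheta^\natural_{\bm{y},f,x}$ is a functor $F\rightarrow F$, and its correstriction $(-)^\times_f:F\rightarrow F\langle y\rangle$ has $\mathbb{E}_f:\xi\mapsto(\langle x,y\rangle\in\lvert f\rvert\Rightarrow\xi)$ as a right adjoint.
   Context: A local set theory $S$ in a local language $\mathcal{L}$ is a collection of sequents closed under derivability $\vdash_S$ (Bell's intuitionistic typed deduction system). The Nullstellensatz is the axiom that there is a function symbol of signature $\mathbf{1}\rightarrow\mathbf{A}$ for every ground type $\mathbf{A}$; it yields an unrestricted cut rule, hence transitivity of $\vdash_S$, so that the class $F$ of all formulae of $\mathcal{L}$ becomes a (preorder) category with an arrow $\vartheta\to\gamma$ iff $\vartheta\vdash_S\gamma$. $F\langle y\rangle$ denotes the class of formulae of $\mathcal{L}$ not having $y$ as a free variable. An $S$-function $f:X\rightarrow Y$ is a triple $(\lvert f\rvert,X,Y)$ of $S$-sets with $\vdash_S\lvert f\rvert\in Y^X$. For an $S$-function $g:Z\rightarrow\mathit{\Omega}$ write $g^\natural(z)$ for the formula $\langle z,\mathit{true}\rangle\in\lvert g\rvert$. Let $i_Y=(y\mapsto y):Y\rightarrow U_{\mathbf{B}}$, and let $K$ be the canonical interpretation of $\mathcal{L}$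 in the linguistic topos $\mathscr{T}(S)$, so that $\llbracket\vartheta\rrbracket_{K,\bm{y}}=(\bm{y}\mapsto\vartheta)$. For a formula $\vartheta$, let $\bm{y}$ be a finite sequence of variables containing the free variables of $\vartheta$ and $y$, and let $\bm{x}$ be obtained from $\bm{y}$ by replacing $y$ with $x$. The $f$-translation (preimage translation) of $\vartheta$ is the formula $\vartheta^\natural_{\bm{y},f,x}:=(\llbracket\vartheta\rrbracket_{K,\bm{y}}\circ 1\times i_Y\circ 1\times f)^\natural(\bm{x})$; equivalently $\vdash_S\vartheta^\natural_{\bm{y},f,x}\Leftrightarrow\exists y(\langle x,y\rangle\in\lvert f\rvert\wedge\vartheta)$. *)

theory Defs
  imports Main
begin

section \<open>Categories, functors, adjunctions\<close>

record ('o, 'm) cat =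
  Obj :: "'o set"
  Arr :: "'m set"
  Dom :: "'m \<Rightarrow> 'o"
  Cod :: "'m \<Rightarrow> 'o"
  Ident :: "'o \<Rightarrow> 'm"
  Cmp :: "'m \<Rightarrow> 'm \<Rightarrow> 'm"  \<comment> \<open>\<open>Cmp C g f\<close> is \<open>g\<close> after \<open>f\<close>\<close>

definition hom :: "('o, 'm) cat \<Rightarrow> 'o \<Rightarrow> 'o \<Rightarrow> 'm set" where
  "hom C a b = {f \<in> Arr C. Dom C f = a \<and> Cod C f = b}"

definition category :: "('o, 'm) cat \<Rightarrow> bool" where
  "category C \<longleftrightarrow>
     (\<forall>f \<in> Arr C. Dom C f \<in> Obj C \<and> Cod C f \<in> Obj C) \<and>
     (\<forall>a \<in> Obj C. Ident C a \<in> hom C a a) \<and>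
     (\<forall>f \<in> Arr C. \<forall>g \<in> Arr C. Cod C f = Dom C g \<longrightarrow>
        Cmp C g f \<in> hom C (Dom C f) (Cod C g)) \<and>
     (\<forall>f \<in> Arr C. Cmp C f (Ident C (Dom C f)) = f \<and> Cmp C (Ident C (Cod C f)) f = f) \<and>
     (\<forall>f \<in> Arr C. \<forall>g \<in> Arr C. \<forall>h \<in> Arr C. Cod C f = Dom C g \<and> Cod C g = Dom C h \<longrightarrow>
        Cmp C h (Cmp C g f) = Cmp C (Cmp C h g) f)"

definition is_functor ::
  "('o, 'm) cat \<Rightarrow> ('p, 'n) cat \<Rightarrow> ('o \<Rightarrow> 'p) \<Rightarrow> ('m \<Rightarrow> 'n) \<Rightarrow> bool" where
  "is_functor C D Fo Fa \<longleftrightarrow>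
     category C \<and> category D \<and>
     (\<forall>a \<in> Obj C. Fo a \<in> Obj D) \<and>
     (\<forall>f \<in> Arr C. Fa f \<in> hom D (Fo (Dom C f)) (Fo (Cod C f))) \<and>
     (\<forall>a \<in> Obj C. Fa (Ident C a) = Ident D (Fo a)) \<and>
     (\<forall>f \<in> Arr C. \<forall>g \<in> Arr C. Cod C f = Dom C g \<longrightarrow>
        Fa (Cmp C g f) = Cmp D (Fa g) (Fa f))"

text \<open>\<open>right_adjoint C D Fo Fa Go Ga\<close>: the functor \<open>(Go, Ga)\<close> from \<open>D\<close> to \<open>C\<close> is right adjoint to
  the functor \<open>(Fo, Fa)\<close> from \<open>C\<close> to \<open>D\<close>.\<close>

definition right_adjoint ::
  "('o, 'm) cat \<Rightarrow> ('p, 'n) cat \<Rightarrow> ('o \<Rightarrow> 'p) \<Rightarrow> ('m \<Rightarrow> 'n) \<Rightarrow> ('p \<Rightarrow> 'o) \<Rightarrow> ('n \<Rightarrow> 'm) \<Rightarrow> bool" where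
  "right_adjoint C D Fo Fa Go Ga \<longleftrightarrow>
     is_functor C D Fo Fa \<and> is_functor D C Go Ga \<and>
     (\<exists>\<phi>. (\<forall>a \<in> Obj C. \<forall>b \<in> Obj D. bij_betw (\<phi> a b) (hom D (Fo a) b) (hom C a (Go b))) \<and>
          (\<forall>a \<in> Obj C. \<forall>a' \<in> Obj C. \<forall>b \<in> Obj D. \<forall>b' \<in> Obj D.
             \<forall>h \<in> hom C a' a. \<forall>g \<in> hom D (Fo a) b. \<forall>k \<in> hom D b b'.
               \<phi> a' b' (Cmp D k (Cmp D g (Fa h))) = Cmp C (Ga k) (Cmp C (\<phi> a b g) h)))"

definition preorder_cat :: "'o set \<Rightarrow> ('o \<Rightarrow> 'o \<Rightarrow> bool) \<Rightarrow> ('o, 'o \<times> 'o) cat" where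
  "preorder_cat P le =
     \<lparr> Obj = P,
       Arr = {(a, b). a \<in> P \<and> b \<in> P \<and> le a b},
       Dom = fst, Cod = snd,
       Ident = (\<lambda>a. (a, a)),
       Cmp = (\<lambda>g f. (fst f, snd g)) \<rparr>"


section \<open>Local languages\<close>

text \<open>Bell's conventions: a product of one type is that type and a product of no types is
  \<open>\<one>\<close>, so \<open>ProdT\<close> is only well-formed on lists of length at least two. Likewise \<open>Tup\<close> below.\<close>

datatype 'g ty = UnitT | OmegaT | GroundT 'g | PowT "'g ty" | ProdT "'g ty list"

text \<open>Variables and function symbols carry their types and signatures; each type has countably
  many variables.\<close>

datatype 'g var = Variable (vname: nat) (vty: "'g ty")

datatype ('g, 'f) fsym = FSym (fname: 'f) (fdom: "'g ty") (fcod: "'g ty")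

record ('g, 'f) language =
  grounds :: "'g set"
  funs :: "('g, 'f) fsym set"

fun wf_ty :: "('g, 'f) language \<Rightarrow> 'g ty \<Rightarrow> bool" where
  "wf_ty L UnitT = True"
| "wf_ty L OmegaT = True"
| "wf_ty L (GroundT G) = (G \<in> grounds L)"
| "wf_ty L (PowT A) = wf_ty L A"
| "wf_ty L (ProdT As) = (2 \<le> length As \<and> (\<forall>A \<in> set As. wf_ty L A))"

definition local_language :: "('g, 'f) language \<Rightarrow> bool" where
  "local_language L \<longleftrightarrow> (\<forall>h \<in> funs L. wf_ty L (fdom h) \<and> wf_ty L (fcod h))"

definition nullstellensatz :: "('g, 'f) language \<Rightarrow> bool" where
  "nullstellensatz L \<longleftrightarrow>
     (\<forall>G \<in> grounds L. \<exists>h \<in> funs L. fdom h = UnitT \<and> fcod h = GroundT G)"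

text \<open>\<open>Proj i t\<close> is the projection to the component with index \<open>i\<close>, counted from 0;
  \<open>Coll x \<alpha>\<close> is \<open>{x : \<alpha>}\<close> and binds \<open>x\<close>.\<close>

datatype ('g, 'f) trm =
    Var "'g var"
  | Star
  | App "('g, 'f) fsym" "('g, 'f) trm"
  | Tup "('g, 'f) trm list"
  | Proj nat "('g, 'f) trm"
  | Coll "'g var" "('g, 'f) trm"
  | Eq "('g, 'f) trm" "('g, 'f) trm"
  | Mem "('g, 'f) trm" "('g, 'f) trm"

fun ty_of :: "('g, 'f) trm \<Rightarrow> 'g ty" where
  "ty_of (Var v) = vty v"
| "ty_of Star = UnitT"
| "ty_of (App h t) = fcod h"
| "ty_of (Tup ts) = ProdT (map ty_of ts)"
| "ty_of (Proj i t) = (case ty_of t of ProdT As \<Rightarrow> As ! i | _ \<Rightarrow> UnitT)"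
| "ty_of (Coll v a) = PowT (vty v)"
| "ty_of (Eq s t) = OmegaT"
| "ty_of (Mem s t) = OmegaT"

fun wf_trm :: "('g, 'f) language \<Rightarrow> ('g, 'f) trm \<Rightarrow> bool" where
  "wf_trm L (Var v) = wf_ty L (vty v)"
| "wf_trm L Star = True"
| "wf_trm L (App h t) = (h \<in> funs L \<and> wf_trm L t \<and> ty_of t = fdom h)"
| "wf_trm L (Tup ts) = (2 \<le> length ts \<and> (\<forall>t \<in> set ts. wf_trm L t))"
| "wf_trm L (Proj i t) = (wf_trm L t \<and> (\<exists>As. ty_of t = ProdT As \<and> i < length As))"
| "wf_trm L (Coll v a) = (wf_ty L (vty v) \<and> wf_trm L a \<and> ty_of a = OmegaT)"
| "wf_trm L (Eq s t) = (wf_trm L s \<and> wf_trm L t \<and> ty_of s = ty_of t)"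
| "wf_trm L (Mem s t) = (wf_trm L s \<and> wf_trm L t \<and> ty_of t = PowT (ty_of s))"

definition formula :: "('g, 'f) language \<Rightarrow> ('g, 'f) trm \<Rightarrow> bool" where
  "formula L a \<longleftrightarrow> wf_trm L a \<and> ty_of a = OmegaT"

fun fv :: "('g, 'f) trm \<Rightarrow> 'g var set" where
  "fv (Var v) = {v}"
| "fv Star = {}"
| "fv (App h t) = fv t"
| "fv (Tup ts) = (\<Union>t \<in> set ts. fv t)"
| "fv (Proj i t) = fv t"
| "fv (Coll v a) = fv a - {v}"
| "fv (Eq s t) = fv s \<union> fv t"
| "fv (Mem s t) = fv s \<union> fv t"

text \<open>Forall variables occurring in a term, free or bound.\<close>

fun vars :: "('g, 'f) trm \<Rightarrow> 'g var set" where
  "vars (Var v) = {v}"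
| "vars Star = {}"
| "vars (App h t) = vars t"
| "vars (Tup ts) = (\<Union>t \<in> set ts. vars t)"
| "vars (Proj i t) = vars t"
| "vars (Coll v a) = insert v (vars a)"
| "vars (Eq s t) = vars s \<union> vars t"
| "vars (Mem s t) = vars s \<union> vars t"

text \<open>\<open>subst t x s\<close> is \<open>t(x/s)\<close>: every free occurrence of \<open>x\<close> in \<open>t\<close> is replaced by \<open>s\<close>, without
  renaming bound variables.\<close>

fun subst :: "('g, 'f) trm \<Rightarrow> 'g var \<Rightarrow> ('g, 'f) trm \<Rightarrow> ('g, 'f) trm" where
  "subst (Var v) x s = (if v = x then s else Var v)"
| "subst Star x s = Star"
| "subst (App h t) x s = App h (subst t x s)"
| "subst (Tup ts) x s = Tup (map (\<lambda>t. subst t x s) ts)"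
| "subst (Proj i t) x s = Proj i (subst t x s)"
| "subst (Coll v a) x s = (if v = x then Coll v a else Coll v (subst a x s))"
| "subst (Eq t u) x s = Eq (subst t x s) (subst u x s)"
| "subst (Mem t u) x s = Mem (subst t x s) (subst u x s)"

text \<open>\<open>free_for s x t\<close>: the term \<open>s\<close> is free for \<open>x\<close> in \<open>t\<close>.\<close>

fun free_for :: "('g, 'f) trm \<Rightarrow> 'g var \<Rightarrow> ('g, 'f) trm \<Rightarrow> bool" where
  "free_for s x (Var v) = True"
| "free_for s x Star = True"
| "free_for s x (App h t) = free_for s x t"
| "free_for s x (Tup ts) = (\<forall>t \<in> set ts. free_for s x t)"
| "free_for s x (Proj i t) = free_for s x t"
| "free_for s x (Coll v a) = (x \<notin> fv a - {v} \<or> v \<notin> fv s \<and> free_for s x a)"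
| "free_for s x (Eq t u) = (free_for s x t \<and> free_for s x u)"
| "free_for s x (Mem t u) = (free_for s x t \<and> free_for s x u)"


section \<open>Defined logical and set-theoretic operations\<close>

definition fresh :: "'g ty \<Rightarrow> 'g var set \<Rightarrow> 'g var" where
  "fresh A V = Variable (LEAST n. Variable n A \<notin> V) A"

fun fresh_list :: "'g ty list \<Rightarrow> 'g var set \<Rightarrow> 'g var list" where
  "fresh_list [] V = []"
| "fresh_list (A # As) V = fresh A V # fresh_list As (insert (fresh A V) V)"

fun prod_ty :: "'g ty list \<Rightarrow> 'g ty" where
  "prod_ty [] = UnitT"
| "prod_ty [A] = A"
| "prod_ty (A # B # As) = ProdT (A # B # As)"

fun tuple :: "('g, 'f) trm list \<Rightarrow> ('g, 'f) trm" where
  "tuple [] = Star"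
| "tuple [t] = t"
| "tuple (s # t # ts) = Tup (s # t # ts)"

abbreviation pair :: "('g, 'f) trm \<Rightarrow> ('g, 'f) trm \<Rightarrow> ('g, 'f) trm" where
  "pair s t \<equiv> tuple [s, t]"

definition Tru :: "('g, 'f) trm" where
  "Tru = Eq Star Star"

abbreviation Iff :: "('g, 'f) trm \<Rightarrow> ('g, 'f) trm \<Rightarrow> ('g, 'f) trm" where
  "Iff a b \<equiv> Eq a b"

definition Conj :: "('g, 'f) trm \<Rightarrow> ('g, 'f) trm \<Rightarrow> ('g, 'f) trm" where
  "Conj a b = Eq (pair a b) (pair Tru Tru)"

definition Imp :: "('g, 'f) trm \<Rightarrow> ('g, 'f) trm \<Rightarrow> ('g, 'f) trm" where
  "Imp a b = Iff (Conj a b) a"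

definition Forall :: "'g var \<Rightarrow> ('g, 'f) trm \<Rightarrow> ('g, 'f) trm" where
  "Forall x a = Eq (Coll x a) (Coll x Tru)"

text \<open>\<open>\<exists>x \<alpha>\<close> is \<open>\<forall>\<omega> (\<forall>x (\<alpha> \<Rightarrow> \<omega>) \<Rightarrow> \<omega>)\<close> with \<open>\<omega>\<close> of type \<open>\<Omega>\<close>.\<close>

definition Exists :: "'g var \<Rightarrow> ('g, 'f) trm \<Rightarrow> ('g, 'f) trm" where
  "Exists x a = (let w = fresh OmegaT (insert x (vars a))
             in Forall w (Imp (Forall x (Imp a (Var w))) (Var w)))"

definition Exists_unique :: "'g var \<Rightarrow> ('g, 'f) trm \<Rightarrow> ('g, 'f) trm" where
  "Exists_unique x a = (let x' = fresh (vty x) (insert x (vars a))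
     in Exists x (Conj a (Forall x' (Imp (subst a x (Var x')) (Eq (Var x) (Var x'))))))"

fun Conj_list :: "('g, 'f) trm list \<Rightarrow> ('g, 'f) trm" where
  "Conj_list [] = Tru"
| "Conj_list [a] = a"
| "Conj_list (a # b # as) = Conj a (Conj_list (b # as))"

definition Exists_list :: "'g var list \<Rightarrow> ('g, 'f) trm \<Rightarrow> ('g, 'f) trm" where
  "Exists_list xs a = foldr Exists xs a"

text \<open>\<open>Compr xs \<tau> \<alpha>\<close> is \<open>{\<tau> : \<alpha>} = {z : \<exists>x\<^sub>1 \<dots> \<exists>x\<^sub>n (z = \<tau> \<and> \<alpha>)}\<close>, the variables \<open>xs\<close> being bound.\<close>

definition Compr :: "'g var list \<Rightarrow> ('g, 'f) trm \<Rightarrow> ('g, 'f) trm \<Rightarrow> ('g, 'f) trm" where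
  "Compr xs t a = (let z = fresh (ty_of t) (set xs \<union> vars t \<union> vars a)
     in Coll z (Exists_list xs (Conj (Eq (Var z) t) a)))"

definition elem_ty :: "('g, 'f) trm \<Rightarrow> 'g ty" where
  "elem_ty X = (case ty_of X of PowT A \<Rightarrow> A | _ \<Rightarrow> UnitT)"

definition USet :: "'g ty \<Rightarrow> ('g, 'f) trm" where
  "USet A = Coll (fresh A {}) Tru"

definition Subset :: "('g, 'f) trm \<Rightarrow> ('g, 'f) trm \<Rightarrow> ('g, 'f) trm" where
  "Subset X Y = (let x = fresh (elem_ty X) (vars X \<union> vars Y)
     in Forall x (Imp (Mem (Var x) X) (Mem (Var x) Y)))"

definition PowS :: "('g, 'f) trm \<Rightarrow> ('g, 'f) trm" where
  "PowS X = (let u = fresh (PowT (elem_ty X)) (vars X) in Coll u (Subset (Var u) X))"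

definition ProdS :: "('g, 'f) trm list \<Rightarrow> ('g, 'f) trm" where
  "ProdS Xs = (let xs = fresh_list (map elem_ty Xs) (\<Union>X \<in> set Xs. vars X)
     in Compr xs (tuple (map Var xs)) (Conj_list (map2 (\<lambda>x X. Mem (Var x) X) xs Xs)))"

text \<open>\<open>FunS X Y\<close> is \<open>Y\<^sup>X = {u : u \<in> P(X \<times> Y) \<and> \<forall>x\<in>X \<exists>!y\<in>Y \<langle>x,y\<rangle> \<in> u}\<close>.\<close>

definition FunS :: "('g, 'f) trm \<Rightarrow> ('g, 'f) trm \<Rightarrow> ('g, 'f) trm" where
  "FunS X Y =
     (let V = vars X \<union> vars Y;
          u = fresh (PowT (prod_ty [elem_ty X, elem_ty Y])) V;
          x = fresh (elem_ty X) (insert u V);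
          y = fresh (elem_ty Y) (insert x (insert u V))
      in Coll u (Conj (Mem (Var u) (PowS (ProdS [X, Y])))
           (Forall x (Imp (Mem (Var x) X)
             (Exists_unique y (Conj (Mem (Var y) Y) (Mem (pair (Var x) (Var y)) (Var u))))))))"


section \<open>Sequents, derivability and local set theories\<close>

type_synonym ('g, 'f) sequent = "('g, 'f) trm set \<times> ('g, 'f) trm"

definition sequents :: "('g, 'f) language \<Rightarrow> ('g, 'f) sequent set" where
  "sequents L = {(\<Gamma>, a). finite \<Gamma> \<and> (\<forall>g \<in> \<Gamma>. formula L g) \<and> formula L a}"

inductive derives ::
  "('g, 'f) language \<Rightarrow> ('g, 'f) sequent set \<Rightarrow> ('g, 'f) trm set \<Rightarrow> ('g, 'f) trm \<Rightarrow> bool"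
  for L :: "('g, 'f) language" and S :: "('g, 'f) sequent set" where
  given: "(\<Gamma>, a) \<in> S \<Longrightarrow> derives L S \<Gamma> a"
| tautology: "formula L a \<Longrightarrow> derives L S {a} a"
| unity: "vty x = UnitT \<Longrightarrow> derives L S {} (Eq (Var x) Star)"
| equality: "formula L a \<Longrightarrow> wf_ty L (vty z) \<Longrightarrow> vty x = vty z \<Longrightarrow> vty y = vty z \<Longrightarrow>
    free_for (Var x) z a \<Longrightarrow> free_for (Var y) z a \<Longrightarrow>
    derives L S {Eq (Var x) (Var y), subst a z (Var x)} (subst a z (Var y))"
| projection: "2 \<le> length xs \<Longrightarrow> \<forall>x \<in> set xs. wf_ty L (vty x) \<Longrightarrow> i < length xs \<Longrightarrow>
    derives L S {} (Eq (Proj i (Tup (map Var xs))) (Var (xs ! i)))"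
| surjective_pairing: "vty x = ProdT As \<Longrightarrow> wf_ty L (ProdT As) \<Longrightarrow>
    derives L S {} (Eq (Var x) (Tup (map (\<lambda>i. Proj i (Var x)) [0..<length As])))"
| comprehension: "formula L a \<Longrightarrow> wf_ty L (vty x) \<Longrightarrow>
    derives L S {} (Iff (Mem (Var x) (Coll x a)) a)"
| thinning: "derives L S \<Gamma> a \<Longrightarrow> formula L b \<Longrightarrow> derives L S (insert b \<Gamma>) a"
| restricted_cut: "derives L S \<Gamma> a \<Longrightarrow> derives L S (insert a \<Gamma>) b \<Longrightarrow>
    fv a \<subseteq> (\<Union>g \<in> \<Gamma>. fv g) \<union> fv b \<Longrightarrow> derives L S \<Gamma> b"
| substitution: "derives L S \<Gamma> a \<Longrightarrow> wf_trm L t \<Longrightarrow> ty_of t = vty x \<Longrightarrow>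
    \<forall>g \<in> insert a \<Gamma>. free_for t x g \<Longrightarrow>
    derives L S ((\<lambda>g. subst g x t) ` \<Gamma>) (subst a x t)"
| extensionality: "derives L S \<Gamma> (Iff (Mem (Var x) s) (Mem (Var x) t)) \<Longrightarrow>
    x \<notin> (\<Union>g \<in> \<Gamma>. fv g) \<union> fv s \<union> fv t \<Longrightarrow> derives L S \<Gamma> (Eq s t)"
| equivalence: "derives L S (insert a \<Gamma>) b \<Longrightarrow> derives L S (insert b \<Gamma>) a \<Longrightarrow>
    formula L a \<Longrightarrow> formula L b \<Longrightarrow> derives L S \<Gamma> (Iff a b)"

definition local_set_theory :: "('g, 'f) language \<Rightarrow> ('g, 'f) sequent set \<Rightarrow> bool" where
  "local_set_theory L S \<longleftrightarrow>
     local_language L \<and> S \<subseteq> sequents L \<and> (\<forall>\<Gamma> a. derives L S \<Gamma> a \<longrightarrow> (\<Gamma>, a) \<in> S)"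

text \<open>The preorder category on the formulae satisfying \<open>P\<close>, with an arrow from \<open>\<theta>\<close> to \<open>\<gamma>\<close> iff
  \<open>\<theta> \<turnstile>\<^sub>S \<gamma>\<close>. Arrows are pairs of formulae, so the arrow part of a functor between two such
  categories with object part \<open>T\<close> is \<open>map_prod T T\<close>.\<close>

definition formula_cat ::
  "('g, 'f) language \<Rightarrow> ('g, 'f) sequent set \<Rightarrow> (('g, 'f) trm \<Rightarrow> bool) \<Rightarrow>
   (('g, 'f) trm, ('g, 'f) trm \<times> ('g, 'f) trm) cat" where
  "formula_cat L S P = preorder_cat {a. formula L a \<and> P a} (\<lambda>a b. derives L S {a} b)"

definition F_cat ::
  "('g, 'f) language \<Rightarrow> ('g, 'f) sequent set \<Rightarrow>
   (('g, 'f) trm, ('g, 'f) trm \<times> ('g, 'f) trm) cat" where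
  "F_cat L S = formula_cat L S (\<lambda>_. True)"

definition F_cat_without ::
  "('g, 'f) language \<Rightarrow> ('g, 'f) sequent set \<Rightarrow> 'g var \<Rightarrow>
   (('g, 'f) trm, ('g, 'f) trm \<times> ('g, 'f) trm) cat" where
  "F_cat_without L S y = formula_cat L S (\<lambda>a. y \<notin> fv a)"


section \<open>\<open>S\<close>-sets and \<open>S\<close>-functions\<close>

definition S_set :: "('g, 'f) language \<Rightarrow> ('g, 'f) trm \<Rightarrow> bool" where
  "S_set L X \<longleftrightarrow> wf_trm L X \<and> (\<exists>A. ty_of X = PowT A) \<and> fv X = {}"

datatype ('g, 'f) sfun =
  SFun (graph: "('g, 'f) trm") (src: "('g, 'f) trm") (tgt: "('g, 'f) trm")

definition S_function ::
  "('g, 'f) language \<Rightarrow> ('g, 'f) sequent set \<Rightarrow> ('g, 'f) sfun \<Rightarrow> bool" where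
  "S_function L S f \<longleftrightarrow>
     S_set L (graph f) \<and> S_set L (src f) \<and> S_set L (tgt f) \<and>
     derives L S {} (Mem (graph f) (FunS (src f) (tgt f)))"

text \<open>\<open>mapsto xs \<tau> X Y\<close> is \<open>(\<langle>x\<^sub>1,\<dots>,x\<^sub>n\<rangle> \<mapsto> \<tau>) : X \<rightarrow> Y\<close>, with graph
  \<open>{\<langle>\<langle>x\<^sub>1,\<dots>,x\<^sub>n\<rangle>,\<tau>\<rangle> : \<langle>x\<^sub>1,\<dots>,x\<^sub>n\<rangle> \<in> X}\<close>.\<close>

definition mapsto ::
  "'g var list \<Rightarrow> ('g, 'f) trm \<Rightarrow> ('g, 'f) trm \<Rightarrow> ('g, 'f) trm \<Rightarrow> ('g, 'f) sfun" where
  "mapsto xs t X Y =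
     SFun (Compr xs (pair (tuple (map Var xs)) t) (Mem (tuple (map Var xs)) X)) X Y"

definition id_sfun :: "('g, 'f) trm \<Rightarrow> ('g, 'f) sfun" where
  "id_sfun X = (let x = fresh (elem_ty X) (vars X) in mapsto [x] (Var x) X X)"

definition comp_sfun :: "('g, 'f) sfun \<Rightarrow> ('g, 'f) sfun \<Rightarrow> ('g, 'f) sfun" where
  "comp_sfun g f =
     (let V = vars (graph f) \<union> vars (graph g);
          x = fresh (elem_ty (src f)) V;
          y = fresh (elem_ty (tgt f)) (insert x V);
          z = fresh (elem_ty (tgt g)) (insert y (insert x V))
      in SFun (Compr [x, z] (pair (Var x) (Var z))
                 (Exists y (Conj (Mem (pair (Var x) (Var y)) (graph f))
                             (Mem (pair (Var y) (Var z)) (graph g)))))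
              (src f) (tgt g))"

text \<open>The product \<open>f\<^sub>1 \<times> \<dots> \<times> f\<^sub>n\<close>, with graph
  \<open>{\<langle>\<langle>x\<^sub>1,\<dots>,x\<^sub>n\<rangle>,\<langle>y\<^sub>1,\<dots>,y\<^sub>n\<rangle>\<rangle> : \<langle>x\<^sub>1,y\<^sub>1\<rangle> \<in> |f\<^sub>1| \<and> \<dots> \<and> \<langle>x\<^sub>n,y\<^sub>n\<rangle> \<in> |f\<^sub>n|}\<close>.\<close>

definition prod_sfun :: "('g, 'f) sfun list \<Rightarrow> ('g, 'f) sfun" where
  "prod_sfun fs =
     (let V = (\<Union>f \<in> set fs. vars (graph f));
          xs = fresh_list (map (elem_ty \<circ> src) fs) V;
          ys = fresh_list (map (elem_ty \<circ> tgt) fs) (V \<union> set xs)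
      in SFun (Compr (xs @ ys) (pair (tuple (map Var xs)) (tuple (map Var ys)))
                 (Conj_list (map2 (\<lambda>(x, y) f. Mem (pair (Var x) (Var y)) (graph f)) (zip xs ys) fs)))
              (ProdS (map src fs)) (ProdS (map tgt fs)))"


section \<open>The preimage translation\<close>

text \<open>\<open>canon_interp ys \<theta>\<close> is the canonical interpretation of \<open>\<theta>\<close> in the linguistic topos,
  \<open>(\<langle>y\<^sub>1,\<dots>,y\<^sub>n\<rangle> \<mapsto> \<theta>) : U\<^sub>B\<^sub>1 \<times> \<dots> \<times> U\<^sub>B\<^sub>n \<rightarrow> \<Omega>\<close> with \<open>B\<^sub>i\<close> the type of \<open>y\<^sub>i\<close>.\<close>

definition canon_interp :: "'g var list \<Rightarrow> ('g, 'f) trm \<Rightarrow> ('g, 'f) sfun" where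
  "canon_interp ys a = mapsto ys a (ProdS (map (USet \<circ> vty) ys)) (USet OmegaT)"

definition inclusion :: "'g var \<Rightarrow> ('g, 'f) trm \<Rightarrow> ('g, 'f) sfun" where
  "inclusion y Y = mapsto [y] (Var y) Y (USet (vty y))"

text \<open>\<open>one_times ys y h\<close> is \<open>1 \<times> h\<close>: \<open>h\<close> at the coordinate of \<open>y\<close> in \<open>ys\<close>, the identity of \<open>U\<^sub>B\<close>
  at every other coordinate, where \<open>B\<close> is the type of the variable at that coordinate.\<close>

definition one_times :: "'g var list \<Rightarrow> 'g var \<Rightarrow> ('g, 'f) sfun \<Rightarrow> ('g, 'f) sfun" where
  "one_times ys y h = prod_sfun (map (\<lambda>v. if v = y then h else id_sfun (USet (vty v))) ys)"

text \<open>\<open>natural_formula g t\<close> is \<open>g\<^sup>\<natural>(t)\<close>.\<close>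

definition natural_formula :: "('g, 'f) sfun \<Rightarrow> ('g, 'f) trm \<Rightarrow> ('g, 'f) trm" where
  "natural_formula g t = Mem (pair t Tru) (graph g)"

definition admissible_seq ::
  "('g, 'f) language \<Rightarrow> 'g var \<Rightarrow> ('g, 'f) trm \<Rightarrow> 'g var list \<Rightarrow> bool" where
  "admissible_seq L y a ys \<longleftrightarrow>
     distinct ys \<and> (\<forall>v \<in> set ys. wf_ty L (vty v)) \<and> fv a \<union> {y} \<subseteq> set ys"

definition translation ::
  "'g var list \<Rightarrow> ('g, 'f) sfun \<Rightarrow> 'g var \<Rightarrow> 'g var \<Rightarrow> ('g, 'f) trm \<Rightarrow> ('g, 'f) trm" where
  "translation ys f x y a =
     natural_formula
       (comp_sfun (comp_sfun (canon_interp ys a) (one_times ys y (inclusion y (tgt f))))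
                  (one_times ys y f))
       (tuple (map Var (map (\<lambda>v. if v = y then x else v) ys)))"

definition E_map :: "('g, 'f) sfun \<Rightarrow> 'g var \<Rightarrow> 'g var \<Rightarrow> ('g, 'f) trm \<Rightarrow> ('g, 'f) trm" where
  "E_map f x y a = Imp (Mem (pair (Var x) (Var y)) (graph f)) a"

end

theory Submission
  imports Defs
begin

text \<open>
  Everything follows from two entailments about the translation \<open>T \<theta>\<close>, which says that
  \<open>\<exists>y (\<langle>x,y\<rangle> \<in> |f| \<and> \<theta>)\<close>: the sequent \<open>\<theta>, \<langle>x,y\<rangle> \<in> |f| \<turnstile> T \<theta>\<close>, and the rule that
  \<open>\<theta>, \<langle>x,y\<rangle> \<in> |f| \<turnstile> \<xi>\<close> implies \<open>T \<theta> \<turnstile> \<xi>\<close> when \<open>y\<close> is not free in \<open>\<xi>\<close>. Together with unrestricted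
  cut they give the adjunction, and monotonicity because \<open>y\<close> is not free in \<open>T \<theta>\<close>.

  The graphs involved are closed terms whose bound variables may clash with the variables of
  \<open>\<theta>\<close>, \<open>\<xi>\<close>, \<open>x\<close> and \<open>y\<close>, while substitution does not rename. So the graphs are only ever applied
  to fresh variables, which are tied to the intended terms by equations \<open>u = s\<close>; such an equation
  can be discharged once \<open>u\<close> occurs nowhere else.
\<close>

section \<open>Substitution and variables\<close>

text \<open>The translation is not given as an existential formula but as membership in the graph of
  a composite of three maps: \<open>1 \<times> f\<close>, \<open>1 \<times> i_Y\<close> and the
  canonical interpretation. The first exchanges an argument of \<open>f\<close> for a value at the
  coordinate of \<open>y\<close>, the second relates equal tuples only but requires that value to
  lie in \<open>tgt f\<close>, the third reads off a truth value. A pair in the composite graph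
  therefore passes through the points \<open>p\<close>, \<open>u\<close>, \<open>v\<close>,
  \<open>q\<close>. For the first entailment they are set equal to the tuple with \<open>x\<close>,
  twice to the tuple with \<open>y\<close>, and to true. For the second they are generic: the
  formula holds at the components of \<open>v\<close>, each component away from \<open>y\<close> is
  forced to be the variable at that coordinate, and \<open>y\<close> may be equated with the
  remaining one because it is not free in the conclusion. The cut rule of the calculus restricts the
  free variables of the cut formula. The Nullstellensatz lifts the restriction, since each stray
  variable can be replaced by a closed term of its type.\<close>

fun bv :: "('g, 'f) trm \<Rightarrow> 'g var set" where
  "bv (Var v) = {}"
| "bv Star = {}"
| "bv (App h t) = bv t"
| "bv (Tup ts) = (\<Union>t \<in> set ts. bv t)"
| "bv (Proj i t) = bv t"
| "bv (Coll v a) = insert v (bv a)"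
| "bv (Eq s t) = bv s \<union> bv t"
| "bv (Mem s t) = bv s \<union> bv t"

lemma finite_vars [simp]: "finite (vars t)"
  by (induct t) auto

lemma fv_subset_vars: "fv t \<subseteq> vars t"
  by (induct t) auto

lemma bv_subset_vars: "bv t \<subseteq> vars t"
  by (induct t) auto

lemma finite_fv [simp]: "finite (fv t)"
  using finite_subset [OF fv_subset_vars] by simp

lemma subst_notin_fv: "x \<notin> fv t \<Longrightarrow> subst t x s = t"
  by (induct t) (auto intro: map_idI)

lemma free_for_notin_fv: "x \<notin> fv t \<Longrightarrow> free_for s x t"
  by (induct t) auto

lemma free_for_disjoint_bv: "fv s \<inter> bv t = {} \<Longrightarrow> free_for s x t"
  by (induct t) auto

lemma free_for_disjoint_vars: "fv s \<inter> vars t = {} \<Longrightarrow> free_for s x t"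
  using bv_subset_vars [of t] by (intro free_for_disjoint_bv) auto

lemma ty_of_subst [simp]: "ty_of s = vty x \<Longrightarrow> ty_of (subst t x s) = ty_of t"
  by (induct t) (auto cong: map_cong)

lemma wf_subst: "wf_trm L s \<Longrightarrow> ty_of s = vty x \<Longrightarrow> wf_trm L t \<Longrightarrow> wf_trm L (subst t x s)"
  by (induct t) auto

lemma fv_subst_subset: "fv (subst t x s) \<subseteq> (fv t - {x}) \<union> fv s"
  by (induct t) (auto split: if_splits)

lemma bv_subst_subset: "bv (subst t x s) \<subseteq> bv t \<union> bv s"
  by (induct t) (auto split: if_splits)

text \<open>Lets a substitution of \<open>s\<close> pass through a fresh variable \<open>w\<close>,
  as Leibniz's law for terms requires. Bound occurrences of \<open>w\<close> have to be excluded
  too: a binder of \<open>w\<close> would capture the new variable and block the second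
  substitution.\<close>

lemma subst_subst_var: "w \<notin> vars t \<Longrightarrow> subst (subst t x (Var w)) w s = subst t x s"
proof (induct t)
  case (Coll v a)
  have "w \<notin> fv a" using Coll(2) fv_subset_vars[of a] by auto
  with Coll show ?case by (auto simp: subst_notin_fv)
qed auto

lemma free_for_subst_var:
  "w \<notin> vars t \<Longrightarrow> free_for s x t \<Longrightarrow> free_for s w (subst t x (Var w))"
proof (induct t)
  case (Coll v a)
  have w: "w \<notin> fv a" using Coll(2) fv_subset_vars[of a] by auto
  show ?case
  proof (cases "x \<in> fv a - {v}")
    case True
    with Coll show ?thesis by auto
  next
    case False
    with w show ?thesis by (auto simp: subst_notin_fv)
  qed
qed auto

lemma fresh_notin: "finite V \<Longrightarrow> fresh A V \<notin> V"
proof -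
  assume V: "finite V"
  have "\<exists>n. Variable n A \<notin> V"
  proof (rule ccontr)
    assume "\<not> ?thesis"
    then have "range (\<lambda>n. Variable n A) \<subseteq> V" by auto
    then have "finite (range (\<lambda>n. Variable n A))" using V finite_subset by blast
    moreover have "inj (\<lambda>n. Variable n A)" by (auto simp: inj_on_def)
    ultimately show False using finite_imageD infinite_UNIV_nat by blast
  qed
  then show ?thesis unfolding fresh_def by (rule LeastI_ex)
qed

lemma vty_fresh [simp]: "vty (fresh A V) = A"
  by (simp add: fresh_def)

lemma fresh_list_props:
  "finite V \<Longrightarrow> length (fresh_list As V) = length As \<and> map vty (fresh_list As V) = As \<and>
     distinct (fresh_list As V) \<and> set (fresh_list As V) \<inter> V = {}"
proof (induct As arbitrary: V)
  case (Cons A As)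
  have "fresh A V \<notin> V" using Cons(2) by (rule fresh_notin)
  moreover note Cons(1)[of "insert (fresh A V) V"] Cons(2)
  ultimately show ?case by auto
qed auto

section \<open>Typing and free variables of the defined operations\<close>

lemma formula_Eq [simp]: "formula L (Eq s t) \<longleftrightarrow> wf_trm L s \<and> wf_trm L t \<and> ty_of s = ty_of t"
  by (simp add: formula_def)

lemma formula_Mem [simp]:
  "formula L (Mem s t) \<longleftrightarrow> wf_trm L s \<and> wf_trm L t \<and> ty_of t = PowT (ty_of s)"
  by (simp add: formula_def)

lemma formula_Tru [simp]: "formula L Tru"
  by (simp add: Tru_def)

lemma formula_Conj [simp]: "formula L (Conj a b) \<longleftrightarrow> formula L a \<and> formula L b"
  using formula_Tru[of L] by (auto simp: Conj_def formula_def)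

lemma formula_Imp [simp]: "formula L (Imp a b) \<longleftrightarrow> formula L a \<and> formula L b"
  using formula_Conj[of L a b] by (auto simp: Imp_def formula_def Conj_def)

lemma formula_Forall [simp]: "formula L (Forall x a) \<longleftrightarrow> wf_ty L (vty x) \<and> formula L a"
  using formula_Tru[of L] by (auto simp: Forall_def formula_def)

lemma formula_Exists [simp]: "formula L (Exists x a) \<longleftrightarrow> wf_ty L (vty x) \<and> formula L a"
  by (auto simp: Exists_def Let_def formula_def[of L "Var _"])

lemma wf_Coll: "wf_trm L (Coll x a) \<longleftrightarrow> wf_ty L (vty x) \<and> formula L a"
  by (simp add: formula_def)

lemma fv_Tru [simp]: "fv Tru = {}"
  by (simp add: Tru_def)

lemma fv_Conj [simp]: "fv (Conj a b) = fv a \<union> fv b"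
  by (simp add: Conj_def)

lemma fv_Imp [simp]: "fv (Imp a b) = fv a \<union> fv b"
  by (auto simp: Imp_def)

lemma fv_Forall [simp]: "fv (Forall x a) = fv a - {x}"
  by (simp add: Forall_def)

lemma fresh_fv: "finite V \<Longrightarrow> vars a \<subseteq> V \<Longrightarrow> fresh A V \<notin> fv a"
  using fresh_notin[of V A] fv_subset_vars[of a] by auto

lemma fv_Exists [simp]: "fv (Exists x a) = fv a - {x}"
  using fresh_fv[of "insert x (vars a)" a OmegaT] fresh_notin[of "insert x (vars a)" OmegaT]
  by (auto simp: Exists_def Let_def)

lemma vars_Conj [simp]: "vars (Conj a b) = vars a \<union> vars b"
  by (auto simp: Conj_def Tru_def)

lemma vars_Imp [simp]: "vars (Imp a b) = vars a \<union> vars b"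
  by (auto simp: Imp_def)

lemma vars_Forall [simp]: "vars (Forall x a) = insert x (vars a)"
  by (auto simp: Forall_def Tru_def)

lemma vars_Exists: "insert x (vars a) \<subseteq> vars (Exists x a)"
  by (auto simp: Exists_def Let_def)

lemma subst_Conj [simp]: "subst (Conj a b) x s = Conj (subst a x s) (subst b x s)"
  by (simp add: Conj_def Tru_def)

lemma subst_Imp [simp]: "subst (Imp a b) x s = Imp (subst a x s) (subst b x s)"
  by (simp add: Imp_def)

lemma subst_Forall [simp]:
  "subst (Forall v a) x s = (if v = x then Forall v a else Forall v (subst a x s))"
  by (simp add: Forall_def Tru_def)

lemma free_for_Conj [simp]: "free_for s x (Conj a b) \<longleftrightarrow> free_for s x a \<and> free_for s x b"
  by (auto simp: Conj_def Tru_def)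

lemma free_for_Imp [simp]: "free_for s x (Imp a b) \<longleftrightarrow> free_for s x a \<and> free_for s x b"
  by (auto simp: Imp_def)

lemma free_for_Forall [simp]:
  "free_for s x (Forall v a) \<longleftrightarrow> x \<notin> fv a - {v} \<or> v \<notin> fv s \<and> free_for s x a"
  by (auto simp: Forall_def Tru_def)

section \<open>Natural deduction in a local set theory\<close>

locale lst =
  fixes L :: "('g, 'f) language" and S :: "('g, 'f) sequent set"
  assumes lst: "local_set_theory L S"
    and nullst: "nullstellensatz L"
begin

abbreviation entails :: "('g, 'f) trm set \<Rightarrow> ('g, 'f) trm \<Rightarrow> bool" (infix "\<turnstile>" 45) where
  "\<Gamma> \<turnstile> a \<equiv> derives L S \<Gamma> a"

definition ctx :: "('g, 'f) trm set \<Rightarrow> bool" where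
  "ctx \<Gamma> \<longleftrightarrow> finite \<Gamma> \<and> (\<forall>g \<in> \<Gamma>. formula L g)"

lemma ctx_insert [simp]: "ctx (insert a \<Gamma>) \<longleftrightarrow> formula L a \<and> ctx \<Gamma>"
  by (auto simp: ctx_def)

lemma ctx_empty [simp]: "ctx {}"
  by (simp add: ctx_def)

lemma ctx_Un [simp]: "ctx (\<Gamma> \<union> \<Delta>) \<longleftrightarrow> ctx \<Gamma> \<and> ctx \<Delta>"
  by (auto simp: ctx_def)

lemma entails_wf: "\<Gamma> \<turnstile> a \<Longrightarrow> ctx \<Gamma> \<and> formula L a"
  using lst by (force simp: local_set_theory_def sequents_def ctx_def)

section \<open>Structural rules: weakening, substitution and unrestricted cut\<close>

lemma weaken:
  assumes "\<Gamma> \<turnstile> a" "\<Gamma> \<subseteq> \<Delta>" "ctx \<Delta>"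
  shows "\<Delta> \<turnstile> a"
proof -
  have "finite \<Delta>'" if "\<Delta>' \<subseteq> \<Delta>" for \<Delta>'
    using that assms(3) finite_subset by (auto simp: ctx_def)
  moreover have "\<Gamma> \<union> \<Delta>' \<turnstile> a" if "finite \<Delta>'" "\<Delta>' \<subseteq> \<Delta>" for \<Delta>'
    using that
  proof (induct rule: finite_induct)
    case empty
    then show ?case using assms(1) by simp
  next
    case (insert b B)
    then show ?case using thinning[of L S "\<Gamma> \<union> B" a b] assms(3) by (auto simp: ctx_def)
  qed
  ultimately have "\<Gamma> \<union> \<Delta> \<turnstile> a" by blast
  then show ?thesis using assms(2) by (simp add: sup.absorb2)
qed

lemma hyp: "ctx \<Gamma> \<Longrightarrow> a \<in> \<Gamma> \<Longrightarrow> \<Gamma> \<turnstile> a"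
  by (rule weaken [OF tautology]) (auto simp: ctx_def)

text \<open>The Nullstellensatz enters here, as the source of closed terms of ground type. At the
  other types \<open>Star\<close>, \<open>Tru\<close>, a universal set and tuples of closed terms
  serve.\<close>

lemma closed_term_exists: "wf_ty L A \<Longrightarrow> \<exists>t. wf_trm L t \<and> ty_of t = A \<and> fv t = {}"
proof (induct A)
  case UnitT
  show ?case by (rule exI[of _ Star]) simp
next
  case OmegaT
  show ?case using formula_Tru[of L] by (intro exI[of _ Tru]) (auto simp: formula_def)
next
  case (GroundT G)
  then obtain h where "h \<in> funs L" "fdom h = UnitT" "fcod h = GroundT G"
    using nullst by (auto simp: nullstellensatz_def)
  then show ?case by (intro exI[of _ "App h Star"]) simp
next
  case (PowT A)
  then show ?case
    by (intro exI[of _ "Coll (fresh A {}) Tru"]) (simp add: wf_Coll del: wf_trm.simps(6))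
next
  case (ProdT As)
  then have "\<forall>A \<in> set As. \<exists>t. wf_trm L t \<and> ty_of t = A \<and> fv t = {}" by simp
  then obtain c where c: "\<forall>A \<in> set As. wf_trm L (c A) \<and> ty_of (c A) = A \<and> fv (c A) = {}"
    by metis
  then have "map (\<lambda>A. ty_of (c A)) As = As" by (simp add: map_idI)
  with c ProdT(2) show ?case by (intro exI[of _ "Tup (map c As)"]) (auto simp: comp_def)
qed

lemma wf_fv: "wf_trm L t \<Longrightarrow> v \<in> fv t \<Longrightarrow> wf_ty L (vty v)"
  by (induct t) auto

lemma substitute:
  assumes "\<Gamma> \<turnstile> a" "wf_trm L t" "ty_of t = vty x"
    "free_for t x a" "\<And>g. g \<in> \<Gamma> \<Longrightarrow> free_for t x g"
    "\<Delta> = (\<lambda>g. subst g x t) ` \<Gamma>" "b = subst a x t"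
  shows "\<Delta> \<turnstile> b"
  using substitution[of L S \<Gamma> a t x] assms by auto

text \<open>Restricted cut forbids free variables of \<open>a\<close> that occur neither in \<Gamma>
  nor in \<open>b\<close>. A closed term put for such a variable changes neither \<Gamma> nor
  \<open>b\<close>, so both premises survive with one stray variable fewer. The induction is on a
  finite set \<open>W\<close> that contains all stray variables.\<close>

lemma cut:
  assumes "\<Gamma> \<turnstile> a" "insert a \<Gamma> \<turnstile> b"
  shows "\<Gamma> \<turnstile> b"
proof -
  define V where "V = (\<Union>g\<in>\<Gamma>. fv g) \<union> fv b"
  have "\<Gamma> \<turnstile> b" if "finite W" "fv a \<subseteq> V \<union> W" "\<Gamma> \<turnstile> a" "insert a \<Gamma> \<turnstile> b" for a W
    using that
  proof (induct W arbitrary: a rule: finite_induct)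
    case empty
    then show ?case using restricted_cut[of L S \<Gamma> a b] by (auto simp: V_def)
  next
    case (insert w W)
    show ?case
    proof (cases "w \<in> V \<or> w \<notin> fv a")
      case True
      then show ?thesis using insert by blast
    next
      case False
      have "wf_trm L a" using entails_wf[OF insert(5)] by (simp add: formula_def)
      then have "wf_ty L (vty w)" using wf_fv False by blast
      then obtain t where t: "wf_trm L t" "ty_of t = vty w" "fv t = {}"
        using closed_term_exists by blast
      have ff: "free_for t w c" for c using t(3) by (simp add: free_for_disjoint_bv)
      have "subst g w t = g" if "g \<in> insert b \<Gamma>" for g
        using False that by (intro subst_notin_fv) (auto simp: V_def)
      then have id: "(\<lambda>g. subst g w t) ` \<Gamma> = \<Gamma>" "subst b w t = b"
        by auto
      have "\<Gamma> \<turnstile> subst a w t"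
        by (rule substitute[OF insert(5) t(1,2) ff ff]) (simp_all add: id)
      moreover have "insert (subst a w t) \<Gamma> \<turnstile> b"
        by (rule substitute[OF insert(6) t(1,2) ff ff]) (simp_all add: id)
      moreover have "fv (subst a w t) \<subseteq> V \<union> W"
        using fv_subst_subset[of a w t] t(3) insert(4) by auto
      ultimately show ?thesis using insert(3) by blast
    qed
  qed
  from this[of "fv a" a] assms show ?thesis by auto
qed

lemma cut1: "{a} \<turnstile> b \<Longrightarrow> \<Gamma> \<turnstile> a \<Longrightarrow> \<Gamma> \<turnstile> b"
  using cut[of \<Gamma> a b] weaken[of "{a}" b "insert a \<Gamma>"] entails_wf[of \<Gamma> a] by auto

lemma cut2: "{a, b} \<turnstile> c \<Longrightarrow> \<Gamma> \<turnstile> a \<Longrightarrow> \<Gamma> \<turnstile> b \<Longrightarrow> \<Gamma> \<turnstile> c"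
proof -
  assume *: "{a, b} \<turnstile> c" "\<Gamma> \<turnstile> a" "\<Gamma> \<turnstile> b"
  have c: "ctx (insert b (insert a \<Gamma>))" using * entails_wf by auto
  have "insert b (insert a \<Gamma>) \<turnstile> c" by (rule weaken[OF *(1) _ c]) auto
  moreover have "insert a \<Gamma> \<turnstile> b" by (rule weaken[OF *(3)]) (use c in auto)
  ultimately have "insert a \<Gamma> \<turnstile> c" using cut by blast
  with *(2) show ?thesis using cut by blast
qed

lemma cut_set:
  assumes "\<Delta> \<turnstile> b" "\<And>d. d \<in> \<Delta> \<Longrightarrow> \<Gamma> \<turnstile> d" "ctx \<Gamma>"
  shows "\<Gamma> \<turnstile> b"
proof -
  have "finite \<Delta>" using entails_wf[OF assms(1)] by (simp add: ctx_def)
  then have "\<Delta> \<union> \<Gamma> \<turnstile> b \<Longrightarrow> (\<And>d. d \<in> \<Delta> \<Longrightarrow> \<Gamma> \<turnstile> d) \<Longrightarrow> \<Gamma> \<turnstile> b"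
  proof (induct \<Delta> rule: finite_induct)
    case (insert d D)
    have "D \<union> \<Gamma> \<turnstile> d"
      by (rule weaken[OF insert(5)[of d]]) (use entails_wf[OF insert(4)] in auto)
    then have "D \<union> \<Gamma> \<turnstile> b" using insert(4) cut by auto
    then show ?case using insert by auto
  qed auto
  moreover have "\<Delta> \<union> \<Gamma> \<turnstile> b"
    by (rule weaken[OF assms(1)]) (use entails_wf[OF assms(1)] assms(3) in auto)
  ultimately show ?thesis using assms(2) by blast
qed

lemma theorem_weaken: "{} \<turnstile> a \<Longrightarrow> ctx \<Gamma> \<Longrightarrow> \<Gamma> \<turnstile> a"
  by (rule weaken) auto

subsection \<open>Equality\<close>

text \<open>Reflexivity is not among the rules. The projection axiom makes a component of the pair
  of \<open>x\<close> with itself equal to \<open>x\<close>, and the equality axiom turns this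
  equation into \<open>x = x\<close>.\<close>

lemma eq_refl_var: "wf_ty L (vty x) \<Longrightarrow> {} \<turnstile> Eq (Var x) (Var x)"
proof -
  assume w: "wf_ty L (vty x)"
  define u where "u = fresh (vty x) {x}"
  have u: "u \<noteq> x" "vty u = vty x" using fresh_notin[of "{x}" "vty x"] by (auto simp: u_def)
  define p :: "('g, 'f) trm" where "p = Proj 0 (Tup (map Var [x, x]))"
  have p: "wf_trm L p" "ty_of p = vty x" "fv p = {x}" using w by (auto simp: p_def)
  have 1: "{} \<turnstile> Eq p (Var x)"
    using projection[of "[x, x]" L 0 S] w by (simp add: p_def)
  \<comment> \<open>With \<open>u = x\<close> as the formula and \<open>u\<close> as the variable of
    substitution, the two hypotheses of the equality axiom coincide and its conclusion is
    \<open>x = x\<close>.\<close>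
  have "{Eq (Var u) (Var x), subst (Eq (Var u) (Var x)) u (Var u)} \<turnstile> subst (Eq (Var u) (Var x)) u (Var x)"
    by (rule equality) (use w u in auto)
  then have "{Eq (Var u) (Var x)} \<turnstile> Eq (Var x) (Var x)" using u by simp
  then have "{Eq p (Var x)} \<turnstile> Eq (Var x) (Var x)"
    by (rule substitute[where t = p and x = u]) (use u p in auto)
  with 1 show ?thesis using cut1 by blast
qed

lemma eq_refl: "wf_trm L t \<Longrightarrow> wf_ty L (ty_of t) \<Longrightarrow> ctx \<Gamma> \<Longrightarrow> \<Gamma> \<turnstile> Eq t t"
proof -
  assume t: "wf_trm L t" "wf_ty L (ty_of t)" "ctx \<Gamma>"
  have "{} \<turnstile> Eq (Var (fresh (ty_of t) {})) (Var (fresh (ty_of t) {}))"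
    by (rule eq_refl_var) (use t in simp)
  then have "{} \<turnstile> Eq t t"
    by (rule substitute[where t = t and x = "fresh (ty_of t) {}"]) (use t in auto)
  with t show ?thesis by (simp add: theorem_weaken)
qed

text \<open>The equality axiom speaks of variables only. It is taken at fresh \<open>u\<close> and
  \<open>v\<close>, which are then replaced by \<open>s\<close> and \<open>t\<close>; as they avoid
  all variables of \<open>a\<close>, no capture arises on the way.\<close>

lemma leibniz:
  assumes "\<Gamma> \<turnstile> Eq s t" "\<Gamma> \<turnstile> subst a z s" "formula L a" "wf_ty L (vty z)"
    "ty_of s = vty z" "free_for s z a" "free_for t z a"
  shows "\<Gamma> \<turnstile> subst a z t"
proof -
  have st: "wf_trm L s" "wf_trm L t" "ty_of t = vty z"
    using entails_wf[OF assms(1)] assms(5) by auto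
  define V where "V = insert z (vars a \<union> vars s \<union> vars t)"
  define u where "u = fresh (vty z) V"
  define v where "v = fresh (vty z) (insert u V)"
  have "u \<notin> V" "v \<notin> insert u V" unfolding u_def v_def by (rule fresh_notin, simp add: V_def)+
  then have u: "u \<notin> vars a" "u \<noteq> z" "u \<notin> fv s" "u \<notin> fv t" and
    v: "v \<notin> vars a" "v \<noteq> z" "v \<notin> fv s" "v \<notin> fv t" and uv: "u \<noteq> v"
    using fv_subset_vars[of s] fv_subset_vars[of t] by (auto simp: V_def)
  have [simp]: "vty u = vty z" "vty v = vty z" by (simp_all add: u_def v_def)
  have au: "u \<notin> fv a" "v \<notin> fv a" using u v fv_subset_vars[of a] by auto
  have nu: "u \<notin> fv (subst a z (Var v))" "v \<notin> fv (subst a z s)"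
    using fv_subst_subset[of a z "Var v"] fv_subst_subset[of a z s] au uv v by auto
  have "{Eq (Var u) (Var v), subst a z (Var u)} \<turnstile> subst a z (Var v)"
    by (rule equality) (use assms u v in \<open>auto intro!: free_for_disjoint_vars\<close>)
  then have "{Eq s (Var v), subst a z s} \<turnstile> subst a z (Var v)"
    by (rule substitute[where t = s and x = u])
      (use assms st u v uv nu in \<open>auto simp: subst_subst_var free_for_subst_var
        subst_notin_fv free_for_notin_fv\<close>)
  then have "{Eq s t, subst a z s} \<turnstile> subst a z t"
    by (rule substitute[where t = t and x = v])
      (use assms st u v uv nu in \<open>auto simp: subst_subst_var free_for_subst_var
        subst_notin_fv free_for_notin_fv\<close>)
  then show ?thesis using assms(1,2) cut2 by blast
qed

lemma wf_ty_of: "wf_trm L t \<Longrightarrow> wf_ty L (ty_of t)"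
proof (induct t)
  case (App h t)
  then show ?case using lst by (simp add: local_set_theory_def local_language_def)
qed (auto split: ty.splits)

lemma eq_reflI [intro]: "wf_trm L t \<Longrightarrow> ctx \<Gamma> \<Longrightarrow> \<Gamma> \<turnstile> Eq t t"
  by (simp add: eq_refl wf_ty_of)

lemma eq_wf: "\<Gamma> \<turnstile> Eq s t \<Longrightarrow> wf_trm L s \<and> wf_trm L t \<and> ty_of s = ty_of t \<and> ctx \<Gamma> \<and> wf_ty L (ty_of t)"
  using entails_wf[of \<Gamma> "Eq s t"] wf_ty_of[of t] by auto

text \<open>Leibniz's law for the formula \<open>c(s) = c\<close> in \<open>z\<close>, starting from
  reflexivity. If \<open>z\<close> were free in \<open>s\<close>, the left side would change along
  with the right one.\<close>

lemma eq_cong: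
  assumes st: "\<Gamma> \<turnstile> Eq s t" and c: "wf_trm L c" "vty z = ty_of s"
    "free_for s z c" "free_for t z c" and z: "z \<notin> fv s"
  shows "\<Gamma> \<turnstile> Eq (subst c z s) (subst c z t)"
proof -
  note w = eq_wf[OF st]
  have z': "z \<notin> fv (subst c z s)" using z fv_subst_subset[of c z s] by auto
  have wc: "wf_trm L (subst c z s)" using w c by (simp add: wf_subst)
  have "\<Gamma> \<turnstile> subst (Eq (subst c z s) c) z t"
  proof (rule leibniz[OF st])
    show "\<Gamma> \<turnstile> subst (Eq (subst c z s) c) z s"
      using z' wc w by (simp add: subst_notin_fv eq_reflI)
  qed (use w c z' wc in \<open>auto simp: free_for_notin_fv\<close>)
  then show ?thesis using z' by (simp add: subst_notin_fv)
qed

lemma eq_sym: "\<Gamma> \<turnstile> Eq s t \<Longrightarrow> \<Gamma> \<turnstile> Eq t s"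
proof -
  assume st: "\<Gamma> \<turnstile> Eq s t"
  note w = eq_wf[OF st]
  define z where "z = fresh (ty_of s) (vars s)"
  have z: "z \<notin> fv s" "vty z = ty_of s" unfolding z_def by (rule fresh_fv) auto
  have "\<Gamma> \<turnstile> subst (Eq (Var z) s) z t"
    by (rule leibniz[OF st]) (use w z in \<open>auto simp: subst_notin_fv free_for_notin_fv\<close>)
  with z show ?thesis by (simp add: subst_notin_fv)
qed

lemma eq_trans: "\<Gamma> \<turnstile> Eq r s \<Longrightarrow> \<Gamma> \<turnstile> Eq s t \<Longrightarrow> \<Gamma> \<turnstile> Eq r t"
proof -
  assume st: "\<Gamma> \<turnstile> Eq s t" and rs: "\<Gamma> \<turnstile> Eq r s"
  note w = eq_wf[OF st] eq_wf[OF rs]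
  define z where "z = fresh (ty_of s) (vars r)"
  have z: "z \<notin> fv r" "vty z = ty_of s" unfolding z_def by (rule fresh_fv) auto
  have "\<Gamma> \<turnstile> subst (Eq r (Var z)) z t"
    by (rule leibniz[OF st]) (use w z rs in \<open>auto simp: subst_notin_fv free_for_notin_fv\<close>)
  with z show ?thesis by (simp add: subst_notin_fv)
qed

lemma Proj_cong: "\<Gamma> \<turnstile> Eq s t \<Longrightarrow> wf_trm L (Proj i s) \<Longrightarrow> \<Gamma> \<turnstile> Eq (Proj i s) (Proj i t)"
proof -
  assume st: "\<Gamma> \<turnstile> Eq s t" and p: "wf_trm L (Proj i s)"
  note w = eq_wf[OF st]
  define z where "z = fresh (ty_of s) (vars s)"
  have z: "z \<notin> fv s" "vty z = ty_of s" unfolding z_def by (rule fresh_fv) auto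
  show ?thesis using eq_cong[OF st, of "Proj i (Var z)" z] z p w by auto
qed

lemma Mem_cong: "\<Gamma> \<turnstile> Mem s X \<Longrightarrow> \<Gamma> \<turnstile> Eq s t \<Longrightarrow> \<Gamma> \<turnstile> Mem t X"
proof -
  assume st: "\<Gamma> \<turnstile> Eq s t" and m: "\<Gamma> \<turnstile> Mem s X"
  note w = eq_wf[OF st] entails_wf[OF m]
  define z where "z = fresh (ty_of s) (vars X)"
  have z: "z \<notin> fv X" "vty z = ty_of s" unfolding z_def by (rule fresh_fv) auto
  have "\<Gamma> \<turnstile> subst (Mem (Var z) X) z t"
    by (rule leibniz[OF st]) (use w z m in \<open>auto simp: subst_notin_fv free_for_notin_fv\<close>)
  with z show ?thesis by (simp add: subst_notin_fv)
qed

text \<open>Entries are exchanged one at a time; after \<open>k\<close> exchanges the list is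
  \<open>take k ts @ drop k ss\<close>. Each exchange is congruence for a tuple with a fresh
  variable at index \<open>k\<close>.\<close>

lemma Tup_cong:
  assumes "length ss = length ts" "2 \<le> length ss" "\<And>i. i < length ss \<Longrightarrow> \<Gamma> \<turnstile> Eq (ss ! i) (ts ! i)"
  shows "\<Gamma> \<turnstile> Eq (Tup ss) (Tup ts)"
proof -
  have w: "wf_trm L (ss ! i) \<and> wf_trm L (ts ! i) \<and> ty_of (ss ! i) = ty_of (ts ! i)" if "i < length ss" for i
    using assms(3)[OF that] eq_wf by blast
  have cG: "ctx \<Gamma>" using assms(3)[of 0] assms(2) eq_wf by force
  have ws: "wf_trm L s" if "s \<in> set ss" for s
    using that w by (metis in_set_conv_nth)
  have wt: "wf_trm L s" if "s \<in> set ts" for s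
    using that w assms(1) by (metis in_set_conv_nth)
  have tys: "map ty_of ss = map ty_of ts"
    using w assms(1) by (auto intro: nth_equalityI)
  have "k \<le> length ss \<Longrightarrow> \<Gamma> \<turnstile> Eq (Tup ss) (Tup (take k ts @ drop k ss))" for k
  proof (induct k)
    case 0
    then show ?case using assms(2) ws cG by auto
  next
    case (Suc k)
    then have k: "k < length ss" by simp
    define V where "V = vars (Tup ss) \<union> vars (Tup ts)"
    define z where "z = fresh (ty_of (ss ! k)) V"
    have "z \<notin> V" unfolding z_def by (rule fresh_notin) (simp add: V_def)
    then have z: "\<forall>s\<in>set ss \<union> set ts. z \<notin> fv s"
      using fv_subset_vars by (fastforce simp: V_def)
    have vz: "vty z = ty_of (ss ! k)" by (simp add: z_def)
    define c where "c = Tup (take k ts @ Var z # drop (Suc k) ss)"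
    have notin: "\<forall>s \<in> set (take k ts) \<union> set (drop (Suc k) ss). z \<notin> fv s"
      using z by (auto dest: in_set_takeD in_set_dropD)
    have sub: "subst c z r = Tup (take k ts @ r # drop (Suc k) ss)" for r
      using notin by (auto simp: c_def subst_notin_fv intro!: map_idI)
    have ff: "free_for r z c" for r
      using notin by (auto simp: c_def free_for_notin_fv)
    have "wf_trm L c"
      using assms(1,2) ws wt w[OF k] k vz wf_ty_of[of "ss ! k"]
      by (auto simp: c_def dest: in_set_takeD in_set_dropD)
    then have "\<Gamma> \<turnstile> Eq (subst c z (ss ! k)) (subst c z (ts ! k))"
      using assms(3)[OF k] vz ff z k by (intro eq_cong) auto
    moreover have "take k ts @ ss ! k # drop (Suc k) ss = take k ts @ drop k ss"
      using k by (simp add: Cons_nth_drop_Suc)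
    moreover have "take k ts @ ts ! k # drop (Suc k) ss = take (Suc k) ts @ drop (Suc k) ss"
      using k assms(1) by (simp add: take_Suc_conv_app_nth)
    ultimately have "\<Gamma> \<turnstile> Eq (Tup (take k ts @ drop k ss)) (Tup (take (Suc k) ts @ drop (Suc k) ss))"
      unfolding sub by simp
    with Suc show ?case by (intro eq_trans[OF Suc(1)]) auto
  qed
  from this[of "length ss"] assms(1) show ?thesis by simp
qed

lemma pair_cong: "\<Gamma> \<turnstile> Eq s s' \<Longrightarrow> \<Gamma> \<turnstile> Eq t t' \<Longrightarrow> \<Gamma> \<turnstile> Eq (pair s t) (pair s' t')"
  by (simp, rule Tup_cong) (auto simp: less_Suc_eq)

subsection \<open>Elimination of defined variables\<close>

definition defs :: "'g var list \<Rightarrow> ('g, 'f) trm list \<Rightarrow> ('g, 'f) trm set" where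
  "defs us ss = set (map2 (\<lambda>u s. Eq (Var u) s) us ss)"

lemma defs_simps [simp]: "defs [] ss = {}" "defs us [] = {}"
  "defs (u # us) (s # ss) = insert (Eq (Var u) s) (defs us ss)"
  by (simp_all add: defs_def)

lemma in_defs: "length us = length ss \<Longrightarrow> i < length us \<Longrightarrow> Eq (Var (us ! i)) (ss ! i) \<in> defs us ss"
  by (force simp: defs_def set_conv_nth)

lemma ctx_defs:
  "length us = length ss \<Longrightarrow> (\<And>s. s \<in> set ss \<Longrightarrow> wf_trm L s) \<Longrightarrow> map vty us = map ty_of ss \<Longrightarrow>
     ctx (defs us ss)"
  by (induct us ss rule: list_induct2) (auto simp: wf_ty_of)

text \<open>Putting \<open>s\<close> for \<open>u\<close> leaves \<Gamma> and \<open>a\<close> as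
  they are and turns the equation into \<open>s = s\<close>, which is cut away. Capture cannot
  occur, because \<open>u\<close> is free only as the left side of the equation.\<close>

lemma def_elim:
  assumes "insert (Eq (Var u) s) \<Gamma> \<turnstile> a" "\<forall>g \<in> insert a \<Gamma>. u \<notin> fv g" "u \<notin> fv s"
  shows "\<Gamma> \<turnstile> a"
proof -
  note w = entails_wf[OF assms(1)]
  have "subst g u s = g" if "g \<in> insert a \<Gamma>" for g
    using assms(2) that by (intro subst_notin_fv) auto
  then have id: "(\<lambda>g. subst g u s) ` \<Gamma> = \<Gamma>" "subst a u s = a" by auto
  have "insert (Eq s s) \<Gamma> \<turnstile> a"
    by (rule substitute[OF assms(1), where t = s and x = u])
      (use w assms(2,3) in \<open>auto simp: id free_for_notin_fv subst_notin_fv\<close>)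
  moreover have "\<Gamma> \<turnstile> Eq s s" using w by auto
  ultimately show ?thesis using cut by blast
qed

lemma defs_elim:
  assumes "length us = length ss" "defs us ss \<union> \<Gamma> \<turnstile> a" "distinct us"
    "\<And>g. g \<in> insert a \<Gamma> \<Longrightarrow> fv g \<inter> set us = {}" "\<And>s. s \<in> set ss \<Longrightarrow> fv s \<inter> set us = {}"
  shows "\<Gamma> \<turnstile> a"
  using assms
proof (induct us ss arbitrary: \<Gamma> rule: list_induct2)
  case (Cons u us s ss)
  have *: "\<forall>s' \<in> set ss. u \<notin> fv s'" "u \<notin> set us" using Cons(4,6) by auto
  have u: "u \<notin> fv g" if g: "g \<in> defs us ss" for g
  proof -
    obtain v b where "(v, b) \<in> set (zip us ss)" "g = Eq (Var v) b"
      using g by (auto simp: defs_def)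
    with * show ?thesis by (auto dest: set_zip_leftD set_zip_rightD)
  qed
  have "defs us ss \<union> \<Gamma> \<turnstile> a"
    by (rule def_elim[of u s]) (use Cons(3,5,6) u in auto)
  then show ?case by (rule Cons(2)) (use Cons(4,5,6) in auto)
qed simp

text \<open>The projection axiom is stated for tuples of variables. Fresh variables
  \<open>us\<close> name the entries, congruence carries the axiom over to \<open>ts\<close>, and
  the naming equations are discharged at the end.\<close>

lemma Tup_Proj:
  assumes "2 \<le> length ts" "\<forall>t \<in> set ts. wf_trm L t" "i < length ts" "ctx \<Gamma>"
  shows "\<Gamma> \<turnstile> Eq (Proj i (Tup ts)) (ts ! i)"
proof -
  define us where "us = fresh_list (map ty_of ts) (vars (Tup ts))"
  have us: "length us = length ts" "map vty us = map ty_of ts" "distinct us"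
    "set us \<inter> vars (Tup ts) = {}"
    using fresh_list_props[of "vars (Tup ts)" "map ty_of ts"] by (auto simp: us_def)
  have d: "set us \<inter> fv t = {}" if "t \<in> set ts" for t
    using us(4) fv_subset_vars[of t] that by auto
  have c: "ctx (defs us ts)" using us assms by (intro ctx_defs) auto
  have wu: "wf_ty L (vty u)" if "u \<in> set us" for u
    using that us(1,2) assms(2) by (metis in_set_conv_nth nth_map wf_ty_of nth_mem)
  have eq: "defs us ts \<turnstile> Eq (Var (us ! j)) (ts ! j)" if "j < length ts" for j
    using that us in_defs by (intro hyp[OF c]) auto
  have "defs us ts \<turnstile> Eq (Proj i (Tup (map Var us))) (Var (us ! i))"
    by (rule theorem_weaken[OF _ c], rule projection) (use assms us wu in auto)
  moreover have t: "defs us ts \<turnstile> Eq (Tup (map Var us)) (Tup ts)"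
    by (rule Tup_cong) (use assms us eq in auto)
  have "defs us ts \<turnstile> Eq (Proj i (Tup (map Var us))) (Proj i (Tup ts))"
    by (rule Proj_cong[OF t]) (use assms us wu in auto)
  ultimately have fin: "defs us ts \<union> {} \<turnstile> Eq (Proj i (Tup ts)) (ts ! i)"
    using eq_sym eq_trans eq[OF assms(3)] unfolding Un_empty_right by blast
  have "{} \<turnstile> Eq (Proj i (Tup ts)) (ts ! i)"
  proof (rule defs_elim[OF us(1) fin us(3)])
    have "fv (Tup ts) \<inter> set us = {}" using d by auto
    then show "fv g \<inter> set us = {}" if "g \<in> {Eq (Proj i (Tup ts)) (ts ! i)}" for g
      using d[of "ts ! i"] assms(3) that by auto
  qed (use us d in auto)
  then show ?thesis using assms(4) theorem_weaken by blast
qed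

subsection \<open>Logical connectives\<close>

lemma eq_mp: "\<Gamma> \<turnstile> Iff a b \<Longrightarrow> \<Gamma> \<turnstile> a \<Longrightarrow> \<Gamma> \<turnstile> b"
proof -
  assume ab: "\<Gamma> \<turnstile> Iff a b" and a: "\<Gamma> \<turnstile> a"
  define z :: "'g var" where "z = fresh OmegaT {}"
  have "\<Gamma> \<turnstile> subst (Var z) z b"
    by (rule leibniz[OF ab]) (use a entails_wf[OF a] in \<open>auto simp: z_def formula_def\<close>)
  then show ?thesis by simp
qed

lemma TruI: "ctx \<Gamma> \<Longrightarrow> \<Gamma> \<turnstile> Tru"
  by (auto simp: Tru_def)

lemma eq_TruI: "\<Gamma> \<turnstile> a \<Longrightarrow> \<Gamma> \<turnstile> Eq a Tru"
proof -
  assume a: "\<Gamma> \<turnstile> a"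
  note w = entails_wf[OF a]
  show ?thesis
    by (rule equivalence) (use w a in \<open>auto intro: TruI weaken[OF a]\<close>)
qed

lemma eq_TruE: "\<Gamma> \<turnstile> Eq a Tru \<Longrightarrow> \<Gamma> \<turnstile> a"
  using eq_mp[OF eq_sym TruI] entails_wf by blast

lemma ConjI: "\<Gamma> \<turnstile> a \<Longrightarrow> \<Gamma> \<turnstile> b \<Longrightarrow> \<Gamma> \<turnstile> Conj a b"
  unfolding Conj_def by (rule pair_cong) (auto intro: eq_TruI)

lemma wf_formula: "formula L a \<Longrightarrow> wf_trm L a"
  by (simp add: formula_def)

text \<open>A conjunction is an equation between pairs, so projecting both sides makes each conjunct
  equal to \<open>Tru\<close>. The index \<open>i\<close> serves both eliminations at once.\<close>

lemma ConjE_nth: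
  assumes c: "\<Gamma> \<turnstile> Conj a b" and i: "i < 2"
  shows "\<Gamma> \<turnstile> [a, b] ! i"
proof -
  have w: "formula L a" "formula L b" "ctx \<Gamma>" using entails_wf[OF c] by auto
  have e: "\<Gamma> \<turnstile> Eq (Tup [a, b]) (Tup [Tru, Tru])" using c by (simp add: Conj_def)
  have "\<Gamma> \<turnstile> Eq (Proj i (Tup [a, b])) (Proj i (Tup [Tru, Tru]))"
    by (rule Proj_cong[OF e]) (use w i in \<open>auto simp: wf_formula\<close>)
  moreover have "\<Gamma> \<turnstile> Eq (Proj i (Tup [a, b])) ([a, b] ! i)"
    by (rule Tup_Proj) (use w i in \<open>auto simp: wf_formula\<close>)
  moreover have "\<Gamma> \<turnstile> Eq (Proj i (Tup [Tru, Tru])) ([Tru, Tru] ! i)"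
    by (rule Tup_Proj) (use w i in \<open>auto simp: wf_formula\<close>)
  ultimately have "\<Gamma> \<turnstile> Eq ([a, b] ! i) ([Tru, Tru] ! i)" using eq_sym eq_trans by blast
  moreover have "[Tru, Tru] ! i = (Tru :: ('g, 'f) trm)" using i by (auto simp: less_2_cases_iff)
  ultimately show ?thesis by (auto intro: eq_TruE)
qed

lemma ConjE1: "\<Gamma> \<turnstile> Conj a b \<Longrightarrow> \<Gamma> \<turnstile> a"
  using ConjE_nth[of \<Gamma> a b 0] by simp

lemma ConjE2: "\<Gamma> \<turnstile> Conj a b \<Longrightarrow> \<Gamma> \<turnstile> b"
  using ConjE_nth[of \<Gamma> a b 1] by simp

lemma Conj_left:
  assumes "insert a (insert b \<Gamma>) \<turnstile> c"
  shows "insert (Conj a b) \<Gamma> \<turnstile> c"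
proof (rule cut_set[OF assms])
  show c: "ctx (insert (Conj a b) \<Gamma>)" using entails_wf[OF assms] by auto
  have "insert (Conj a b) \<Gamma> \<turnstile> Conj a b" by (rule hyp[OF c]) simp
  then show "insert (Conj a b) \<Gamma> \<turnstile> d" if "d \<in> insert a (insert b \<Gamma>)" for d
    using that hyp[OF c, of d] ConjE1[of _ a b] ConjE2[of _ a b] by auto
qed

lemma ImpI: "insert a \<Gamma> \<turnstile> b \<Longrightarrow> \<Gamma> \<turnstile> Imp a b"
proof -
  assume ab: "insert a \<Gamma> \<turnstile> b"
  note w = entails_wf[OF ab]
  have "insert (Conj a b) \<Gamma> \<turnstile> a" by (rule ConjE1[OF hyp]) (use w in auto)
  moreover have "insert a \<Gamma> \<turnstile> Conj a b" by (rule ConjI[OF hyp ab]) (use w in auto)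
  ultimately show ?thesis unfolding Imp_def by (rule equivalence) (use w in auto)
qed

lemma ImpE: "\<Gamma> \<turnstile> Imp a b \<Longrightarrow> \<Gamma> \<turnstile> a \<Longrightarrow> \<Gamma> \<turnstile> b"
  unfolding Imp_def using eq_mp eq_sym ConjE2 by blast

text \<open>By extensionality: membership of \<open>x\<close> in either of the two comprehensions is
  equal to \<open>Tru\<close> under \<Gamma>.\<close>

lemma ForallI:
  assumes "\<Gamma> \<turnstile> a" "\<And>g. g \<in> \<Gamma> \<Longrightarrow> x \<notin> fv g" "wf_ty L (vty x)"
  shows "\<Gamma> \<turnstile> Forall x a"
proof -
  note w = entails_wf[OF assms(1)]
  have m: "\<Gamma> \<turnstile> Iff (Mem (Var x) (Coll x b)) b" if "formula L b" for b
    using comprehension[of L b x S] that assms(3) w theorem_weaken by blast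
  have "\<Gamma> \<turnstile> Iff (Mem (Var x) (Coll x a)) (Mem (Var x) (Coll x Tru))"
    using m[of a] m[of Tru] w eq_TruI[OF assms(1)] eq_trans eq_sym formula_Tru by blast
  then show ?thesis unfolding Forall_def by (rule extensionality) (use assms in auto)
qed

lemma Coll_iff:
  assumes "formula L a" "wf_trm L t" "ty_of t = vty x" "free_for t x a" "ctx \<Gamma>"
  shows "\<Gamma> \<turnstile> Iff (Mem t (Coll x a)) (subst a x t)"
proof -
  have "wf_ty L (vty x)" using wf_ty_of assms by metis
  then have "{} \<turnstile> Iff (Mem (Var x) (Coll x a)) a" using comprehension assms by blast
  then have "{} \<turnstile> Iff (Mem t (Coll x a)) (subst a x t)"
    by (rule substitute[where t = t and x = x]) (use assms in auto)
  then show ?thesis using assms theorem_weaken by blast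
qed

lemma ForallE:
  assumes a: "\<Gamma> \<turnstile> Forall x a" and t: "wf_trm L t" "ty_of t = vty x" "free_for t x a"
  shows "\<Gamma> \<turnstile> subst a x t"
proof -
  have w: "formula L a" "wf_ty L (vty x)" "ctx \<Gamma>" using entails_wf[OF a] by auto
  have e: "\<Gamma> \<turnstile> Eq (Coll x a) (Coll x Tru)" using a by (simp add: Forall_def)
  define z where "z = fresh (PowT (vty x)) (vars t \<union> vars a)"
  have z: "z \<notin> fv t" "z \<notin> fv a" "vty z = PowT (vty x)" unfolding z_def
    by (rule fresh_fv; auto)+ auto
  \<comment> \<open>The two equal comprehensions are exchanged inside the formula
    \<open>t \<in> z\<close>, with a set variable \<open>z\<close> in their place.\<close>
  have "\<Gamma> \<turnstile> Eq (subst (Mem t (Var z)) z (Coll x a)) (subst (Mem t (Var z)) z (Coll x Tru))"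
    by (rule eq_cong[OF e]) (use t w z in \<open>auto simp: free_for_notin_fv\<close>)
  then have "\<Gamma> \<turnstile> Eq (Mem t (Coll x a)) (Mem t (Coll x Tru))"
    using z by (simp add: subst_notin_fv)
  moreover have "\<Gamma> \<turnstile> Iff (Mem t (Coll x a)) (subst a x t)"
    by (rule Coll_iff) (use w t in auto)
  moreover have "\<Gamma> \<turnstile> Iff (Mem t (Coll x Tru)) (subst Tru x t)"
    by (rule Coll_iff) (use w t in \<open>auto simp: free_for_notin_fv\<close>)
  moreover have "subst Tru x t = Tru" by (simp add: subst_notin_fv)
  ultimately have "\<Gamma> \<turnstile> Eq (subst a x t) Tru" using eq_trans eq_sym by metis
  then show ?thesis by (rule eq_TruE)
qed

lemma subst_Var_self: "subst a x (Var x) = a"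
  by (induct a) (auto intro: map_idI)

lemma free_for_Var_self: "free_for (Var x) x a"
  by (induct a) auto

text \<open>Existence is encoded by quantifying over truth values: \<open>w\<close> is arbitrary,
  and the hypothesis on \<open>w\<close>, instantiated at \<open>x\<close> itself, leads from
  \<open>a\<close> to \<open>w\<close>.\<close>

lemma ExistsI: "formula L a \<Longrightarrow> wf_ty L (vty x) \<Longrightarrow> {a} \<turnstile> Exists x a"
proof -
  assume a: "formula L a" "wf_ty L (vty x)"
  define w where "w = fresh OmegaT (insert x (vars a))"
  have w: "w \<noteq> x" "w \<notin> fv a" "vty w = OmegaT"
    using fresh_fv[of "insert x (vars a)" a OmegaT] fresh_notin[of "insert x (vars a)" OmegaT]
    by (auto simp: w_def)
  define b where "b = Forall x (Imp a (Var w))"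
  have fb: "formula L b" using a w by (simp add: b_def formula_def[of L "Var w"])
  have "{b, a} \<turnstile> Forall x (Imp a (Var w))" by (rule hyp) (use a fb in \<open>auto simp: b_def\<close>)
  then have "{b, a} \<turnstile> subst (Imp a (Var w)) x (Var x)"
    by (rule ForallE) (use a in \<open>auto simp: free_for_Var_self\<close>)
  then have "{b, a} \<turnstile> Imp a (Var w)" using subst_Var_self by metis
  then have "{b, a} \<turnstile> Var w" by (rule ImpE) (rule hyp, use a fb in auto)
  then have "{a} \<turnstile> Imp b (Var w)" by (rule ImpI)
  then have "{a} \<turnstile> Forall w (Imp b (Var w))" by (rule ForallI) (use w in auto)
  then show ?thesis by (simp add: Exists_def b_def w_def Let_def)
qed

text \<open>The truth value \<open>w\<close> in the encoding is instantiated by the conclusion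
  \<open>b\<close>, which gives \<open>Imp (Forall x (Imp a b)) b\<close>. This places
  \<open>b\<close> under the quantifier on \<open>x\<close> without capture, as \<open>x\<close> is
  not free in \<open>b\<close>.\<close>

lemma Exists_left:
  assumes "insert a \<Gamma> \<turnstile> b" "\<And>g. g \<in> insert b \<Gamma> \<Longrightarrow> x \<notin> fv g" "wf_ty L (vty x)"
  shows "insert (Exists x a) \<Gamma> \<turnstile> b"
proof -
  have f: "formula L a" "formula L b" "ctx \<Gamma>" using entails_wf[OF assms(1)] by auto
  define w where "w = fresh OmegaT (insert x (vars a))"
  have w: "w \<noteq> x" "w \<notin> fv a" "vty w = OmegaT"
    using fresh_fv[of "insert x (vars a)" a OmegaT] fresh_notin[of "insert x (vars a)" OmegaT]
    by (auto simp: w_def)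
  have fb: "wf_trm L b" "ty_of b = OmegaT" using f by (auto simp: formula_def)
  have ex: "Exists x a = Forall w (Imp (Forall x (Imp a (Var w))) (Var w))"
    by (simp add: Exists_def w_def Let_def)
  have c: "ctx (insert (Exists x a) \<Gamma>)" using f assms(3) by simp
  have "insert (Exists x a) \<Gamma> \<turnstile> Forall w (Imp (Forall x (Imp a (Var w))) (Var w))"
    by (rule hyp[OF c]) (simp add: ex)
  then have "insert (Exists x a) \<Gamma> \<turnstile> subst (Imp (Forall x (Imp a (Var w))) (Var w)) w b"
    by (rule ForallE) (use fb w assms(2) in \<open>auto simp: free_for_notin_fv\<close>)
  then have 1: "insert (Exists x a) \<Gamma> \<turnstile> Imp (Forall x (Imp a b)) b"
    using w by (simp add: subst_notin_fv)
  have "\<Gamma> \<turnstile> Forall x (Imp a b)"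
    by (rule ForallI[OF ImpI[OF assms(1)]]) (use assms(2,3) in auto)
  then have "insert (Exists x a) \<Gamma> \<turnstile> Forall x (Imp a b)"
    by (rule weaken) (use c in auto)
  with 1 show ?thesis by (rule ImpE)
qed

end

section \<open>Tuples and comprehensions\<close>

text \<open>\<open>prj n i\<close> inverts \<open>tuple\<close> on lists of length \<open>n\<close>, where a tuple of length 1 is its only entry.\<close>

definition prj :: "nat \<Rightarrow> nat \<Rightarrow> ('g, 'f) trm \<Rightarrow> ('g, 'f) trm" where
  "prj n i t = (if n = 1 then t else Proj i t)"

lemma tuple_eq: "tuple ts = (if ts = [] then Star else if length ts = 1 then hd ts else Tup ts)"
  by (cases ts rule: tuple.cases) auto

lemma prod_ty_eq: "prod_ty As = (if As = [] then UnitT else if length As = 1 then hd As else ProdT As)"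
  by (cases As rule: prod_ty.cases) auto

lemma ty_of_tuple [simp]: "ty_of (tuple ts) = prod_ty (map ty_of ts)"
  by (cases ts rule: tuple.cases) auto

lemma wf_tuple [simp]: "wf_trm L (tuple ts) \<longleftrightarrow> (\<forall>t \<in> set ts. wf_trm L t)"
  by (cases ts rule: tuple.cases) auto

lemma fv_tuple [simp]: "fv (tuple ts) = (\<Union>t \<in> set ts. fv t)"
  by (cases ts rule: tuple.cases) auto

lemma vars_tuple [simp]: "vars (tuple ts) = (\<Union>t \<in> set ts. vars t)"
  by (cases ts rule: tuple.cases) auto

lemma fv_prj [simp]: "fv (prj n i t) = fv t"
  by (simp add: prj_def)

lemma bv_prj [simp]: "bv (prj n i t) = bv t"
  by (simp add: prj_def)

lemma wf_prj: "wf_trm L t \<Longrightarrow> ty_of t = prod_ty As \<Longrightarrow> i < length As \<Longrightarrow> wf_trm L (prj (length As) i t)"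
  by (cases As rule: prod_ty.cases) (auto simp: prj_def)

lemma ty_of_prj: "ty_of t = prod_ty As \<Longrightarrow> i < length As \<Longrightarrow> ty_of (prj (length As) i t) = As ! i"
  by (cases As rule: prod_ty.cases) (auto simp: prj_def)

lemma formula_Exists_list:
  "formula L (Exists_list xs a) \<longleftrightarrow> (\<forall>x \<in> set xs. wf_ty L (vty x)) \<and> formula L a"
  by (induct xs) (auto simp: Exists_list_def)

lemma fv_Exists_list: "fv (Exists_list xs a) = fv a - set xs"
  by (induct xs) (auto simp: Exists_list_def)

lemma vars_Exists_list: "set xs \<union> vars a \<subseteq> vars (Exists_list xs a)"
proof (induct xs)
  case (Cons x xs)
  then show ?case using vars_Exists[of x "Exists_list xs a"] by (auto simp: Exists_list_def)
qed (auto simp: Exists_list_def)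

section \<open>Set comprehension over several variables\<close>

definition Compr_var :: "'g var list \<Rightarrow> ('g, 'f) trm \<Rightarrow> ('g, 'f) trm \<Rightarrow> 'g var" where
  "Compr_var xs t a = fresh (ty_of t) (set xs \<union> vars t \<union> vars a)"

lemma Compr_eq:
  "Compr xs t a = Coll (Compr_var xs t a) (Exists_list xs (Conj (Eq (Var (Compr_var xs t a)) t) a))"
  by (simp add: Compr_def Compr_var_def Let_def)

lemma Compr_var:
  "vty (Compr_var xs t a) = ty_of t" "Compr_var xs t a \<notin> set xs"
  "Compr_var xs t a \<notin> fv t" "Compr_var xs t a \<notin> fv a"
proof -
  have "Compr_var xs t a \<notin> set xs \<union> vars t \<union> vars a"
    unfolding Compr_var_def by (rule fresh_notin) simp
  then show "Compr_var xs t a \<notin> set xs"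
    "Compr_var xs t a \<notin> fv t" "Compr_var xs t a \<notin> fv a"
    using fv_subset_vars by auto
qed (simp add: Compr_var_def)

lemma fv_Compr: "fv (Compr xs t a) = fv t \<union> fv a - set xs"
  using Compr_var(3,4)[of xs t a] by (auto simp: Compr_eq fv_Exists_list)

lemma ty_of_Compr [simp]: "ty_of (Compr xs t a) = PowT (ty_of t)"
  by (simp add: Compr_eq Compr_var(1))

lemma vars_Compr: "insert (Compr_var xs t a) (set xs \<union> vars t \<union> vars a) \<subseteq> vars (Compr xs t a)"
  using vars_Exists_list[of xs "Conj (Eq (Var (Compr_var xs t a)) t) a"]
  by (auto simp: Compr_eq)

lemma formula_Conj_list: "formula L (Conj_list as) \<longleftrightarrow> (\<forall>a \<in> set as. formula L a)"
  by (induct as rule: Conj_list.induct) auto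

lemma fv_Conj_list: "fv (Conj_list as) = (\<Union>a \<in> set as. fv a)"
  by (induct as rule: Conj_list.induct) auto

context lst
begin

lemma wf_Compr:
  "wf_trm L t \<Longrightarrow> formula L a \<Longrightarrow> \<forall>x \<in> set xs. wf_ty L (vty x) \<Longrightarrow> wf_trm L (Compr xs t a)"
  unfolding Compr_eq wf_Coll by (auto simp: formula_Exists_list Compr_var(1) wf_ty_of)

lemma tuple_cong:
  assumes "length ss = length ts" "\<And>i. i < length ss \<Longrightarrow> \<Gamma> \<turnstile> Eq (ss ! i) (ts ! i)" "ctx \<Gamma>"
  shows "\<Gamma> \<turnstile> Eq (tuple ss) (tuple ts)"
proof (cases "2 \<le> length ss")
  case True
  then have "tuple ss = Tup ss" "tuple ts = Tup ts" using assms(1) by (auto simp: tuple_eq)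
  then show ?thesis using Tup_cong[OF assms(1) True assms(2)] by simp
next
  case False
  then consider "ss = []" | s t where "ss = [s]" "ts = [t]"
    using assms(1) by (cases ss; cases ts) (auto simp: Suc_le_eq)
  then show ?thesis using assms by cases auto
qed

lemma prj_cong:
  "\<Gamma> \<turnstile> Eq s t \<Longrightarrow> ty_of s = prod_ty As \<Longrightarrow> i < length As \<Longrightarrow>
    \<Gamma> \<turnstile> Eq (prj (length As) i s) (prj (length As) i t)"
  using Proj_cong[of \<Gamma> s t i] eq_wf[of \<Gamma> s t] wf_prj[of L s As i] by (auto simp: prj_def)

lemma prj_tuple:
  assumes "\<forall>t \<in> set ts. wf_trm L t" "i < length ts" "ctx \<Gamma>" "n = length ts"
  shows "\<Gamma> \<turnstile> Eq (prj n i (tuple ts)) (ts ! i)"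
proof (cases "2 \<le> length ts")
  case True
  then have "tuple ts = Tup ts" by (auto simp: tuple_eq)
  then show ?thesis using Tup_Proj[OF True assms(1,2,3)] True assms(4) by (simp add: prj_def)
next
  case False
  then obtain t where "ts = [t]" using assms(2) by (cases ts) (auto simp: Suc_le_eq)
  then show ?thesis using assms by (auto simp: prj_def)
qed

lemma tuple_prj:
  assumes "wf_trm L t" "ty_of t = prod_ty As" "As \<noteq> []" "ctx \<Gamma>"
  shows "\<Gamma> \<turnstile> Eq t (tuple (map (\<lambda>i. prj (length As) i t) [0..<length As]))"
proof (cases "2 \<le> length As")
  case True
  define x where "x = fresh (ty_of t) {}"
  have ty: "ty_of t = ProdT As" using assms(2) True by (auto simp: prod_ty_eq)
  have "{} \<turnstile> Eq (Var x) (Tup (map (\<lambda>i. Proj i (Var x)) [0..<length As]))"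
    by (rule surjective_pairing) (use wf_ty_of[OF assms(1)] ty in \<open>auto simp: x_def\<close>)
  then have "{} \<turnstile> Eq t (Tup (map (\<lambda>i. Proj i t) [0..<length As]))"
    by (rule substitute[where t = t and x = x]) (use assms in \<open>auto simp: x_def\<close>)
  then have "{} \<turnstile> Eq t (tuple (map (\<lambda>i. prj (length As) i t) [0..<length As]))"
    using True by (auto simp: tuple_eq prj_def)
  then show ?thesis using assms(4) theorem_weaken by blast
next
  case False
  with assms(3) obtain A where "As = [A]" by (cases As) (auto simp: Suc_le_eq)
  then show ?thesis using assms by (auto simp: prj_def)
qed

lemma Exists_listI: "formula L a \<Longrightarrow> \<forall>x \<in> set xs. wf_ty L (vty x) \<Longrightarrow> {a} \<turnstile> Exists_list xs a"
proof (induct xs)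
  case Nil
  then show ?case by (auto simp: Exists_list_def intro: tautology)
next
  case (Cons x xs)
  have "{Exists_list xs a} \<turnstile> Exists x (Exists_list xs a)"
    by (rule ExistsI) (use Cons in \<open>auto simp: formula_Exists_list\<close>)
  moreover have "{a} \<turnstile> Exists_list xs a" using Cons by auto
  ultimately show ?case using cut1 by (simp add: Exists_list_def)
qed

lemma Exists_list_left:
  assumes "insert a \<Gamma> \<turnstile> b" "\<And>g. g \<in> insert b \<Gamma> \<Longrightarrow> fv g \<inter> set xs = {}"
    "\<forall>x \<in> set xs. wf_ty L (vty x)"
  shows "insert (Exists_list xs a) \<Gamma> \<turnstile> b"
  using assms(2,3)
proof (induct xs)
  case Nil
  then show ?case using assms(1) by (simp add: Exists_list_def)
next
  case (Cons x xs)
  have "insert (Exists_list xs a) \<Gamma> \<turnstile> b" by (rule Cons(1)) (use Cons(2,3) in auto)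
  then have "insert (Exists x (Exists_list xs a)) \<Gamma> \<turnstile> b"
    by (rule Exists_left) (use Cons(2,3) in auto)
  then show ?case by (simp add: Exists_list_def)
qed

text \<open>Stated at the bound variable of the comprehension itself: a general term in its place
  could be captured by the quantifiers over \<open>xs\<close>. Other terms are reached through
  equations with this variable.\<close>

lemma Compr_var_iff:
  assumes "wf_trm L t" "formula L a" "\<forall>x \<in> set xs. wf_ty L (vty x)" "ctx \<Gamma>"
  shows "\<Gamma> \<turnstile> Iff (Mem (Var (Compr_var xs t a)) (Compr xs t a))
    (Exists_list xs (Conj (Eq (Var (Compr_var xs t a)) t) a))"
proof (rule theorem_weaken)
  show "{} \<turnstile> Iff (Mem (Var (Compr_var xs t a)) (Compr xs t a))
    (Exists_list xs (Conj (Eq (Var (Compr_var xs t a)) t) a))"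
    unfolding Compr_eq
    by (rule comprehension) (use assms in \<open>auto simp: formula_Exists_list Compr_var(1) wf_ty_of\<close>)
qed (fact assms)

text \<open>The variables \<open>xs\<close> act as their own witnesses, so \<open>t\<close> and
  \<open>a\<close> occur unchanged. The bound variable of the comprehension is set equal to
  \<open>t\<close> and then eliminated.\<close>

lemma Compr_intro:
  assumes "wf_trm L t" "formula L a" "\<forall>x \<in> set xs. wf_ty L (vty x)"
  shows "{a} \<turnstile> Mem t (Compr xs t a)"
proof -
  define z where "z = Compr_var xs t a"
  note z = Compr_var[of xs t a, folded z_def]
  define \<Gamma> where "\<Gamma> = {Eq (Var z) t, a}"
  have fz: "formula L (Eq (Var z) t)" using assms z(1) by (simp add: wf_ty_of)
  have c: "ctx \<Gamma>" using assms(2) fz unfolding \<Gamma>_def by (simp del: formula_Eq)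
  have e: "\<Gamma> \<turnstile> Eq (Var z) t" by (rule hyp[OF c]) (simp add: \<Gamma>_def)
  have "{Conj (Eq (Var z) t) a} \<turnstile> Exists_list xs (Conj (Eq (Var z) t) a)"
    by (rule Exists_listI) (use assms fz in auto)
  moreover have "\<Gamma> \<turnstile> Conj (Eq (Var z) t) a"
    by (rule ConjI[OF e]) (rule hyp[OF c], simp add: \<Gamma>_def)
  ultimately have "\<Gamma> \<turnstile> Exists_list xs (Conj (Eq (Var z) t) a)" by (rule cut1)
  then have "\<Gamma> \<turnstile> Mem (Var z) (Compr xs t a)"
    using eq_mp[OF eq_sym[OF Compr_var_iff[OF assms c]]] by (simp add: z_def)
  then have "\<Gamma> \<turnstile> Mem t (Compr xs t a)" using e by (rule Mem_cong)
  then show ?thesis unfolding \<Gamma>_def by (rule def_elim) (use z in \<open>auto simp: fv_Compr\<close>)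
qed

text \<open>The bound variables of the comprehension become generic witnesses without renaming, so
  the free variables of \<open>s\<close>, \<Gamma> and \<open>b\<close> have to avoid every variable
  of the comprehension. The term \<open>s\<close> enters by an equation with the variable
  \<open>z\<close> of the comprehension, discharged last.\<close>

lemma Compr_left:
  assumes "insert (Eq s t) (insert a \<Gamma>) \<turnstile> b"
    and xs: "\<forall>x \<in> set xs. wf_ty L (vty x)"
    and fv: "\<And>g. g \<in> insert b \<Gamma> \<Longrightarrow> fv g \<inter> vars (Compr xs t a) = {}"
    and s: "fv s \<inter> vars (Compr xs t a) = {}"
  shows "insert (Mem s (Compr xs t a)) \<Gamma> \<turnstile> b"
proof -
  define z where "z = Compr_var xs t a"
  note z = Compr_var[of xs t a, folded z_def]
  have w: "wf_trm L s" "wf_trm L t" "ty_of s = ty_of t" "formula L a" "ctx \<Gamma>"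
    using entails_wf[OF assms(1)] by auto
  have vC: "insert z (set xs) \<subseteq> vars (Compr xs t a)" using vars_Compr[of xs t a] by (auto simp: z_def)
  have fz: "formula L (Eq (Var z) t)" "formula L (Eq (Var z) s)"
    using w z(1) by (simp_all add: wf_ty_of)
  have wC: "wf_trm L (Compr xs t a)" using wf_Compr w xs by auto
  have fv': "\<forall>g \<in> insert b \<Gamma>. fv g \<inter> insert z (set xs) = {}"
    "fv s \<inter> insert z (set xs) = {}" using fv s vC by blast+
  define \<Delta> where "\<Delta> = insert (Eq (Var z) s) \<Gamma>"
  have c: "ctx \<Delta>" using w fz by (simp add: \<Delta>_def)
  have "insert (Eq (Var z) t) (insert a \<Delta>) \<turnstile> b"
  proof (rule cut_set[OF assms(1)])
    show c': "ctx (insert (Eq (Var z) t) (insert a \<Delta>))" using c fz w by simp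
    fix d assume d: "d \<in> insert (Eq s t) (insert a \<Gamma>)"
    have "insert (Eq (Var z) t) (insert a \<Delta>) \<turnstile> Eq s t"
      by (rule eq_trans[OF eq_sym, of _ "Var z"]) (rule hyp[OF c'], simp add: \<Delta>_def)+
    then show "insert (Eq (Var z) t) (insert a \<Delta>) \<turnstile> d"
      using d hyp[OF c', of d] by (auto simp: \<Delta>_def)
  qed
  then have "insert (Conj (Eq (Var z) t) a) \<Delta> \<turnstile> b" by (rule Conj_left)
  then have 1: "insert (Exists_list xs (Conj (Eq (Var z) t) a)) \<Delta> \<turnstile> b"
    by (rule Exists_list_left) (use fv' z(2) xs in \<open>auto simp: \<Delta>_def\<close>)
  have "insert (Eq (Var z) s) (insert (Mem s (Compr xs t a)) \<Gamma>) \<turnstile> b"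
  proof (rule cut_set[OF 1])
    show c': "ctx (insert (Eq (Var z) s) (insert (Mem s (Compr xs t a)) \<Gamma>))"
      using fz w wC by simp
    have "insert (Eq (Var z) s) (insert (Mem s (Compr xs t a)) \<Gamma>) \<turnstile> Mem (Var z) (Compr xs t a)"
      by (rule Mem_cong[OF _ eq_sym, of _ s]) (rule hyp[OF c'], simp)+
    then have "insert (Eq (Var z) s) (insert (Mem s (Compr xs t a)) \<Gamma>) \<turnstile>
        Exists_list xs (Conj (Eq (Var z) t) a)"
      using eq_mp[OF Compr_var_iff[OF w(2,4) xs c']] by (simp add: z_def)
    then show "insert (Eq (Var z) s) (insert (Mem s (Compr xs t a)) \<Gamma>) \<turnstile> d"
      if "d \<in> insert (Exists_list xs (Conj (Eq (Var z) t) a)) \<Delta>" for d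
      using that hyp[OF c', of d] by (auto simp: \<Delta>_def)
  qed
  then show ?thesis
    by (rule def_elim) (use fv' z in \<open>auto simp: fv_Compr\<close>)
qed

lemma Compr_intro_defs:
  assumes a: "defs us ss \<union> \<Gamma> \<turnstile> a" and t: "defs us ss \<union> \<Gamma> \<turnstile> Eq t s"
    and us: "length us = length ss" "distinct us" "\<forall>x \<in> set us. wf_ty L (vty x)"
    and fv: "\<And>g. g \<in> \<Gamma> \<Longrightarrow> fv g \<inter> set us = {}" "\<And>r. r \<in> set ss \<Longrightarrow> fv r \<inter> set us = {}"
      "fv s \<inter> set us = {}"
  shows "\<Gamma> \<turnstile> Mem s (Compr us t a)"
proof -
  have "wf_trm L t" "formula L a" using entails_wf[OF a] entails_wf[OF t] by auto
  then have "{a} \<turnstile> Mem t (Compr us t a)" using us by (intro Compr_intro) auto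
  then have "defs us ss \<union> \<Gamma> \<turnstile> Mem t (Compr us t a)" using a by (rule cut1)
  then have *: "defs us ss \<union> \<Gamma> \<turnstile> Mem s (Compr us t a)" using t by (rule Mem_cong)
  show ?thesis
    by (rule defs_elim[OF us(1) * us(2)]) (use fv in \<open>auto simp: fv_Compr\<close>)
qed

lemma Conj_listI: "(\<And>a. a \<in> set as \<Longrightarrow> \<Gamma> \<turnstile> a) \<Longrightarrow> ctx \<Gamma> \<Longrightarrow> \<Gamma> \<turnstile> Conj_list as"
  by (induct as rule: Conj_list.induct) (auto intro: TruI ConjI)

lemma Conj_listE: "\<Gamma> \<turnstile> Conj_list as \<Longrightarrow> a \<in> set as \<Longrightarrow> \<Gamma> \<turnstile> a"
  by (induct as rule: Conj_list.induct) (auto intro: ConjE1 dest: ConjE2)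

end

section \<open>Graphs of composites, products and inclusions\<close>

lemma fresh_list_facts:
  assumes "finite V"
  shows "length (fresh_list As V) = length As" "map vty (fresh_list As V) = As"
    "distinct (fresh_list As V)" "set (fresh_list As V) \<inter> V = {}"
  using fresh_list_props[OF assms, of As] by auto

lemma ty_of_ProdS [simp]: "ty_of (ProdS Xs) = PowT (prod_ty (map elem_ty Xs))"
  using fresh_list_facts(2)[of "\<Union>X \<in> set Xs. vars X" "map elem_ty Xs"]
  by (simp add: ProdS_def Let_def comp_def)

lemma elem_ty_ProdS [simp]: "elem_ty (ProdS Xs) = prod_ty (map elem_ty Xs)"
  by (simp add: elem_ty_def)

lemma elem_ty_USet [simp]: "elem_ty (USet A) = A"
  by (simp add: elem_ty_def USet_def)

lemma ty_of_USet [simp]: "ty_of (USet A) = PowT A"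
  by (simp add: USet_def)

lemma fv_USet [simp]: "fv (USet A) = {}"
  by (simp add: USet_def)

lemma wf_USet [simp]: "wf_trm L (USet A) \<longleftrightarrow> wf_ty L A"
  by (simp add: USet_def wf_Coll del: wf_trm.simps(6))

context lst
begin

lemma USet_mem: "wf_trm L t \<Longrightarrow> ty_of t = A \<Longrightarrow> ctx \<Gamma> \<Longrightarrow> \<Gamma> \<turnstile> Mem t (USet A)"
proof -
  assume *: "wf_trm L t" "ty_of t = A" "ctx \<Gamma>"
  have "\<Gamma> \<turnstile> Iff (Mem t (USet A)) (subst Tru (fresh A {}) t)"
    unfolding USet_def by (rule Coll_iff) (use * in \<open>auto simp: free_for_notin_fv\<close>)
  then show ?thesis using TruI[OF *(3)] eq_mp eq_sym by (metis fv_Tru subst_notin_fv empty_iff)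
qed

section \<open>Closed sets, closed relations and products of sets\<close>

definition closed_set :: "('g, 'f) trm \<Rightarrow> bool" where
  "closed_set X \<longleftrightarrow> wf_trm L X \<and> fv X = {} \<and> ty_of X = PowT (elem_ty X)"

text \<open>Treats the graph as a closed relation between the element types of source and target.
  Composites and products of graphs are computed at this level.\<close>

definition closed_rel :: "('g, 'f) sfun \<Rightarrow> bool" where
  "closed_rel f \<longleftrightarrow> wf_trm L (graph f) \<and> fv (graph f) = {} \<and>
     ty_of (graph f) = PowT (ProdT [elem_ty (src f), elem_ty (tgt f)])"

lemma closed_rel_wf_ty: "closed_rel f \<Longrightarrow> wf_ty L (elem_ty (src f)) \<and> wf_ty L (elem_ty (tgt f))"
  using wf_ty_of[of "graph f"] by (auto simp: closed_rel_def)

definition ProdS_vars :: "('g, 'f) trm list \<Rightarrow> 'g var list" where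
  "ProdS_vars Xs = fresh_list (map elem_ty Xs) (\<Union>X \<in> set Xs. vars X)"

lemma ProdS_eq: "ProdS Xs = Compr (ProdS_vars Xs) (tuple (map Var (ProdS_vars Xs)))
    (Conj_list (map2 (\<lambda>x X. Mem (Var x) X) (ProdS_vars Xs) Xs))"
  by (simp add: ProdS_def ProdS_vars_def Let_def)

lemma ProdS_vars: "length (ProdS_vars Xs) = length Xs" "map vty (ProdS_vars Xs) = map elem_ty Xs"
    "distinct (ProdS_vars Xs)" "set (ProdS_vars Xs) \<subseteq> vars (ProdS Xs)"
  using fresh_list_facts[of "\<Union>X \<in> set Xs. vars X" "map elem_ty Xs"]
    vars_Compr[of "ProdS_vars Xs" "tuple (map Var (ProdS_vars Xs))"
      "Conj_list (map2 (\<lambda>x X. Mem (Var x) X) (ProdS_vars Xs) Xs)", folded ProdS_eq]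
  by (simp_all add: ProdS_vars_def)

lemma set_map2_nth: "length xs = length zs \<Longrightarrow> set (map2 h xs zs) = {h (xs ! i) (zs ! i) |i. i < length xs}"
  by (force simp: set_conv_nth)

lemma ProdS_vars_wf:
  assumes "\<forall>X \<in> set Xs. closed_set X" "i < length Xs"
  shows "vty (ProdS_vars Xs ! i) = elem_ty (Xs ! i)" "wf_ty L (vty (ProdS_vars Xs ! i))"
proof -
  show *: "vty (ProdS_vars Xs ! i) = elem_ty (Xs ! i)"
    using arg_cong[OF ProdS_vars(2)[of Xs], of "\<lambda>l. l ! i"] assms(2) by (simp add: ProdS_vars(1))
  have "closed_set (Xs ! i)" using assms by simp
  then show "wf_ty L (vty (ProdS_vars Xs ! i))"
    using wf_ty_of[of "Xs ! i"] by (simp add: * closed_set_def)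
qed

lemma closed_set_ProdS:
  assumes "\<forall>X \<in> set Xs. closed_set X"
  shows "closed_set (ProdS Xs)"
proof -
  note v = ProdS_vars[of Xs] ProdS_vars_wf[OF assms]
  have cX: "closed_set (Xs ! i)" if "i < length Xs" for i using assms that by simp
  have f: "formula L (Conj_list (map2 (\<lambda>x X. Mem (Var x) X) (ProdS_vars Xs) Xs))"
    using v cX unfolding formula_Conj_list set_map2_nth[OF v(1)] by (auto simp: closed_set_def)
  have fv: "fv (Conj_list (map2 (\<lambda>x X. Mem (Var x) X) (ProdS_vars Xs) Xs)) \<subseteq> set (ProdS_vars Xs)"
    using v(1) cX unfolding fv_Conj_list set_map2_nth[OF v(1)] by (auto simp: closed_set_def)
  have wf: "\<forall>x \<in> set (ProdS_vars Xs). wf_ty L (vty x)"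
    using v(1,6) by (metis in_set_conv_nth)
  have "wf_trm L (ProdS Xs)" unfolding ProdS_eq by (rule wf_Compr) (use f wf in auto)
  moreover have "fv (ProdS Xs) = {}" unfolding ProdS_eq fv_Compr using fv by auto
  ultimately show ?thesis by (simp add: closed_set_def)
qed

text \<open>The condition is put on the projections of \<open>s\<close>, so that \<open>s\<close>
  may be a single variable of product type. The bound variables of the product are equated with
  these projections, and surjective pairing reassembles \<open>s\<close> from them.\<close>

lemma ProdS_intro:
  assumes Xs: "\<forall>X \<in> set Xs. closed_set X" "Xs \<noteq> []"
    and m: "\<And>i. i < length Xs \<Longrightarrow> \<Gamma> \<turnstile> Mem (prj (length Xs) i s) (Xs ! i)"
    and s: "wf_trm L s" "ty_of s = prod_ty (map elem_ty Xs)"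
    and fv: "\<And>g. g \<in> \<Gamma> \<Longrightarrow> fv g \<inter> vars (ProdS Xs) = {}" "fv s \<inter> vars (ProdS Xs) = {}"
  shows "\<Gamma> \<turnstile> Mem s (ProdS Xs)"
proof -
  define us where "us = ProdS_vars Xs"
  define n where "n = length Xs"
  define ss where "ss = map (\<lambda>i. prj n i s) [0..<n]"
  note v = ProdS_vars[of Xs, folded us_def] ProdS_vars_wf[OF Xs(1), folded us_def]
  have cG: "ctx \<Gamma>" using m[of 0] Xs(2) entails_wf by auto
  have len: "length us = length ss" by (simp add: ss_def v n_def)
  have wus: "\<forall>x \<in> set us. wf_ty L (vty x)" using v(1,6) by (metis in_set_conv_nth)
  have tys: "map vty us = map ty_of ss"
    by (rule nth_equalityI) (use v(1,5) s ty_of_prj[of s "map elem_ty Xs"] in \<open>auto simp: ss_def n_def\<close>)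
  have wss: "wf_trm L r" if "r \<in> set ss" for r
    using that wf_prj[OF s] by (auto simp: ss_def n_def)
  have c: "ctx (defs us ss \<union> \<Gamma>)" using ctx_defs[OF len wss tys] cG by simp
  have eq: "defs us ss \<union> \<Gamma> \<turnstile> Eq (Var (us ! i)) (prj n i s)" if "i < n" for i
    using in_defs[OF len, of i] that v(1) by (intro hyp[OF c]) (auto simp: ss_def n_def)
  show ?thesis unfolding ProdS_eq us_def[symmetric]
  proof (rule Compr_intro_defs[OF _ _ len v(3) wus])
    show "defs us ss \<union> \<Gamma> \<turnstile> Conj_list (map2 (\<lambda>x X. Mem (Var x) X) us Xs)"
    proof (rule Conj_listI[OF _ c])
      fix a assume "a \<in> set (map2 (\<lambda>x X. Mem (Var x) X) us Xs)"
      then obtain i where i: "i < n" "a = Mem (Var (us ! i)) (Xs ! i)"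
        unfolding set_map2_nth[OF v(1)] using v(1) by (auto simp: n_def)
      have "defs us ss \<union> \<Gamma> \<turnstile> Mem (prj n i s) (Xs ! i)"
        by (rule weaken[OF m _ c, folded n_def]) (use i in \<open>auto simp: n_def\<close>)
      then show "defs us ss \<union> \<Gamma> \<turnstile> a" unfolding i(2) using eq_sym[OF eq[OF i(1)]] by (rule Mem_cong)
    qed
    have "defs us ss \<union> \<Gamma> \<turnstile> Eq (tuple (map Var us)) (tuple ss)"
      by (rule tuple_cong) (use len v(1) eq c in \<open>auto simp: ss_def n_def\<close>)
    moreover have "defs us ss \<union> \<Gamma> \<turnstile> Eq s (tuple ss)"
      using tuple_prj[OF s _ c] Xs(2) by (simp add: ss_def n_def)
    ultimately show "defs us ss \<union> \<Gamma> \<turnstile> Eq (tuple (map Var us)) s"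
      using eq_sym eq_trans by blast
  qed (use fv v(4) in \<open>auto simp: ss_def\<close>)
qed

end

lemma graph_mapsto: "graph (mapsto xs t X Y) =
    Compr xs (pair (tuple (map Var xs)) t) (Mem (tuple (map Var xs)) X)"
  and src_mapsto [simp]: "src (mapsto xs t X Y) = X"
  and tgt_mapsto [simp]: "tgt (mapsto xs t X Y) = Y"
  by (simp_all add: mapsto_def)

lemma src_comp_sfun [simp]: "src (comp_sfun g f) = src f"
  and tgt_comp_sfun [simp]: "tgt (comp_sfun g f) = tgt g"
  by (simp_all add: comp_sfun_def Let_def)

lemma src_prod_sfun [simp]: "src (prod_sfun fs) = ProdS (map src fs)"
  and tgt_prod_sfun [simp]: "tgt (prod_sfun fs) = ProdS (map tgt fs)"
  by (simp_all add: prod_sfun_def Let_def)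

context lst
begin

section \<open>Equality of pairs and typing of closed relations\<close>

lemma pair_inject:
  assumes "\<Gamma> \<turnstile> Eq (pair s t) (pair s' t')"
  shows "\<Gamma> \<turnstile> Eq s s'" "\<Gamma> \<turnstile> Eq t t'"
proof -
  have w: "wf_trm L s" "wf_trm L t" "wf_trm L s'" "wf_trm L t'" "ctx \<Gamma>"
    using eq_wf[OF assms] by auto
  have e: "\<Gamma> \<turnstile> Eq (Tup [s, t]) (Tup [s', t'])" using assms by simp
  have *: "\<Gamma> \<turnstile> Eq ([s, t] ! i) ([s', t'] ! i)" if "i < 2" for i
  proof -
    have "\<Gamma> \<turnstile> Eq (Proj i (Tup [s, t])) (Proj i (Tup [s', t']))"
      by (rule Proj_cong[OF e]) (use w that in auto)
    moreover have "\<Gamma> \<turnstile> Eq (Proj i (Tup [s, t])) ([s, t] ! i)"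
      "\<Gamma> \<turnstile> Eq (Proj i (Tup [s', t'])) ([s', t'] ! i)"
      by (rule Tup_Proj; use w that in auto)+
    ultimately show ?thesis using eq_sym eq_trans by blast
  qed
  show "\<Gamma> \<turnstile> Eq s s'" "\<Gamma> \<turnstile> Eq t t'" using *[of 0] *[of 1] by simp_all
qed

lemma rel_cong:
  "\<Gamma> \<turnstile> Mem (pair s t) R \<Longrightarrow> \<Gamma> \<turnstile> Eq s s' \<Longrightarrow> \<Gamma> \<turnstile> Eq t t' \<Longrightarrow> \<Gamma> \<turnstile> Mem (pair s' t') R"
  using Mem_cong pair_cong by blast

lemma formula_rel:
  "closed_rel f \<Longrightarrow> formula L (Mem (pair s t) (graph f)) \<longleftrightarrow>
    wf_trm L s \<and> wf_trm L t \<and> ty_of s = elem_ty (src f) \<and> ty_of t = elem_ty (tgt f)"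
  by (auto simp: closed_rel_def)

lemma fv_rel: "closed_rel f \<Longrightarrow> fv (Mem (pair s t) (graph f)) = fv s \<union> fv t"
  by (auto simp: closed_rel_def)

lemma closed_rel_mapsto:
  assumes "closed_set X" "elem_ty X = prod_ty (map vty xs)" "wf_trm L t" "ty_of t = elem_ty Y"
    "fv t \<subseteq> set xs" "\<forall>x \<in> set xs. wf_ty L (vty x)"
  shows "closed_rel (mapsto xs t X Y)"
proof -
  have "wf_trm L (graph (mapsto xs t X Y))"
    unfolding graph_mapsto by (rule wf_Compr) (use assms in \<open>auto simp: closed_set_def comp_def\<close>)
  then show ?thesis using assms
    by (auto simp: closed_rel_def graph_mapsto fv_Compr closed_set_def comp_def)
qed

subsection \<open>Subset inclusions\<close>

text \<open>Covers two maps of the translation: the inclusion of \<open>tgt f\<close> into its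
  universal set, and the identities of universal sets, where \<open>X\<close> and \<open>W\<close>
  coincide.\<close>

lemma inclusion_intro:
  assumes X: "closed_set X" "vty z = elem_ty X" and s: "wf_trm L s" "ty_of s = elem_ty X"
    "fv s \<inter> vars (graph (mapsto [z] (Var z) X W)) = {}"
  shows "{Mem s X} \<turnstile> Mem (pair s s) (graph (mapsto [z] (Var z) X W))"
proof -
  have vC: "z \<in> vars (graph (mapsto [z] (Var z) X W))"
    using vars_Compr[of "[z]"] by (auto simp: graph_mapsto)
  then have z: "z \<notin> fv s" using s(3) by auto
  have wz: "wf_ty L (vty z)" using X(2) s wf_ty_of by metis
  have c: "ctx (defs [z] [s] \<union> {Mem s X})" using X s wz by (auto simp: closed_set_def)
  have e: "defs [z] [s] \<union> {Mem s X} \<turnstile> Eq (Var z) s" by (rule hyp[OF c]) simp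
  have "defs [z] [s] \<union> {Mem s X} \<turnstile> Mem s X" by (rule hyp[OF c]) simp
  then have m: "defs [z] [s] \<union> {Mem s X} \<turnstile> Mem (tuple (map Var [z])) X"
    using eq_sym[OF e] Mem_cong by simp
  have p: "defs [z] [s] \<union> {Mem s X} \<turnstile> Eq (pair (tuple (map Var [z])) (Var z)) (pair s s)"
    using pair_cong[OF e e] by simp
  show ?thesis unfolding graph_mapsto
    by (rule Compr_intro_defs[OF m p]) (use z wz X in \<open>auto simp: closed_set_def\<close>)
qed

lemma inclusion_elim:
  assumes X: "closed_set X" "vty z = elem_ty X"
    and s: "wf_trm L s" "ty_of s = elem_ty X" "fv s \<inter> vars (graph (mapsto [z] (Var z) X W)) = {}"
    and t: "wf_trm L t" "ty_of t = elem_ty X" "fv t \<inter> vars (graph (mapsto [z] (Var z) X W)) = {}"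
  shows "{Mem (pair s t) (graph (mapsto [z] (Var z) X W))} \<turnstile> Eq s t"
proof -
  have wz: "wf_ty L (vty z)" using X(2) s wf_ty_of by metis
  define \<Gamma> where "\<Gamma> = {Eq (pair s t) (pair (tuple (map Var [z])) (Var z)), Mem (tuple (map Var [z])) X}"
  have c: "ctx \<Gamma>" using X s t wz by (auto simp: closed_set_def \<Gamma>_def)
  have "\<Gamma> \<turnstile> Eq (pair s t) (pair (tuple (map Var [z])) (Var z))"
    by (rule hyp[OF c]) (simp add: \<Gamma>_def)
  note this' = pair_inject[OF this]
  then have "\<Gamma> \<turnstile> Eq s t" using eq_sym eq_trans by (metis list.map tuple.simps(2))
  then show ?thesis unfolding graph_mapsto \<Gamma>_def
    by (rule Compr_left) (use wz s(3) t(3) in \<open>auto simp: graph_mapsto\<close>)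
qed

subsection \<open>Products\<close>

definition prod_xs :: "('g, 'f) sfun list \<Rightarrow> 'g var list" where
  "prod_xs fs = fresh_list (map (elem_ty \<circ> src) fs) (\<Union>f \<in> set fs. vars (graph f))"

definition prod_ys :: "('g, 'f) sfun list \<Rightarrow> 'g var list" where
  "prod_ys fs = fresh_list (map (elem_ty \<circ> tgt) fs) ((\<Union>f \<in> set fs. vars (graph f)) \<union> set (prod_xs fs))"

definition prod_body :: "('g, 'f) sfun list \<Rightarrow> ('g, 'f) trm list" where
  "prod_body fs = map2 (\<lambda>(x, y) f. Mem (pair (Var x) (Var y)) (graph f)) (zip (prod_xs fs) (prod_ys fs)) fs"

lemma graph_prod_sfun: "graph (prod_sfun fs) = Compr (prod_xs fs @ prod_ys fs)
    (pair (tuple (map Var (prod_xs fs))) (tuple (map Var (prod_ys fs)))) (Conj_list (prod_body fs))"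
  by (simp add: prod_sfun_def prod_xs_def prod_ys_def prod_body_def Let_def)

lemma prod_vars:
  "length (prod_xs fs) = length fs" "length (prod_ys fs) = length fs"
  "map vty (prod_xs fs) = map (elem_ty \<circ> src) fs" "map vty (prod_ys fs) = map (elem_ty \<circ> tgt) fs"
  "distinct (prod_xs fs @ prod_ys fs)"
  "set (prod_xs fs @ prod_ys fs) \<subseteq> vars (graph (prod_sfun fs))"
  using fresh_list_facts[of "\<Union>f \<in> set fs. vars (graph f)" "map (elem_ty \<circ> src) fs", folded prod_xs_def]
    fresh_list_facts[of "(\<Union>f \<in> set fs. vars (graph f)) \<union> set (prod_xs fs)"
      "map (elem_ty \<circ> tgt) fs", folded prod_ys_def]
    vars_Compr[of "prod_xs fs @ prod_ys fs"
      "pair (tuple (map Var (prod_xs fs))) (tuple (map Var (prod_ys fs)))"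
      "Conj_list (prod_body fs)", folded graph_prod_sfun]
  by (auto simp del: tuple.simps)

lemma prod_vars_nth:
  assumes "\<forall>f \<in> set fs. closed_rel f" "i < length fs"
  shows "vty (prod_xs fs ! i) = elem_ty (src (fs ! i))" "vty (prod_ys fs ! i) = elem_ty (tgt (fs ! i))"
    "wf_ty L (vty (prod_xs fs ! i))" "wf_ty L (vty (prod_ys fs ! i))"
proof -
  show 1: "vty (prod_xs fs ! i) = elem_ty (src (fs ! i))" "vty (prod_ys fs ! i) = elem_ty (tgt (fs ! i))"
    using arg_cong[OF prod_vars(3)[of fs], of "\<lambda>l. l ! i"] arg_cong[OF prod_vars(4)[of fs], of "\<lambda>l. l ! i"]
      assms(2) by (simp_all add: prod_vars(1,2))
  have "closed_rel (fs ! i)" using assms by simp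
  then show "wf_ty L (vty (prod_xs fs ! i))" "wf_ty L (vty (prod_ys fs ! i))"
    unfolding 1 using closed_rel_wf_ty by blast+
qed

lemma prod_vars_wf:
  assumes "\<forall>f \<in> set fs. closed_rel f"
  shows "\<forall>x \<in> set (prod_xs fs @ prod_ys fs). wf_ty L (vty x)"
  using prod_vars_nth(3,4)[OF assms] prod_vars(1,2)[of fs] by (auto simp: in_set_conv_nth)

lemma set_prod_body: "set (prod_body fs) =
    {Mem (pair (Var (prod_xs fs ! i)) (Var (prod_ys fs ! i))) (graph (fs ! i)) |i. i < length fs}"
proof -
  have l: "length (zip (prod_xs fs) (prod_ys fs)) = length fs" by (simp add: prod_vars)
  show ?thesis unfolding prod_body_def set_map2_nth[OF l]
    by (rule Collect_cong, rule ex_cong1) (auto simp: prod_vars)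
qed

lemma formula_prod_body:
  assumes "\<forall>f \<in> set fs. closed_rel f"
  shows "formula L (Conj_list (prod_body fs))"
  unfolding formula_Conj_list set_prod_body
  using prod_vars_nth[OF assms] assms by (auto simp: formula_rel simp del: tuple.simps formula_Mem)

lemma closed_rel_prod_sfun:
  assumes "\<forall>f \<in> set fs. closed_rel f"
  shows "closed_rel (prod_sfun fs)"
proof -
  have "wf_trm L (graph (prod_sfun fs))"
    unfolding graph_prod_sfun
    by (rule wf_Compr) (use prod_vars_wf[OF assms] formula_prod_body[OF assms] in auto)
  moreover have "fv (Conj_list (prod_body fs)) \<subseteq> set (prod_xs fs @ prod_ys fs)"
    unfolding fv_Conj_list set_prod_body using assms
    by (auto simp: fv_rel prod_vars(1,2) simp del: tuple.simps fv.simps(8))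
  then have "fv (graph (prod_sfun fs)) = {}"
    unfolding graph_prod_sfun fv_Compr by auto
  moreover have "ty_of (graph (prod_sfun fs)) =
      PowT (ProdT [elem_ty (src (prod_sfun fs)), elem_ty (tgt (prod_sfun fs))])"
    using prod_vars(3,4)[of fs] unfolding graph_prod_sfun by (simp add: comp_def)
  ultimately show ?thesis by (simp add: closed_rel_def)
qed

text \<open>The bound variables of the product graph are equated with the projections of
  \<open>s\<close> and \<open>t\<close>. Each conjunct of the body is then a premise up to equality,
  and surjective pairing rebuilds both tuples.\<close>

lemma prod_sfun_intro:
  assumes fs: "\<forall>f \<in> set fs. closed_rel f" "fs \<noteq> []"
    and s: "wf_trm L s" "ty_of s = prod_ty (map (elem_ty \<circ> src) fs)" "fv s \<inter> vars (graph (prod_sfun fs)) = {}"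
    and t: "wf_trm L t" "ty_of t = prod_ty (map (elem_ty \<circ> tgt) fs)" "fv t \<inter> vars (graph (prod_sfun fs)) = {}"
    and n: "n = length fs"
    and m: "\<And>i. i < n \<Longrightarrow> \<Delta> \<turnstile> Mem (pair (prj n i s) (prj n i t)) (graph (fs ! i))"
  shows "\<Delta> \<turnstile> Mem (pair s t) (graph (prod_sfun fs))"
proof -
  \<comment> \<open>The premises themselves serve as an intermediate context. Their free variables
    are those of \<open>s\<close> and \<open>t\<close> and so avoid the bound variables of the
    graph, which is not known of \<Delta>; cutting with \<open>m\<close> returns to \<Delta> at the
    end.\<close>
  define \<Gamma> where "\<Gamma> = (\<lambda>i. Mem (pair (prj n i s) (prj n i t)) (graph (fs ! i))) ` {..<n}"
  define xs where "xs = prod_xs fs"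
  define ys where "ys = prod_ys fs"
  define ss where "ss = map (\<lambda>i. prj n i s) [0..<n]"
  define ts where "ts = map (\<lambda>i. prj n i t) [0..<n]"
  note v = prod_vars[of fs, folded xs_def ys_def] and vn = prod_vars_nth[OF fs(1), folded xs_def ys_def]
  have cr: "closed_rel (fs ! i)" if "i < n" for i using fs that n by simp
  have cG: "ctx \<Gamma>"
    using entails_wf[OF m] unfolding ctx_def \<Gamma>_def by auto
  have len: "length (xs @ ys) = length (ss @ ts)" by (simp add: ss_def ts_def v n)
  have tys: "map vty (xs @ ys) = map ty_of (ss @ ts)"
  proof -
    have "map vty xs = map ty_of ss"
      by (rule nth_equalityI) (use v(1) vn s ty_of_prj[of s "map (elem_ty \<circ> src) fs"] in \<open>auto simp: ss_def n\<close>)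
    moreover have "map vty ys = map ty_of ts"
      by (rule nth_equalityI) (use v(2) vn t ty_of_prj[of t "map (elem_ty \<circ> tgt) fs"] in \<open>auto simp: ts_def n\<close>)
    ultimately show ?thesis by simp
  qed
  have wss: "wf_trm L r" if "r \<in> set (ss @ ts)" for r
    using that wf_prj[OF s(1,2)] wf_prj[OF t(1,2)] by (auto simp: ss_def ts_def n)
  define D where "D = defs (xs @ ys) (ss @ ts) \<union> \<Gamma>"
  have c: "ctx D" using ctx_defs[OF len wss tys] cG by (simp add: D_def)
  have ex: "D \<turnstile> Eq (Var (xs ! i)) (prj n i s)" if "i < n" for i
    using in_defs[OF len, of i] that v(1) by (intro hyp[OF c]) (auto simp: ss_def n D_def nth_append)
  have ey: "D \<turnstile> Eq (Var (ys ! i)) (prj n i t)" if "i < n" for i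
    \<comment> \<open>The equations for \<open>ys\<close> follow the \<open>n\<close> equations for
      \<open>xs\<close>, hence the shift by \<open>n\<close>.\<close>
    using in_defs[OF len, of "n + i"] that v(1,2) by (intro hyp[OF c]) (auto simp: ss_def ts_def n D_def nth_append)
  have "\<Gamma> \<turnstile> Mem (pair s t) (graph (prod_sfun fs))"
    unfolding graph_prod_sfun xs_def[symmetric] ys_def[symmetric]
  proof (rule Compr_intro_defs[OF _ _ len v(5)])
    show "defs (xs @ ys) (ss @ ts) \<union> \<Gamma> \<turnstile> Conj_list (prod_body fs)" unfolding D_def[symmetric]
    proof (rule Conj_listI[OF _ c])
      fix a assume "a \<in> set (prod_body fs)"
      then obtain i where i: "i < n" "a = Mem (pair (Var (xs ! i)) (Var (ys ! i))) (graph (fs ! i))"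
        unfolding set_prod_body xs_def ys_def n by blast
      have "D \<turnstile> Mem (pair (prj n i s) (prj n i t)) (graph (fs ! i))"
        by (rule hyp[OF c]) (use i in \<open>auto simp: D_def \<Gamma>_def\<close>)
      then show "D \<turnstile> a" unfolding i(2) using eq_sym[OF ex[OF i(1)]] eq_sym[OF ey[OF i(1)]] by (rule rel_cong)
    qed
    have 1: "D \<turnstile> Eq (tuple (map Var xs)) (tuple ss)"
      by (rule tuple_cong) (use v(1) ex c in \<open>auto simp: ss_def n\<close>)
    have 2: "D \<turnstile> Eq s (tuple ss)"
      using tuple_prj[OF s(1,2) _ c] fs(2) by (simp add: ss_def n)
    have 3: "D \<turnstile> Eq (tuple (map Var ys)) (tuple ts)"
      by (rule tuple_cong) (use v(2) ey c in \<open>auto simp: ts_def n\<close>)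
    have 4: "D \<turnstile> Eq t (tuple ts)"
      using tuple_prj[OF t(1,2) _ c] fs(2) by (simp add: ts_def n)
    show "defs (xs @ ys) (ss @ ts) \<union> \<Gamma> \<turnstile>
        Eq (pair (tuple (map Var xs)) (tuple (map Var ys))) (pair s t)"
      unfolding D_def[symmetric]
      by (rule pair_cong[OF eq_trans[OF 1 eq_sym[OF 2]] eq_trans[OF 3 eq_sym[OF 4]]])
    show "\<forall>x \<in> set (xs @ ys). wf_ty L (vty x)" using prod_vars_wf[OF fs(1)] by (simp add: xs_def ys_def)
    show "fv g \<inter> set (xs @ ys) = {}" if "g \<in> \<Gamma>" for g
    proof -
      have "fv g = fv s \<union> fv t"
        using that cr by (auto simp: \<Gamma>_def fv_rel simp del: tuple.simps fv.simps)
      then show ?thesis using v(6) s(3) t(3) by blast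
    qed
  qed (use v(6) s(3) t(3) in \<open>auto simp: ss_def ts_def\<close>)
  then show ?thesis
    by (rule cut_set) (use m entails_wf[OF m[of 0]] n fs(2) in \<open>auto simp: \<Gamma>_def\<close>)
qed

text \<open>With generic bound tuples, injectivity of pairing identifies \<open>s\<close> and
  \<open>t\<close> with them. Their projections are then equal to the bound variables, and the
  conjunct with index \<open>i\<close> is carried over.\<close>

lemma prod_sfun_elim:
  assumes fs: "\<forall>f \<in> set fs. closed_rel f" "fs \<noteq> []"
    and s: "wf_trm L s" "ty_of s = prod_ty (map (elem_ty \<circ> src) fs)" "fv s \<inter> vars (graph (prod_sfun fs)) = {}"
    and t: "wf_trm L t" "ty_of t = prod_ty (map (elem_ty \<circ> tgt) fs)" "fv t \<inter> vars (graph (prod_sfun fs)) = {}"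
    and n: "n = length fs" and i: "i < n"
  shows "{Mem (pair s t) (graph (prod_sfun fs))} \<turnstile> Mem (pair (prj n i s) (prj n i t)) (graph (fs ! i))"
proof -
  define xs where "xs = prod_xs fs"
  define ys where "ys = prod_ys fs"
  note v = prod_vars[of fs, folded xs_def ys_def] and vn = prod_vars_nth[OF fs(1), folded xs_def ys_def]
  have cr: "closed_rel (fs ! i)" using fs i n by simp
  define D where "D = {Eq (pair s t) (pair (tuple (map Var xs)) (tuple (map Var ys))), Conj_list (prod_body fs)}"
  have w: "\<forall>x \<in> set (xs @ ys). wf_ty L (vty x)" using prod_vars_wf[OF fs(1)] by (simp add: xs_def ys_def)
  have c: "ctx D" using formula_prod_body[OF fs(1)] w s t v(3,4) by (auto simp: D_def comp_def)
  have "D \<turnstile> Eq (pair s t) (pair (tuple (map Var xs)) (tuple (map Var ys)))"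
    by (rule hyp[OF c]) (simp add: D_def)
  note e = pair_inject[OF this]
  have "D \<turnstile> Eq (prj n i s) (prj n i (tuple (map Var xs)))"
    using prj_cong[OF e(1) s(2)] i n by simp
  moreover have "D \<turnstile> Eq (prj n i (tuple (map Var xs))) (map Var xs ! i)"
    by (rule prj_tuple) (use w i n v(1) c in auto)
  ultimately have es: "D \<turnstile> Eq (Var (xs ! i)) (prj n i s)"
    using eq_sym eq_trans i n v(1) by (metis nth_map)
  have "D \<turnstile> Eq (prj n i t) (prj n i (tuple (map Var ys)))"
    using prj_cong[OF e(2) t(2)] i n by simp
  moreover have "D \<turnstile> Eq (prj n i (tuple (map Var ys))) (map Var ys ! i)"
    by (rule prj_tuple) (use w i n v(2) c in auto)
  ultimately have et: "D \<turnstile> Eq (Var (ys ! i)) (prj n i t)"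
    using eq_sym eq_trans i n v(2) by (metis nth_map)
  have "D \<turnstile> Conj_list (prod_body fs)" by (rule hyp[OF c]) (simp add: D_def)
  then have "D \<turnstile> Mem (pair (Var (xs ! i)) (Var (ys ! i))) (graph (fs ! i))"
    by (rule Conj_listE) (use i n in \<open>auto simp: set_prod_body xs_def ys_def\<close>)
  then have "D \<turnstile> Mem (pair (prj n i s) (prj n i t)) (graph (fs ! i))"
    using es et by (rule rel_cong)
  then show ?thesis unfolding D_def graph_prod_sfun xs_def[symmetric] ys_def[symmetric]
  proof (rule Compr_left)
    show "fv g \<inter> vars (Compr (xs @ ys) (pair (tuple (map Var xs)) (tuple (map Var ys)))
       (Conj_list (prod_body fs))) = {}" 
      if "g \<in> {Mem (pair (prj n i s) (prj n i t)) (graph (fs ! i))}" for g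
      using that s(3) t(3) cr unfolding graph_prod_sfun xs_def[symmetric] ys_def[symmetric]
      by (auto simp: fv_rel simp del: tuple.simps fv.simps)
    show "fv (pair s t) \<inter> vars (Compr (xs @ ys) (pair (tuple (map Var xs)) (tuple (map Var ys)))
       (Conj_list (prod_body fs))) = {}" 
      using s(3) t(3) unfolding graph_prod_sfun xs_def[symmetric] ys_def[symmetric] by auto
  qed (fact w)
qed

subsection \<open>Composites\<close>

definition comp_x :: "('g, 'f) sfun \<Rightarrow> ('g, 'f) sfun \<Rightarrow> 'g var" where
  "comp_x g f = fresh (elem_ty (src f)) (vars (graph f) \<union> vars (graph g))"

definition comp_y :: "('g, 'f) sfun \<Rightarrow> ('g, 'f) sfun \<Rightarrow> 'g var" where
  "comp_y g f = fresh (elem_ty (tgt f)) (insert (comp_x g f) (vars (graph f) \<union> vars (graph g)))"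

definition comp_z :: "('g, 'f) sfun \<Rightarrow> ('g, 'f) sfun \<Rightarrow> 'g var" where
  "comp_z g f = fresh (elem_ty (tgt g))
     (insert (comp_y g f) (insert (comp_x g f) (vars (graph f) \<union> vars (graph g))))"

definition comp_body :: "('g, 'f) sfun \<Rightarrow> ('g, 'f) sfun \<Rightarrow> ('g, 'f) trm" where
  "comp_body g f = Conj (Mem (pair (Var (comp_x g f)) (Var (comp_y g f))) (graph f))
     (Mem (pair (Var (comp_y g f)) (Var (comp_z g f))) (graph g))"

lemma graph_comp_sfun: "graph (comp_sfun g f) = Compr [comp_x g f, comp_z g f]
    (pair (Var (comp_x g f)) (Var (comp_z g f))) (Exists (comp_y g f) (comp_body g f))"
  by (simp add: comp_sfun_def comp_x_def comp_y_def comp_z_def comp_body_def Let_def)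

lemma comp_vars:
  "vty (comp_x g f) = elem_ty (src f)" "vty (comp_y g f) = elem_ty (tgt f)" "vty (comp_z g f) = elem_ty (tgt g)"
  "distinct [comp_x g f, comp_y g f, comp_z g f]"
  "{comp_x g f, comp_y g f, comp_z g f} \<subseteq> vars (graph (comp_sfun g f))"
proof -
  define V where "V = vars (graph f) \<union> vars (graph g)"
  have "comp_y g f \<notin> insert (comp_x g f) V" "comp_z g f \<notin> insert (comp_y g f) (insert (comp_x g f) V)"
    unfolding comp_y_def comp_z_def V_def by (rule fresh_notin; simp)+
  then show "distinct [comp_x g f, comp_y g f, comp_z g f]" by auto
  show "{comp_x g f, comp_y g f, comp_z g f} \<subseteq> vars (graph (comp_sfun g f))"
    using vars_Compr[of "[comp_x g f, comp_z g f]" "pair (Var (comp_x g f)) (Var (comp_z g f))"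
        "Exists (comp_y g f) (comp_body g f)"] vars_Exists[of "comp_y g f" "comp_body g f"]
    unfolding graph_comp_sfun by auto
qed (simp_all add: comp_x_def comp_y_def comp_z_def)

context
  fixes f g :: "('g, 'f) sfun"
  assumes f: "closed_rel f" and g: "closed_rel g" and fg: "elem_ty (tgt f) = elem_ty (src g)"
begin

lemma comp_vars_wf: "wf_ty L (vty (comp_x g f))" "wf_ty L (vty (comp_y g f))" "wf_ty L (vty (comp_z g f))"
  using closed_rel_wf_ty[OF f] closed_rel_wf_ty[OF g] by (simp_all add: comp_vars)

lemma formula_comp_body: "formula L (comp_body g f)"
  using comp_vars_wf by (simp add: comp_body_def formula_rel[OF f] formula_rel[OF g] comp_vars fg
      del: tuple.simps formula_Mem)

lemma closed_rel_comp_sfun: "closed_rel (comp_sfun g f)"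
proof -
  have "wf_trm L (graph (comp_sfun g f))"
    unfolding graph_comp_sfun
    by (rule wf_Compr) (use comp_vars_wf formula_comp_body in auto)
  moreover have "fv (comp_body g f) \<subseteq> {comp_x g f, comp_y g f, comp_z g f}"
    by (auto simp: comp_body_def fv_rel[OF f] fv_rel[OF g] simp del: tuple.simps fv.simps(8))
  then have "fv (graph (comp_sfun g f)) = {}"
    unfolding graph_comp_sfun fv_Compr by auto
  ultimately show ?thesis by (simp add: closed_rel_def graph_comp_sfun comp_vars)
qed

text \<open>The intermediate term \<open>r\<close> is represented by the variable \<open>y\<close>
  that the body quantifies. Its equation has to be discharged before the comprehension is formed,
  while those for \<open>x\<close> and \<open>z\<close> belong to the comprehension.\<close>

lemma comp_sfun_intro:
  assumes s: "fv s \<inter> vars (graph (comp_sfun g f)) = {}"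
    and r: "fv r \<inter> vars (graph (comp_sfun g f)) = {}"
    and t: "fv t \<inter> vars (graph (comp_sfun g f)) = {}"
    and m: "\<Delta> \<turnstile> Mem (pair s r) (graph f)" "\<Delta> \<turnstile> Mem (pair r t) (graph g)"
  shows "\<Delta> \<turnstile> Mem (pair s t) (graph (comp_sfun g f))"
proof -
  define x where "x = comp_x g f"
  define y where "y = comp_y g f"
  define z where "z = comp_z g f"
  note v = comp_vars[of g f, folded x_def y_def z_def] comp_vars_wf[folded x_def y_def z_def]
  \<comment> \<open>As for products, the two premises replace \<Delta> as context because their free
    variables are known to avoid the bound variables of the composite.\<close>
  define \<Gamma> where "\<Gamma> = {Mem (pair s r) (graph f), Mem (pair r t) (graph g)}"
  have w: "wf_trm L s" "ty_of s = elem_ty (src f)" "wf_trm L r" "ty_of r = elem_ty (src g)"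
    "wf_trm L t" "ty_of t = elem_ty (tgt g)"
    using entails_wf[OF m(1)] entails_wf[OF m(2)] formula_rel[OF f] formula_rel[OF g] by blast+
  have cG: "ctx \<Gamma>" using entails_wf[OF m(1)] entails_wf[OF m(2)]
    unfolding \<Gamma>_def by (simp del: tuple.simps formula_Mem)
  define D where "D = insert (Eq (Var y) r) (defs [x, z] [s, t] \<union> \<Gamma>)"
  have c: "ctx D" "ctx (defs [x, z] [s, t] \<union> \<Gamma>)" using cG w v fg by (simp_all add: D_def)
  have e: "D \<turnstile> Eq s (Var x)" "D \<turnstile> Eq r (Var y)" "D \<turnstile> Eq t (Var z)"
    by (rule eq_sym, rule hyp[OF c(1)], simp add: D_def)+
  have "D \<turnstile> Mem (pair s r) (graph f)" "D \<turnstile> Mem (pair r t) (graph g)"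
    by (rule hyp[OF c(1)], simp add: D_def \<Gamma>_def)+
  then have "D \<turnstile> comp_body g f"
    unfolding comp_body_def x_def[symmetric] y_def[symmetric] z_def[symmetric]
    using e by (intro ConjI) (erule rel_cong; assumption)+
  moreover have "{comp_body g f} \<turnstile> Exists y (comp_body g f)"
    by (rule ExistsI[OF formula_comp_body]) (use v in simp)
  ultimately have "D \<turnstile> Exists y (comp_body g f)" using cut1 by blast
  then have a: "defs [x, z] [s, t] \<union> \<Gamma> \<turnstile> Exists y (comp_body g f)"
    unfolding D_def
  proof (rule def_elim)
    have "y \<notin> fv s" "y \<notin> fv r" "y \<notin> fv t" using s r t v(5) by auto
    then show "\<forall>g\<in>insert (Exists y (comp_body g f)) (defs [x, z] [s, t] \<union> \<Gamma>). y \<notin> fv g" "y \<notin> fv r"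
      using v(4) by (auto simp: \<Gamma>_def fv_rel[OF f] fv_rel[OF g] simp del: tuple.simps fv.simps(8))
  qed
  have p: "defs [x, z] [s, t] \<union> \<Gamma> \<turnstile> Eq (pair (Var x) (Var z)) (pair s t)"
    by (rule pair_cong; rule hyp[OF c(2)]; simp)
  have "\<Gamma> \<turnstile> Mem (pair s t) (graph (comp_sfun g f))"
    unfolding graph_comp_sfun x_def[symmetric] y_def[symmetric] z_def[symmetric]
    by (rule Compr_intro_defs[OF a p])
      (use v s r t in \<open>auto simp: \<Gamma>_def fv_rel[OF f] fv_rel[OF g] simp del: tuple.simps(3) fv.simps(8)\<close>)
  then show ?thesis by (rule cut_set) (use m entails_wf[OF m(1)] in \<open>auto simp: \<Gamma>_def\<close>)
qed

text \<open>The intermediate point is returned under a variable \<open>r\<close> of the caller's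
  choice in place of the variable bound in the graph. Such a variable can meet the disjointness
  conditions of the graphs in which it is used next.\<close>

lemma comp_sfun_elim:
  assumes s: "wf_trm L s" "ty_of s = elem_ty (src f)" "fv s \<inter> vars (graph (comp_sfun g f)) = {}"
    and t: "wf_trm L t" "ty_of t = elem_ty (tgt g)" "fv t \<inter> vars (graph (comp_sfun g f)) = {}"
    and r: "vty r = elem_ty (tgt f)" "r \<notin> vars (graph (comp_sfun g f))" "r \<notin> fv s" "r \<notin> fv t"
  shows "{Mem (pair s t) (graph (comp_sfun g f))} \<turnstile>
    Exists r (Conj (Mem (pair s (Var r)) (graph f)) (Mem (pair (Var r) t) (graph g)))"
proof -
  define x where "x = comp_x g f"
  define y where "y = comp_y g f"
  define z where "z = comp_z g f"
  note v = comp_vars[of g f, folded x_def y_def z_def] comp_vars_wf[folded x_def y_def z_def]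
  have wr: "wf_ty L (vty r)" using closed_rel_wf_ty[OF f] r by simp
  define a where "a r = Conj (Mem (pair s (Var r)) (graph f)) (Mem (pair (Var r) t) (graph g))" for r
  have fa: "formula L (a r)" "formula L (a y)"
    using s t r wr v fg unfolding a_def
    by (simp_all add: formula_rel[OF f] formula_rel[OF g] del: tuple.simps formula_Mem)
  have fva: "fv (a u) = fv s \<union> fv t \<union> {u}" for u
    unfolding a_def by (auto simp: fv_rel[OF f] fv_rel[OF g] simp del: tuple.simps fv.simps(8))
  have "{a r} \<turnstile> Exists r (a r)" using fa(1) wr by (rule ExistsI)
  \<comment> \<open>This is the change of bound variable: \<open>y\<close> is substituted for
    \<open>r\<close> in the introduction rule, and the conclusion stays the same because
    \<open>r\<close> is bound in it.\<close>
  then have ay: "{a y} \<turnstile> Exists r (a r)"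
  proof (rule substitute[where t = "Var y" and x = r])
    have gr: "fv (graph f) = {}" "fv (graph g) = {}" using f g by (simp_all add: closed_rel_def)
    then show "free_for (Var y) r u" if "u \<in> {a r}" for u
      using that r by (auto simp: a_def free_for_notin_fv)
    show "{a y} = (\<lambda>g. subst g r (Var y)) ` {a r}"
      using r gr by (auto simp: a_def subst_notin_fv)
  qed (use v r in \<open>auto simp: free_for_notin_fv subst_notin_fv\<close>)
  define E where "E = Eq (pair s t) (pair (Var x) (Var z))"
  define D where "D = {comp_body g f, E}"
  have c: "ctx D" using formula_comp_body s t v by (simp add: D_def E_def)
  have "D \<turnstile> Eq (pair s t) (pair (Var x) (Var z))" by (rule hyp[OF c]) (simp add: D_def E_def)
  note e = pair_inject[OF this]
  have y: "D \<turnstile> Eq (Var y) (Var y)" using c v by auto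
  have b: "D \<turnstile> comp_body g f" by (rule hyp[OF c]) (simp add: D_def)
  have "D \<turnstile> a y" unfolding a_def
  proof (rule ConjI)
    show "D \<turnstile> Mem (pair s (Var y)) (graph f)"
      using ConjE1[OF b[unfolded comp_body_def]] eq_sym[OF e(1)] y
      unfolding x_def y_def z_def by (rule rel_cong)
    show "D \<turnstile> Mem (pair (Var y) t) (graph g)"
      using ConjE2[OF b[unfolded comp_body_def]] y eq_sym[OF e(2)]
      unfolding x_def y_def z_def by (rule rel_cong)
  qed
  with ay have "insert (comp_body g f) {E} \<turnstile> Exists r (a r)" unfolding D_def by (rule cut1)
  then have "insert (Exists y (comp_body g f)) {E} \<turnstile> Exists r (a r)"
    by (rule Exists_left) (use v s(3) t(3) r in \<open>auto simp: fva E_def\<close>)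
  then have "insert E (insert (Exists y (comp_body g f)) {}) \<turnstile> Exists r (a r)"
    by (simp add: insert_commute)
  then have "insert (Mem (pair s t) (graph (comp_sfun g f))) {} \<turnstile> Exists r (a r)"
    unfolding graph_comp_sfun E_def x_def y_def z_def
  proof (rule Compr_left)
    show "fv u \<inter> vars (Compr [comp_x g f, comp_z g f] (pair (Var (comp_x g f)) (Var (comp_z g f)))
       (Exists (comp_y g f) (comp_body g f))) = {}" if "u \<in> {Exists r (a r)}" for u
      using that s(3) t(3) unfolding graph_comp_sfun[symmetric] by (auto simp: fva)
    show "fv (pair s t) \<inter> vars (Compr [comp_x g f, comp_z g f] (pair (Var (comp_x g f)) (Var (comp_z g f)))
       (Exists (comp_y g f) (comp_body g f))) = {}"
      using s(3) t(3) unfolding graph_comp_sfun[symmetric] by auto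
  qed (use v in \<open>auto simp: x_def z_def\<close>)
  then show ?thesis by (simp add: a_def)
qed

end

end

section \<open>The preimage translation\<close>

fun msub :: "('g, 'f) trm \<Rightarrow> 'g var list \<Rightarrow> ('g, 'f) trm list \<Rightarrow> ('g, 'f) trm" where
  "msub a (u # us) (s # ss) = msub (subst a u s) us ss"
| "msub a us ss = a"

lemma fv_msub: "length us = length ss \<Longrightarrow> fv (msub a us ss) \<subseteq> (fv a - set us) \<union> (\<Union>s \<in> set ss. fv s)"
proof (induct us ss arbitrary: a rule: list_induct2)
  case (Cons u us s ss)
  then show ?case using fv_subst_subset[of a u s] by fastforce
qed simp

lemma fv_Subset [simp]: "fv (Subset X Y) = fv X \<union> fv Y"
  using fresh_fv[of "vars X \<union> vars Y" X "elem_ty X"] fresh_fv[of "vars X \<union> vars Y" Y "elem_ty X"]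
  by (auto simp: Subset_def Let_def)

lemma fv_PowS [simp]: "fv (PowS X) = fv X"
  using fresh_fv[of "vars X" X "PowT (elem_ty X)"] by (auto simp: PowS_def Let_def)

context lst
begin

text \<open>Each single substitution is an instance of congruence. The condition
  \<open>bv s = {}\<close> keeps the bound variables of the intermediate formulas among those of
  \<open>a\<close>, so every later term remains free for its variable.\<close>

lemma msub_eq:
  assumes "length us = length ss" "formula L a" "map vty us = map ty_of ss"
    "\<And>s. s \<in> set ss \<Longrightarrow> wf_trm L s \<and> fv s \<inter> (bv a \<union> set us) = {} \<and> bv s = {}"
    "\<And>i. i < length us \<Longrightarrow> \<Gamma> \<turnstile> Eq (Var (us ! i)) (ss ! i)" "ctx \<Gamma>"
  shows "\<Gamma> \<turnstile> Eq a (msub a us ss)"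
  using assms
proof (induct us ss arbitrary: a rule: list_induct2)
  case Nil
  then show ?case by (auto simp: wf_formula)
next
  case (Cons u us s ss)
  have s: "wf_trm L s" "fv s \<inter> (bv a \<union> set (u # us)) = {}" "bv s = {}" "ty_of s = vty u"
    using Cons.prems(2,3) by auto
  have "\<Gamma> \<turnstile> Eq s (Var u)" using Cons.prems(4)[of 0] by (auto intro: eq_sym)
  then have "\<Gamma> \<turnstile> Eq (subst a u s) (subst a u (Var u))"
    by (rule eq_cong)
      (use Cons.prems(1) s in \<open>auto simp: wf_formula free_for_Var_self intro!: free_for_disjoint_bv\<close>)
  then have 1: "\<Gamma> \<turnstile> Eq a (subst a u s)" by (auto simp: subst_Var_self intro: eq_sym)
  have "\<Gamma> \<turnstile> Eq (subst a u s) (msub (subst a u s) us ss)"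
  proof (rule Cons.hyps)
    show "formula L (subst a u s)"
      using Cons.prems(1) s wf_subst by (auto simp: formula_def)
    show "wf_trm L s' \<and> fv s' \<inter> (bv (subst a u s) \<union> set us) = {} \<and> bv s' = {}" if "s' \<in> set ss" for s'
      using Cons.prems(3)[of s'] that bv_subst_subset[of a u s] s(3) by auto
    show "\<Gamma> \<turnstile> Eq (Var (us ! i)) (ss ! i)" if "i < length us" for i
      using Cons.prems(4)[of "Suc i"] that by simp
  qed (use Cons.prems in auto)
  with 1 show ?case using eq_trans by auto
qed

subsection \<open>The values of an S-function\<close>

lemma closed_Coll_mem:
  assumes m: "\<Gamma> \<turnstile> Mem t (Coll u a)" and t: "fv t = {}"
  shows "\<Gamma> \<turnstile> subst a u t"
proof -
  have w: "wf_trm L t" "wf_trm L (Coll u a)" "ty_of t = vty u" "ctx \<Gamma>"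
    using entails_wf[OF m] by auto
  have "\<Gamma> \<turnstile> Iff (Mem t (Coll u a)) (subst a u t)"
    by (rule Coll_iff) (use w t in \<open>auto simp: wf_Coll formula_def intro: free_for_disjoint_bv\<close>)
  then show ?thesis using m eq_mp by blast
qed

text \<open>The variables \<open>u\<close> and \<open>x\<close> are those that \<open>PowS\<close>
  and \<open>Subset\<close> choose. As \<open>G\<close> and \<open>Z\<close> are closed,
  substituting for \<open>u\<close> and \<open>x\<close> reaches only the intended places.\<close>

lemma PowS_mem:
  assumes m: "{} \<turnstile> Mem G (PowS Z)" and G: "fv G = {}" and Z: "fv Z = {}"
    and t: "wf_trm L t" "ty_of t = elem_ty Z"
  shows "{Mem t G} \<turnstile> Mem t Z"
proof -
  define u where "u = fresh (PowT (elem_ty Z)) (vars Z)"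
  define x where "x = fresh (elem_ty Z) (insert u (vars Z))"
  have "x \<noteq> u" unfolding x_def using fresh_notin[of "insert u (vars Z)" "elem_ty Z"] by auto
  moreover have "elem_ty (Var u :: ('g, 'f) trm) = elem_ty Z" by (simp add: elem_ty_def u_def)
  then have sub: "Subset (Var u) Z = Forall x (Imp (Mem (Var x) (Var u)) (Mem (Var x) Z))"
    by (simp add: Subset_def x_def Let_def)
  have "{} \<turnstile> subst (Subset (Var u) Z) u G"
    by (rule closed_Coll_mem[OF _ G]) (use m in \<open>simp add: PowS_def u_def Let_def\<close>)
  ultimately have "{} \<turnstile> Forall x (Imp (Mem (Var x) G) (Mem (Var x) Z))"
    using Z by (simp add: sub subst_notin_fv)
  then have "{} \<turnstile> subst (Imp (Mem (Var x) G) (Mem (Var x) Z)) x t"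
    by (rule ForallE) (use t G Z in \<open>auto simp: x_def free_for_notin_fv\<close>)
  then have i: "{} \<turnstile> Imp (Mem t G) (Mem t Z)" using G Z by (simp add: subst_notin_fv)
  then have c: "ctx {Mem t G}" using entails_wf[OF i] by simp
  show ?thesis by (rule ImpE[OF theorem_weaken[OF i c] hyp[OF c]]) simp
qed

lemma closed_set_S_set: "S_set L X \<longleftrightarrow> closed_set X"
  by (auto simp: S_set_def closed_set_def elem_ty_def)

text \<open>The first conjunct in the definition of \<open>FunS\<close> makes \<open>G\<close> a
  subset of the product. The product term is closed, so putting \<open>G\<close> for the bound
  variable leaves it intact.\<close>

lemma FunS_mem:
  assumes m: "{} \<turnstile> Mem G (FunS X Y)" and G: "fv G = {}" and X: "closed_set X" and Y: "closed_set Y"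
  shows "{} \<turnstile> Mem G (PowS (ProdS [X, Y]))" "ty_of G = PowT (ProdT [elem_ty X, elem_ty Y])"
proof -
  define u where "u = fresh (PowT (prod_ty [elem_ty X, elem_ty Y])) (vars X \<union> vars Y)"
  obtain b where b: "FunS X Y = Coll u (Conj (Mem (Var u) (PowS (ProdS [X, Y]))) b)"
    by (simp add: FunS_def Let_def u_def)
  have cl: "closed_set (ProdS [X, Y])" using X Y by (intro closed_set_ProdS) simp
  then have cl: "fv (PowS (ProdS [X, Y])) = {}" by (simp add: closed_set_def)
  have "{} \<turnstile> subst (Conj (Mem (Var u) (PowS (ProdS [X, Y]))) b) u G"
    by (rule closed_Coll_mem[OF _ G]) (use m b in simp)
  then have "{} \<turnstile> Conj (Mem G (PowS (ProdS [X, Y]))) (subst b u G)"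
    using cl by (simp add: subst_notin_fv)
  then show "{} \<turnstile> Mem G (PowS (ProdS [X, Y]))" by (rule ConjE1)
  show "ty_of G = PowT (ProdT [elem_ty X, elem_ty Y])" using entails_wf[OF m] b by (simp add: u_def)
qed

lemma ProdS_pair_snd:
  assumes X: "closed_set X" and Y: "closed_set Y"
    and s: "wf_trm L s" "ty_of s = elem_ty X" "fv s \<inter> vars (ProdS [X, Y]) = {}"
    and t: "wf_trm L t" "ty_of t = elem_ty Y" "fv t \<inter> vars (ProdS [X, Y]) = {}"
  shows "{Mem (pair s t) (ProdS [X, Y])} \<turnstile> Mem t Y"
proof -
  have "length (ProdS_vars [X, Y]) = 2" by (simp add: ProdS_vars)
  then obtain x y where xy: "ProdS_vars [X, Y] = [x, y]"
    by (metis (no_types, opaque_lifting) One_nat_def Suc_1 length_0_conv length_Suc_conv)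
  have v: "vty x = elem_ty X" "vty y = elem_ty Y" using ProdS_vars(2)[of "[X, Y]"] xy by auto
  have w: "wf_ty L (vty x)" "wf_ty L (vty y)" using wf_ty_of s t v by metis+
  define D where "D = {Eq (pair s t) (pair (Var x) (Var y)), Conj (Mem (Var x) X) (Mem (Var y) Y)}"
  have P: "ProdS [X, Y] = Compr [x, y] (pair (Var x) (Var y)) (Conj (Mem (Var x) X) (Mem (Var y) Y))"
    by (simp add: ProdS_eq xy)
  have c: "ctx D" using X Y s t v w by (auto simp: D_def closed_set_def)
  have "D \<turnstile> Conj (Mem (Var x) X) (Mem (Var y) Y)" by (rule hyp[OF c]) (simp add: D_def)
  then have m: "D \<turnstile> Mem (Var y) Y" by (rule ConjE2)
  have "D \<turnstile> Eq (pair s t) (pair (Var x) (Var y))" by (rule hyp[OF c]) (simp add: D_def)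
  then have "D \<turnstile> Mem t Y" using Mem_cong[OF m eq_sym[OF pair_inject(2)]] by blast
  then show ?thesis unfolding D_def P
    by (rule Compr_left) (use w s(3) t(3) Y in \<open>auto simp: P closed_set_def\<close>)
qed

lemma S_function_closed_rel:
  assumes "S_function L S f"
  shows "closed_rel f" "closed_set (src f)" "closed_set (tgt f)"
proof -
  show X: "closed_set (src f)" and Y: "closed_set (tgt f)"
    using assms by (simp_all add: S_function_def closed_set_S_set)
  show "closed_rel f"
    using FunS_mem(2)[OF _ _ X Y, of "graph f"] assms
    by (auto simp: S_function_def closed_rel_def S_set_def)
qed

text \<open>The inclusion in the translation is defined on \<open>tgt f\<close> alone, so values of
  \<open>f\<close> must be known to lie there. This comes from the graph being a subset of the
  product of source and target.\<close>

lemma S_function_value: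
  assumes f: "S_function L S f"
    and s: "wf_trm L s" "ty_of s = elem_ty (src f)" "fv s \<inter> vars (ProdS [src f, tgt f]) = {}"
    and t: "wf_trm L t" "ty_of t = elem_ty (tgt f)" "fv t \<inter> vars (ProdS [src f, tgt f]) = {}"
  shows "{Mem (pair s t) (graph f)} \<turnstile> Mem t (tgt f)"
proof -
  note cl = S_function_closed_rel[OF f]
  have "closed_set (ProdS [src f, tgt f])" using cl by (intro closed_set_ProdS) simp
  then have P: "fv (ProdS [src f, tgt f]) = {}" by (simp add: closed_set_def)
  have g: "fv (graph f) = {}" using cl by (simp add: closed_rel_def)
  have "{} \<turnstile> Mem (graph f) (PowS (ProdS [src f, tgt f]))"
    by (rule FunS_mem(1)) (use f cl g in \<open>auto simp: S_function_def\<close>)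
  then have "{Mem (pair s t) (graph f)} \<turnstile> Mem (pair s t) (ProdS [src f, tgt f])"
    by (rule PowS_mem) (use g P s t in auto)
  then show ?thesis by (rule cut1[OF ProdS_pair_snd[OF cl(2,3) s t]])
qed

subsection \<open>The canonical interpretation\<close>

context
  fixes ys :: "'g var list" and \<theta> :: "('g, 'f) trm"
  assumes \<theta>: "formula L \<theta>" and ys: "distinct ys" "\<forall>v \<in> set ys. wf_ty L (vty v)"
    "fv \<theta> \<subseteq> set ys" "ys \<noteq> []"
begin

lemma closed_set_Usets: "\<forall>X \<in> set (map (USet \<circ> vty) ys). closed_set X"
  using ys by (auto simp: closed_set_def)

lemma closed_rel_canon_interp: "closed_rel (canon_interp ys \<theta>)"
  unfolding canon_interp_def
  by (rule closed_rel_mapsto)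
    (use \<theta> ys closed_set_ProdS[OF closed_set_Usets] in \<open>auto simp: formula_def comp_def\<close>)

text \<open>The variables \<open>ys\<close> may clash with bound variables of the product of
  universal sets. Membership is thus shown for a fresh \<open>v\<close>, and the tuple is
  substituted for \<open>v\<close> afterwards, which is harmless as the product term is closed. The
  graph itself is entered at its own bound variables \<open>ys\<close>.\<close>

lemma canon_interp_intro: "{} \<turnstile> Mem (pair (tuple (map Var ys)) \<theta>) (graph (canon_interp ys \<theta>))"
proof -
  define Xs :: "('g, 'f) trm list" where "Xs = map (USet \<circ> vty) ys"
  note cP = closed_set_ProdS[OF closed_set_Usets, folded Xs_def]
  have ty: "map elem_ty Xs = map vty ys" "length Xs = length ys" by (simp_all add: Xs_def)
  define v where "v = fresh (prod_ty (map vty ys)) (vars (ProdS Xs))"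
  have v: "v \<notin> vars (ProdS Xs)" "vty v = prod_ty (map vty ys)"
    unfolding v_def by (rule fresh_notin) simp_all
  have "wf_ty L (prod_ty (map vty ys))"
    using wf_ty_of[of "tuple (map Var ys)"] ys by (auto simp: comp_def)
  then have wv: "wf_trm L (Var v)" using v by simp
  have "{} \<turnstile> Mem (Var v) (ProdS Xs)"
  proof (rule ProdS_intro)
    show "{} \<turnstile> Mem (prj (length Xs) i (Var v)) (Xs ! i)" if "i < length Xs" for i
      using that wf_prj[OF wv, of "map elem_ty Xs" i] ty_of_prj[of "Var v :: ('g, 'f) trm" "map elem_ty Xs" i] v ty
      by (auto simp: Xs_def comp_def intro!: USet_mem)
  qed (use closed_set_Usets ys v wv ty in \<open>auto simp: Xs_def comp_def\<close>)
  then have "{} \<turnstile> Mem (tuple (map Var ys)) (ProdS Xs)"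
    by (rule substitute[where t = "tuple (map Var ys)" and x = v])
      (use ys v cP in \<open>auto simp: comp_def closed_set_def subst_notin_fv free_for_notin_fv\<close>)
  moreover have "{Mem (tuple (map Var ys)) (ProdS Xs)} \<turnstile>
      Mem (pair (tuple (map Var ys)) \<theta>) (graph (canon_interp ys \<theta>))"
    unfolding canon_interp_def graph_mapsto Xs_def[symmetric]
    by (rule Compr_intro)
      (use ys \<theta> cP ty in \<open>auto simp: wf_formula closed_set_def comp_def\<close>)
  ultimately show ?thesis using cut1 by blast
qed

text \<open>The variables \<open>ys\<close> are bound in the graph and may not survive in the
  conclusion. Hence the value is expressed by \<theta> at the projections of \<open>v\<close>, which
  equal \<open>ys\<close> while the graph is being unfolded.\<close>

lemma canon_interp_elim:
  assumes v: "vty v = prod_ty (map vty ys)" "v \<notin> vars (graph (canon_interp ys \<theta>))"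
    and t: "formula L t" "fv t \<inter> vars (graph (canon_interp ys \<theta>)) = {}"
    and n: "n = length ys"
  shows "{Mem (pair (Var v) t) (graph (canon_interp ys \<theta>))} \<turnstile>
     Eq (msub \<theta> ys (map (\<lambda>i. prj n i (Var v)) [0..<n])) t"
proof -
  define ss where "ss = map (\<lambda>i. prj n i (Var v :: ('g, 'f) trm)) [0..<n]"
  define X :: "('g, 'f) trm" where "X = ProdS (map (USet \<circ> vty) ys)"
  have cX: "closed_set X" using closed_set_ProdS[OF closed_set_Usets] by (simp add: X_def)
  have G: "graph (canon_interp ys \<theta>) = Compr ys (pair (tuple (map Var ys)) \<theta>) (Mem (tuple (map Var ys)) X)"
    by (simp only: canon_interp_def graph_mapsto X_def)
  have vG: "set ys \<union> vars \<theta> \<subseteq> vars (graph (canon_interp ys \<theta>))"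
    unfolding G using vars_Compr[of ys "pair (tuple (map Var ys)) \<theta>"] by auto
  have wv: "wf_trm L (Var v)"
    using wf_ty_of[of "tuple (map Var ys)"] ys v by (auto simp: comp_def)
  have ty: "vty v = prod_ty (map ty_of (map Var ys))" using v by (simp add: comp_def)
  define D where "D = {Eq (pair (Var v) t) (pair (tuple (map Var ys)) \<theta>), Mem (tuple (map Var ys)) X}"
  have c: "ctx D" using wv \<theta> t cX v ys
    by (auto simp: D_def wf_formula closed_set_def formula_def comp_def X_def)
  have "D \<turnstile> Eq (pair (Var v) t) (pair (tuple (map Var ys)) \<theta>)" by (rule hyp[OF c]) (simp add: D_def)
  note e = pair_inject[OF this]
  have es: "D \<turnstile> Eq (Var (ys ! i)) (ss ! i)" if i: "i < length ys" for i
  proof -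
    have "D \<turnstile> Eq (prj n i (Var v)) (prj n i (tuple (map Var ys)))"
      using prj_cong[OF e(1), of "map vty ys"] v i n by simp
    moreover have "D \<turnstile> Eq (prj n i (tuple (map Var ys))) (map Var ys ! i)"
      by (rule prj_tuple) (use i ys c n in auto)
    ultimately have "D \<turnstile> Eq (prj n i (Var v)) (map Var ys ! i)" by (rule eq_trans)
    then show ?thesis using i n by (auto simp: ss_def intro: eq_sym)
  qed
  have "D \<turnstile> Eq \<theta> (msub \<theta> ys ss)"
  proof (rule msub_eq[OF _ \<theta> _ _ es c])
    show "length ys = length ss" by (simp add: ss_def n)
    show "map vty ys = map ty_of ss"
      by (rule nth_equalityI) (use v ty_of_prj[of "Var v :: ('g, 'f) trm" "map vty ys"] n in \<open>auto simp: ss_def\<close>)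
    show "wf_trm L s \<and> fv s \<inter> (bv \<theta> \<union> set ys) = {} \<and> bv s = {}" if "s \<in> set ss" for s
      using that wf_prj[OF wv, of "map vty ys"] v vG bv_subset_vars[of \<theta>] n by (auto simp: ss_def)
  qed
  then have "D \<turnstile> Eq (msub \<theta> ys ss) t" by (rule eq_trans[OF eq_sym eq_sym[OF e(2)]])
  then have "insert (Mem (pair (Var v) t) (graph (canon_interp ys \<theta>))) {} \<turnstile> Eq (msub \<theta> ys ss) t"
    unfolding D_def G
  proof (rule Compr_left)
    have "length ys = length ss" by (simp add: ss_def n)
    then have "fv (msub \<theta> ys ss) \<subseteq> {v}"
      using fv_msub[of ys ss \<theta>] ys by (auto simp: ss_def)
    then show "fv g \<inter> vars (Compr ys (pair (tuple (map Var ys)) \<theta>) (Mem (tuple (map Var ys)) X)) = {}"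
      if "g \<in> {Iff (msub \<theta> ys ss) t}" for g
      using that v t unfolding G by auto
  qed (use v t ys in \<open>auto simp: G\<close>)
  then show ?thesis by (simp add: ss_def)
qed

end

end

context lst
begin

subsection \<open>Introduction and elimination of the translation\<close>

lemma id_sfun_USet: "\<exists>z. id_sfun (USet A) = mapsto [z] (Var z) (USet A) (USet A) \<and> vty z = A"
  unfolding id_sfun_def Let_def by (rule exI, rule conjI[OF refl]) simp

lemma closed_set_USet: "wf_ty L A \<Longrightarrow> closed_set (USet A)"
  by (simp add: closed_set_def)

lemma id_sfun_intro:
  assumes "wf_trm L s" "ty_of s = A" "fv s \<inter> vars (graph (id_sfun (USet A) :: ('g, 'f) sfun)) = {}" "ctx \<Gamma>"
  shows "\<Gamma> \<turnstile> Mem (pair s s) (graph (id_sfun (USet A)))"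
proof -
  obtain z where z: "id_sfun (USet A :: ('g, 'f) trm) = mapsto [z] (Var z) (USet A) (USet A)" "vty z = A"
    using id_sfun_USet by blast
  have "{Mem s (USet A)} \<turnstile> Mem (pair s s) (graph (mapsto [z] (Var z) (USet A) (USet A)))"
    by (rule inclusion_intro) (use assms z wf_ty_of[OF assms(1)] in \<open>auto simp: closed_set_USet\<close>)
  then show ?thesis unfolding z(1) by (rule cut1[OF _ USet_mem]) (use assms in auto)
qed

lemma id_sfun_elim:
  assumes "wf_trm L s" "ty_of s = A" "fv s \<inter> vars (graph (id_sfun (USet A) :: ('g, 'f) sfun)) = {}"
    and "wf_trm L t" "ty_of t = A" "fv t \<inter> vars (graph (id_sfun (USet A) :: ('g, 'f) sfun)) = {}"
  shows "{Mem (pair s t) (graph (id_sfun (USet A)))} \<turnstile> Eq s t"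
proof -
  obtain z where z: "id_sfun (USet A :: ('g, 'f) trm) = mapsto [z] (Var z) (USet A) (USet A)" "vty z = A"
    using id_sfun_USet by blast
  show ?thesis unfolding z(1)
    by (rule inclusion_elim) (use assms z wf_ty_of[OF assms(1)] in \<open>auto simp: closed_set_USet\<close>)
qed

lemma closed_rel_id_sfun: "wf_ty L A \<Longrightarrow> closed_rel (id_sfun (USet A))"
proof -
  assume A: "wf_ty L A"
  obtain z where z: "id_sfun (USet A :: ('g, 'f) trm) = mapsto [z] (Var z) (USet A) (USet A)" "vty z = A"
    using id_sfun_USet by blast
  show ?thesis unfolding z(1) by (rule closed_rel_mapsto) (use A z in \<open>auto simp: closed_set_USet\<close>)
qed

lemma src_id_sfun [simp]: "src (id_sfun X) = X" and tgt_id_sfun [simp]: "tgt (id_sfun X) = X"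
  by (simp_all add: id_sfun_def Let_def)

section \<open>The translation as a composite of three graphs\<close>

context
  fixes f :: "('g, 'f) sfun" and x y :: "'g var" and ys :: "'g var list" and \<theta> :: "('g, 'f) trm"
  assumes f: "S_function L S f" and vx: "vty x = elem_ty (src f)" and vy: "vty y = elem_ty (tgt f)"
    and xy: "x \<noteq> y" and \<theta>: "formula L \<theta>" and adm: "admissible_seq L y \<theta> ys"
begin

definition comps :: "('g, 'f) sfun \<Rightarrow> ('g, 'f) sfun list" where
  "comps h = map (\<lambda>v. if v = y then h else id_sfun (USet (vty v))) ys"

text \<open>The variable \<open>x\<close> may already occur in \<open>ys\<close>, so this list can
  contain it twice and is not assumed distinct.\<close>

definition xs :: "'g var list" where
  "xs = map (\<lambda>v. if v = y then x else v) ys"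

text \<open>\<open>F\<close>, \<open>J\<close> and \<open>K\<close> are the three factors in the
  order of application; \<open>H\<close> and \<open>G\<close> follow the bracketing in
  \<open>translation\<close>.\<close>

definition K :: "('g, 'f) sfun" where "K = canon_interp ys \<theta>"
definition J :: "('g, 'f) sfun" where "J = prod_sfun (comps (inclusion y (tgt f)))"
definition F :: "('g, 'f) sfun" where "F = prod_sfun (comps f)"
definition H :: "('g, 'f) sfun" where "H = comp_sfun K J"
definition G :: "('g, 'f) sfun" where "G = comp_sfun H F"

lemma translation_eq: "translation ys f x y \<theta> = Mem (pair (tuple (map Var xs)) Tru) (graph G)"
  by (simp only: translation_def natural_formula_def one_times_def G_def H_def F_def J_def K_def
      comps_def xs_def)

lemma ys: "distinct ys" "\<forall>v \<in> set ys. wf_ty L (vty v)" "fv \<theta> \<subseteq> set ys" "y \<in> set ys" "ys \<noteq> []"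
  using adm by (auto simp: admissible_seq_def)

lemma xs: "length xs = length ys" "\<forall>v \<in> set xs. wf_ty L (vty v)" "y \<notin> set xs"
  "i < length ys \<Longrightarrow> xs ! i = (if ys ! i = y then x else ys ! i)"
proof -
  have "wf_ty L (vty x)" using S_function_closed_rel[OF f] closed_rel_wf_ty vx by metis
  then show "\<forall>v \<in> set xs. wf_ty L (vty v)" using ys by (auto simp: xs_def)
qed (use xy in \<open>auto simp: xs_def\<close>)

lemma closed_rel_inclusion: "closed_rel (inclusion y (tgt f))"
  unfolding inclusion_def
  by (rule closed_rel_mapsto) (use S_function_closed_rel[OF f] vy ys in auto)

lemma comps_closed: "closed_rel h \<Longrightarrow> \<forall>g \<in> set (comps h). closed_rel g"
  using ys by (auto simp: comps_def closed_rel_id_sfun)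

lemma comps_basic: "comps h \<noteq> []" "length (comps h) = length ys"
  "i < length ys \<Longrightarrow> comps h ! i = (if ys ! i = y then h else id_sfun (USet (vty (ys ! i))))"
  using ys by (auto simp: comps_def)

lemma comps_types:
  "map (elem_ty \<circ> src) (comps f) = map vty xs" "map (elem_ty \<circ> tgt) (comps f) = map vty ys"
  "map (elem_ty \<circ> src) (comps (inclusion y (tgt f))) = map vty ys"
  "map (elem_ty \<circ> tgt) (comps (inclusion y (tgt f))) = map vty ys"
  by (auto simp: comps_def xs_def vx vy inclusion_def)

lemma rels_closed: "closed_rel K" "closed_rel J" "closed_rel F" "closed_rel H" "closed_rel G"
  and rels_types: "elem_ty (src K) = prod_ty (map vty ys)" "elem_ty (tgt K) = OmegaT"
    "elem_ty (src J) = prod_ty (map vty ys)" "elem_ty (tgt J) = prod_ty (map vty ys)"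
    "elem_ty (src F) = prod_ty (map vty xs)" "elem_ty (tgt F) = prod_ty (map vty ys)"
    "elem_ty (src H) = prod_ty (map vty ys)" "elem_ty (tgt H) = OmegaT"
    "elem_ty (src G) = prod_ty (map vty xs)" "elem_ty (tgt G) = OmegaT"
proof -
  show K: "closed_rel K" unfolding K_def by (rule closed_rel_canon_interp[OF \<theta> ys(1,2,3,5)])
  show J: "closed_rel J" unfolding J_def
    by (rule closed_rel_prod_sfun[OF comps_closed[OF closed_rel_inclusion]])
  show F: "closed_rel F" unfolding F_def
    by (rule closed_rel_prod_sfun[OF comps_closed]) (use S_function_closed_rel[OF f] in simp)
  show t: "elem_ty (src K) = prod_ty (map vty ys)" "elem_ty (tgt K) = OmegaT"
    "elem_ty (src J) = prod_ty (map vty ys)" "elem_ty (tgt J) = prod_ty (map vty ys)"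
    "elem_ty (src F) = prod_ty (map vty xs)" "elem_ty (tgt F) = prod_ty (map vty ys)"
    by (simp_all add: K_def J_def F_def canon_interp_def comp_def comps_types[unfolded comp_def])
  show t': "elem_ty (src H) = prod_ty (map vty ys)" "elem_ty (tgt H) = OmegaT"
    "elem_ty (src G) = prod_ty (map vty xs)" "elem_ty (tgt G) = OmegaT"
    using t by (simp_all add: H_def G_def)
  show H: "closed_rel H" unfolding H_def by (rule closed_rel_comp_sfun[OF J K]) (simp add: t)
  show "closed_rel G" unfolding G_def by (rule closed_rel_comp_sfun[OF F H]) (simp add: t t')
qed

lemma formula_translation: "formula L (translation ys f x y \<theta>)"
  unfolding translation_eq formula_rel[OF rels_closed(5)]
  using xs(2) rels_types formula_Tru[of L] by (auto simp: formula_def comp_def)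

lemma fv_translation: "y \<notin> fv (translation ys f x y \<theta>)"
  unfolding translation_eq fv_rel[OF rels_closed(5)] using xs(3) by auto

text \<open>Bound variables are included: the rules for graphs need arguments that avoid every
  variable of the graph, not only the free ones.\<close>

definition used_vars :: "'g var set" where
  "used_vars = insert x (insert y (set ys \<union> vars (graph K) \<union> vars (graph J) \<union> vars (graph F) \<union>
     vars (graph H) \<union> vars (graph G) \<union> (\<Union>g \<in> set (comps f). vars (graph g)) \<union>
     (\<Union>g \<in> set (comps (inclusion y (tgt f))). vars (graph g)) \<union> vars (ProdS [src f, tgt f]) \<union> vars \<theta>))"

lemma used_vars: "finite used_vars" "x \<in> used_vars" "y \<in> used_vars" "set ys \<subseteq> used_vars" "set xs \<subseteq> used_vars"
  "vars (graph K) \<subseteq> used_vars" "vars (graph J) \<subseteq> used_vars" "vars (graph F) \<subseteq> used_vars" "vars (graph H) \<subseteq> used_vars"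
  "vars (graph G) \<subseteq> used_vars" "vars (ProdS [src f, tgt f]) \<subseteq> used_vars" "vars \<theta> \<subseteq> used_vars"
  "i < length ys \<Longrightarrow> vars (graph (comps f ! i)) \<subseteq> used_vars"
  "i < length ys \<Longrightarrow> vars (graph (comps (inclusion y (tgt f)) ! i)) \<subseteq> used_vars"
  using nth_mem[of i "comps f"] nth_mem[of i "comps (inclusion y (tgt f))"]
  by (auto simp: used_vars_def xs_def comps_basic(2))

text \<open>The four variables stand for the points of a chain: \<open>F\<close> relates
  \<open>p\<close> to \<open>u\<close>, \<open>J\<close> relates \<open>u\<close> to
  \<open>v\<close>, and \<open>K\<close> relates \<open>v\<close> to the truth value
  \<open>q\<close>. The set \<open>U\<close> makes room for the variables of a conclusion that they
  must avoid too.\<close>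

context
  fixes p u v q :: "'g var" and U :: "'g var set" and n :: nat
  assumes fresh: "distinct [p, u, v, q]" "{p, u, v, q} \<inter> (used_vars \<union> U) = {}"
    and types: "vty p = prod_ty (map vty xs)" "vty u = prod_ty (map vty ys)"
      "vty v = prod_ty (map vty ys)" "vty q = OmegaT"
    and n: "n = length ys"
begin

lemma wf_pq: "wf_ty L (vty p)" "wf_ty L (vty u)" "wf_ty L (vty v)" "wf_ty L (vty q)"
  using wf_ty_of[of "tuple (map Var xs)"] wf_ty_of[of "tuple (map Var ys)"] xs(2) ys(2)
  by (simp_all add: types comp_def)

lemma prj_wf:
  assumes "i < n"
  shows "wf_trm L (prj n i (Var p))" "ty_of (prj n i (Var p) :: ('g, 'f) trm) = vty (xs ! i)"
    "wf_trm L (prj n i (Var u))" "ty_of (prj n i (Var u) :: ('g, 'f) trm) = vty (ys ! i)"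
    "wf_trm L (prj n i (Var v))" "ty_of (prj n i (Var v) :: ('g, 'f) trm) = vty (ys ! i)"
  using assms n types wf_pq xs(1)
    wf_prj[of L "Var p" "map vty xs" i] ty_of_prj[of "Var p :: ('g, 'f) trm" "map vty xs" i]
    wf_prj[of L "Var u" "map vty ys" i] ty_of_prj[of "Var u :: ('g, 'f) trm" "map vty ys" i]
    wf_prj[of L "Var v" "map vty ys" i] ty_of_prj[of "Var v :: ('g, 'f) trm" "map vty ys" i]
  by auto

lemma formula_steps:
  "formula L (Mem (pair (Var p) (Var u)) (graph F))" "formula L (Mem (pair (Var u) (Var v)) (graph J))"
  "formula L (Mem (pair (Var v) (Var q)) (graph K))" "formula L (Mem (pair (Var u) (Var q)) (graph H))"
  "formula L (Mem (pair (Var p) (Var q)) (graph G))"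
  unfolding formula_rel[OF rels_closed(1)] formula_rel[OF rels_closed(2)] formula_rel[OF rels_closed(3)]
    formula_rel[OF rels_closed(4)] formula_rel[OF rels_closed(5)]
  by (simp_all add: rels_types types wf_pq[unfolded types])

lemma F_intro:
  assumes "\<And>i. i < n \<Longrightarrow> \<Delta> \<turnstile> Mem (pair (prj n i (Var p)) (prj n i (Var u))) (graph (comps f ! i))"
  shows "\<Delta> \<turnstile> Mem (pair (Var p) (Var u)) (graph F)"
  unfolding F_def
  by (rule prod_sfun_intro[where n = n])
    (use assms comps_closed[OF S_function_closed_rel(1)[OF f]] comps_basic comps_types types wf_pq n
      fresh(2) used_vars(8) in \<open>auto simp: F_def\<close>)

lemma J_intro:
  assumes "\<And>i. i < n \<Longrightarrow> \<Delta> \<turnstile> Mem (pair (prj n i (Var u)) (prj n i (Var v)))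
    (graph (comps (inclusion y (tgt f)) ! i))"
  shows "\<Delta> \<turnstile> Mem (pair (Var u) (Var v)) (graph J)"
  unfolding J_def
  by (rule prod_sfun_intro[where n = n])
    (use assms comps_closed[OF closed_rel_inclusion] comps_basic comps_types types wf_pq n
      fresh(2) used_vars(7) in \<open>auto simp: J_def\<close>)

lemma F_elim:
  assumes "i < n"
  shows "{Mem (pair (Var p) (Var u)) (graph F)} \<turnstile>
    Mem (pair (prj n i (Var p)) (prj n i (Var u))) (graph (comps f ! i))"
  unfolding F_def
  by (rule prod_sfun_elim)
    (use assms comps_closed[OF S_function_closed_rel(1)[OF f]] comps_basic comps_types types wf_pq n
      fresh(2) used_vars(8) in \<open>auto simp: F_def\<close>)

text \<open>Every coordinate of \<open>J\<close> is of the form \<open>z \<mapsto> z\<close>, the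
  inclusion at \<open>y\<close> and an identity elsewhere, so related points agree in each
  component.\<close>

lemma J_elim:
  assumes "i < n"
  shows "{Mem (pair (Var u) (Var v)) (graph J)} \<turnstile> Eq (prj n i (Var u)) (prj n i (Var v))"
proof -
  have i: "i < length ys" using assms n by simp
  have fr: "fv (prj n i (Var u)) \<inter> vars (graph (comps (inclusion y (tgt f)) ! i)) = {}"
    "fv (prj n i (Var v)) \<inter> vars (graph (comps (inclusion y (tgt f)) ! i)) = {}"
    using fresh(2) used_vars(14)[OF i] by auto
  have "{Mem (pair (Var u) (Var v)) (graph J)} \<turnstile>
    Mem (pair (prj n i (Var u)) (prj n i (Var v))) (graph (comps (inclusion y (tgt f)) ! i))"
    unfolding J_def
    by (rule prod_sfun_elim)
      (use assms comps_closed[OF closed_rel_inclusion] comps_basic comps_types types wf_pq n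
        fresh(2) used_vars(7) in \<open>auto simp: J_def\<close>)
  moreover have "{Mem (pair (prj n i (Var u)) (prj n i (Var v))) (graph (comps (inclusion y (tgt f)) ! i))}
      \<turnstile> Eq (prj n i (Var u)) (prj n i (Var v))"
  proof (cases "ys ! i = y")
    case True
    have c: "comps (inclusion y (tgt f)) ! i = mapsto [y] (Var y) (tgt f) (USet (vty y))"
      using True comps_basic(3)[OF i] by (simp add: inclusion_def)
    show ?thesis unfolding c
      by (rule inclusion_elim)
        (use S_function_closed_rel(3)[OF f] vy prj_wf[OF assms] fr True c in auto)
  next
    case False
    then have c: "comps (inclusion y (tgt f)) ! i = id_sfun (USet (vty (ys ! i)))"
      using comps_basic(3)[OF i] by simp
    show ?thesis unfolding c by (rule id_sfun_elim) (use prj_wf[OF assms] fr c in auto)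
  qed
  ultimately show ?thesis using cut1 by blast
qed

lemma F_elim_id:
  assumes "i < n" "ys ! i \<noteq> y"
  shows "{Mem (pair (Var p) (Var u)) (graph F)} \<turnstile> Eq (prj n i (Var p)) (prj n i (Var u))"
proof -
  have i: "i < length ys" using assms n by simp
  have c: "comps f ! i = id_sfun (USet (vty (ys ! i)))"
    using comps_basic(3)[OF i] assms(2) by simp
  have fr: "fv (prj n i (Var p)) \<inter> vars (graph (comps f ! i)) = {}"
    "fv (prj n i (Var u)) \<inter> vars (graph (comps f ! i)) = {}"
    using fresh(2) used_vars(13)[OF i] by auto
  have "{Mem (pair (prj n i (Var p)) (prj n i (Var u))) (graph (comps f ! i))}
      \<turnstile> Eq (prj n i (Var p)) (prj n i (Var u))"
    unfolding c by (rule id_sfun_elim) (use prj_wf[OF assms(1)] fr c xs(4)[OF i] assms(2) in auto)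
  then show ?thesis using F_elim[OF assms(1)] cut1 by blast
qed

text \<open>Under the equations the chain is checked coordinate by coordinate. At \<open>y\<close>
  the step along \<open>F\<close> is the hypothesis on \<open>x\<close> and \<open>y\<close>,
  elsewhere it is an identity; the step along \<open>K\<close> holds since \<theta> is equal to
  \<open>Tru\<close>.\<close>

lemma translation_intro_aux:
  defines "\<Delta> \<equiv> defs [p, u, v, q] [tuple (map Var xs), tuple (map Var ys), tuple (map Var ys), Tru] \<union>
    {\<theta>, Mem (pair (Var x) (Var y)) (graph f)}"
  shows "\<Delta> \<turnstile> Mem (pair (Var p) (Var q)) (graph G)"
proof -
  note clf = S_function_closed_rel[OF f]
  have wx: "wf_ty L (vty x)" using closed_rel_wf_ty[OF clf(1)] vx by simp
  have fxy: "formula L (Mem (pair (Var x) (Var y)) (graph f))"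
    unfolding formula_rel[OF clf(1)] using wx ys vx vy by auto
  have c: "ctx \<Delta>" unfolding \<Delta>_def
    using wf_pq types \<theta> fxy xs ys formula_Tru[of L] by (auto simp: comp_def formula_def)
  have ep: "\<Delta> \<turnstile> Eq (Var p) (tuple (map Var xs))" and eu: "\<Delta> \<turnstile> Eq (Var u) (tuple (map Var ys))"
    and ev: "\<Delta> \<turnstile> Eq (Var v) (tuple (map Var ys))" and eq: "\<Delta> \<turnstile> Eq (Var q) Tru"
    and t: "\<Delta> \<turnstile> \<theta>" and mxy: "\<Delta> \<turnstile> Mem (pair (Var x) (Var y)) (graph f)"
    by (rule hyp[OF c]; simp add: \<Delta>_def)+
  have comp: "\<Delta> \<turnstile> Eq (prj n i (Var w)) (Var (ws ! i))"
    if "\<Delta> \<turnstile> Eq (Var w) (tuple (map Var ws))" "i < n" "length ws = n" "\<forall>v \<in> set ws. wf_ty L (vty v)" for w ws i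
  proof -
    have "vty w = prod_ty (map vty ws)" using entails_wf[OF that(1)] by (simp add: comp_def)
    then have "\<Delta> \<turnstile> Eq (prj n i (Var w)) (prj n i (tuple (map Var ws)))"
      using prj_cong[OF that(1), of "map vty ws" i] that by simp
    moreover have "\<Delta> \<turnstile> Eq (prj n i (tuple (map Var ws))) (map Var ws ! i)"
      by (rule prj_tuple) (use that c in auto)
    ultimately show ?thesis using that eq_trans by fastforce
  qed
  have pu: "\<Delta> \<turnstile> Mem (pair (prj n i (Var p)) (prj n i (Var u))) (graph (comps f ! i))" if i: "i < n" for i
  proof -
    have i': "i < length ys" using i n by simp
    have p: "\<Delta> \<turnstile> Eq (prj n i (Var p)) (Var (xs ! i))" by (rule comp[OF ep i]) (use xs n in auto)
    have u: "\<Delta> \<turnstile> Eq (prj n i (Var u)) (Var (ys ! i))" by (rule comp[OF eu i]) (use ys n in auto)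
    show ?thesis
    proof (cases "ys ! i = y")
      case True
      have "\<Delta> \<turnstile> Mem (pair (Var (xs ! i)) (Var (ys ! i))) (graph (comps f ! i))"
        using mxy True comps_basic(3)[OF i'] xs(4)[OF i'] by simp
      then show ?thesis using eq_sym[OF p] eq_sym[OF u] by (rule rel_cong)
    next
      case False
      then have c': "comps f ! i = id_sfun (USet (vty (ys ! i)))" using comps_basic(3)[OF i'] by simp
      have "\<Delta> \<turnstile> Mem (pair (prj n i (Var p)) (prj n i (Var p))) (graph (comps f ! i))"
        unfolding c' by (rule id_sfun_intro)
          (use prj_wf[OF i] xs(4)[OF i'] False c fresh(2) used_vars(13)[OF i'] c' in auto)
      moreover have "\<Delta> \<turnstile> Eq (prj n i (Var p)) (prj n i (Var u))"
        using p u False xs(4)[OF i'] eq_trans[OF _ eq_sym[OF u]] by simp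
      ultimately show ?thesis by (rule rel_cong[OF _ eq_reflI[OF prj_wf(1)[OF i] c]])
    qed
  qed
  have uv: "\<Delta> \<turnstile> Mem (pair (prj n i (Var u)) (prj n i (Var v))) (graph (comps (inclusion y (tgt f)) ! i))"
    if i: "i < n" for i
  proof -
    have i': "i < length ys" using i n by simp
    have u: "\<Delta> \<turnstile> Eq (prj n i (Var u)) (Var (ys ! i))" by (rule comp[OF eu i]) (use ys n in auto)
    have v: "\<Delta> \<turnstile> Eq (prj n i (Var v)) (Var (ys ! i))" by (rule comp[OF ev i]) (use ys n in auto)
    have euv: "\<Delta> \<turnstile> Eq (prj n i (Var u)) (prj n i (Var v))" using u eq_sym[OF v] by (rule eq_trans)
    have fr: "fv (prj n i (Var u)) \<inter> vars (graph (comps (inclusion y (tgt f)) ! i)) = {}"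
      using fresh(2) used_vars(14)[OF i'] by auto
    have "\<Delta> \<turnstile> Mem (pair (prj n i (Var u)) (prj n i (Var u))) (graph (comps (inclusion y (tgt f)) ! i))"
    proof (cases "ys ! i = y")
      case True
      then have c': "comps (inclusion y (tgt f)) ! i = mapsto [y] (Var y) (tgt f) (USet (vty y))"
        using comps_basic(3)[OF i'] by (simp add: inclusion_def)
      have m: "\<Delta> \<turnstile> Mem (pair (prj n i (Var p)) (prj n i (Var u))) (graph f)"
        using pu[OF i] comps_basic(3)[OF i'] True by simp
      \<comment> \<open>The value is located in \<open>tgt f\<close> for projections of
        \<open>p\<close> and \<open>u\<close>, not for \<open>x\<close> and \<open>y\<close>, which
        may be bound variables of the product term.\<close>
      have "{Mem (pair (prj n i (Var p)) (prj n i (Var u))) (graph f)} \<turnstile> Mem (prj n i (Var u)) (tgt f)"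
        by (rule S_function_value[OF f])
          (use prj_wf[OF i] xs(4)[OF i'] True vx vy fresh(2) used_vars(11) in auto)
      then have "\<Delta> \<turnstile> Mem (prj n i (Var u)) (tgt f)" using m by (rule cut1)
      moreover have "{Mem (prj n i (Var u)) (tgt f)} \<turnstile>
          Mem (pair (prj n i (Var u)) (prj n i (Var u))) (graph (mapsto [y] (Var y) (tgt f) (USet (vty y))))"
        by (rule inclusion_intro) (use clf vy prj_wf[OF i] True fr c' in auto)
      ultimately show ?thesis unfolding c' using cut1 by blast
    next
      case False
      then have c': "comps (inclusion y (tgt f)) ! i = id_sfun (USet (vty (ys ! i)))"
        using comps_basic(3)[OF i'] by simp
      show ?thesis unfolding c' by (rule id_sfun_intro) (use prj_wf[OF i] c fr c' in auto)
    qed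
    then show ?thesis using euv by (rule rel_cong[OF _ eq_reflI[OF prj_wf(3)[OF i] c]])
  qed
  have "\<Delta> \<turnstile> Mem (pair (tuple (map Var ys)) \<theta>) (graph K)"
    unfolding K_def using canon_interp_intro[OF \<theta> ys(1,2,3,5)] c by (rule theorem_weaken)
  \<comment> \<open>The assumption \<theta> makes its truth value equal to \<open>Tru\<close>, and
    so to \<open>q\<close>.\<close>
  then have K: "\<Delta> \<turnstile> Mem (pair (Var v) (Var q)) (graph K)"
    using eq_sym[OF ev] eq_trans[OF eq_TruI[OF t] eq_sym[OF eq]] by (rule rel_cong)
  have H: "\<Delta> \<turnstile> Mem (pair (Var u) (Var q)) (graph H)" unfolding H_def
    by (rule comp_sfun_intro[OF rels_closed(2,1) _ _ _ _ J_intro[OF uv] K])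
      (use rels_types fresh(2) used_vars(9) in \<open>auto simp: H_def\<close>)
  show ?thesis unfolding G_def
    by (rule comp_sfun_intro[OF rels_closed(3,4) _ _ _ _ F_intro[OF pu] H])
      (use rels_types fresh(2) used_vars(10) in \<open>auto simp: G_def\<close>)
qed

lemma translation_intro_fresh:
  "{\<theta>, Mem (pair (Var x) (Var y)) (graph f)} \<turnstile> translation ys f x y \<theta>"
proof -
  define us where "us = [p, u, v, q]"
  define ss :: "('g, 'f) trm list"
    where "ss = [tuple (map Var xs), tuple (map Var ys), tuple (map Var ys), Tru]"
  define \<Delta> where "\<Delta> = defs us ss \<union> {\<theta>, Mem (pair (Var x) (Var y)) (graph f)}"
  have m: "\<Delta> \<turnstile> Mem (pair (Var p) (Var q)) (graph G)"
    using translation_intro_aux by (simp add: \<Delta>_def us_def ss_def)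
  have c: "ctx \<Delta>" using entails_wf[OF m] by simp
  have "\<Delta> \<turnstile> Eq (Var p) (tuple (map Var xs))" "\<Delta> \<turnstile> Eq (Var q) Tru"
    by (rule hyp[OF c]; simp add: \<Delta>_def us_def ss_def)+
  with m have *: "\<Delta> \<turnstile> translation ys f x y \<theta>" unfolding translation_eq by (rule rel_cong)
  show ?thesis
  proof (rule defs_elim[OF _ *[unfolded \<Delta>_def]])
    have "set us \<inter> used_vars = {}" using fresh(2) by (auto simp: us_def)
    then have "set us \<inter> set xs = {}" "set us \<inter> set ys = {}" "set us \<inter> {x, y} = {}"
      using used_vars(2-5) by blast+
    moreover have "fv (translation ys f x y \<theta>) \<subseteq> set xs"
      unfolding translation_eq fv_rel[OF rels_closed(5)] by auto
    moreover have "fv (Mem (pair (Var x) (Var y)) (graph f)) = {x, y}"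
      unfolding fv_rel[OF S_function_closed_rel(1)[OF f]] by auto
    ultimately show "fv g \<inter> set us = {}"
      if "g \<in> insert (translation ys f x y \<theta>) {\<theta>, Mem (pair (Var x) (Var y)) (graph f)}" for g
      using that ys(3) by (auto simp del: fv.simps(8) tuple.simps)
    show "fv s \<inter> set us = {}" if "s \<in> set ss" for s
      using that \<open>set us \<inter> set xs = {}\<close> \<open>set us \<inter> set ys = {}\<close> by (auto simp: ss_def)
  qed (use fresh in \<open>auto simp: us_def ss_def\<close>)
qed

text \<open>A generic chain yields \<theta> at the components of \<open>v\<close> and the pair of
  \<open>x\<close> with the \<open>y\<close>-component of \<open>v\<close> in the graph of
  \<open>f\<close>. With \<open>y\<close> equated with that component, these are the hypotheses of
  the sequent for \<xi>.\<close>

lemma translation_elim_fresh: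
  assumes \<xi>: "{\<theta>, Mem (pair (Var x) (Var y)) (graph f)} \<turnstile> \<xi>" and yx: "y \<notin> fv \<xi>" and U: "fv \<xi> \<subseteq> U"
  shows "{translation ys f x y \<theta>} \<turnstile> \<xi>"
proof -
  note clf = S_function_closed_rel[OF f]
  have fxy: "formula L (Mem (pair (Var x) (Var y)) (graph f))" using entails_wf[OF \<xi>] by (simp del: formula_Mem)
  obtain k where k: "k < n" "ys ! k = y" using ys(4) n by (metis in_set_conv_nth)
  have k': "k < length ys" using k n by simp
  define ss :: "('g, 'f) trm list" where "ss = map (\<lambda>i. prj n i (Var v)) [0..<n]"
  define M where "M = msub \<theta> ys ss"
  have len: "length ys = length ss" by (simp add: ss_def n)
  have tyss: "map vty ys = map ty_of ss"
    by (rule nth_equalityI) (use prj_wf n in \<open>auto simp: ss_def\<close>)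
  have wss: "wf_trm L s" if "s \<in> set ss" for s using that prj_wf by (auto simp: ss_def)
  have nv: "v \<notin> vars \<theta>" "v \<notin> set ys" using fresh(2) used_vars(4,12) by auto
  define P where "P = Eq (Var p) (tuple (map Var xs) :: ('g, 'f) trm)"
  define Q where "Q = Eq (Var q) (Tru :: ('g, 'f) trm)"
  define pu where "pu = Mem (pair (Var p) (Var u)) (graph F)"
  define uv where "uv = Mem (pair (Var u) (Var v)) (graph J)"
  define vq where "vq = Mem (pair (Var v) (Var q)) (graph K)"
  define uq where "uq = Mem (pair (Var u) (Var q)) (graph H)"
  define pq where "pq = Mem (pair (Var p) (Var q)) (graph G)"
  have fm: "formula L P" "formula L Q" "formula L pu" "formula L uv" "formula L vq" "formula L uq" "formula L pq"
    using formula_steps types wf_pq xs(2)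
    unfolding P_def Q_def pu_def uv_def vq_def uq_def pq_def
    by (auto simp: comp_def Tru_def simp del: formula_Mem tuple.simps)
  have fvs: "fv P = insert p (set xs)" "fv Q = {q}" "fv pu = {p, u}" "fv uv = {u, v}" "fv vq = {v, q}"
    "fv uq = {u, q}" "fv pq = {p, q}"
    unfolding P_def Q_def pu_def uv_def vq_def uq_def pq_def fv_rel[OF rels_closed(1)]
      fv_rel[OF rels_closed(2)] fv_rel[OF rels_closed(3)] fv_rel[OF rels_closed(4)] fv_rel[OF rels_closed(5)]
    by auto
  have ne: "p \<notin> fv \<xi>" "u \<notin> fv \<xi>" "v \<notin> fv \<xi>" "q \<notin> fv \<xi>" "y \<notin> {p, u, v, q}"
    "p \<notin> set xs" "u \<notin> set xs" "v \<notin> set xs" "q \<notin> set xs"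
    using fresh(2) U used_vars(3,5) by auto
  define \<Gamma> where "\<Gamma> = {P, Q, pu, uv, vq}"
  have c: "ctx \<Gamma>" using fm by (simp add: \<Gamma>_def)
  have h: "\<Gamma> \<turnstile> P" "\<Gamma> \<turnstile> Q" "\<Gamma> \<turnstile> pu" "\<Gamma> \<turnstile> uv" "\<Gamma> \<turnstile> vq"
    by (rule hyp[OF c]; simp add: \<Gamma>_def)+
  \<comment> \<open>\<open>M\<close> is \<theta> evaluated at the components of \<open>v\<close>.
    The graph \<open>K\<close> makes it equal to \<open>q\<close>, and \<open>Q\<close> makes
    \<open>q\<close> true.\<close>
  have "{vq} \<turnstile> Eq M (Var q)" unfolding vq_def M_def ss_def K_def
    by (rule canon_interp_elim[OF \<theta> ys(1,2,3,5)])
      (use types fresh(2) used_vars(6) n in \<open>auto simp: K_def formula_def\<close>)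
  then have "\<Gamma> \<turnstile> Eq M (Var q)" using h(5) by (rule cut1)
  then have M: "\<Gamma> \<turnstile> M" using h(2)[unfolded Q_def] by (rule eq_TruE[OF eq_trans])
  have px: "\<Gamma> \<turnstile> Eq (prj n i (Var p)) (Var (xs ! i))" if i: "i < n" for i
  proof -
    have "\<Gamma> \<turnstile> Eq (prj n i (Var p)) (prj n i (tuple (map Var xs)))"
      using prj_cong[OF h(1)[unfolded P_def], of "map vty xs" i] i n xs(1) types(1) by simp
    moreover have "\<Gamma> \<turnstile> Eq (prj n i (tuple (map Var xs))) (map Var xs ! i)"
      by (rule prj_tuple) (use i n xs c in auto)
    ultimately have "\<Gamma> \<turnstile> Eq (prj n i (Var p)) (map Var xs ! i)" by (rule eq_trans)
    then show ?thesis using i n xs(1) by simp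
  qed
  have uv': "\<Gamma> \<turnstile> Eq (prj n i (Var u)) (prj n i (Var v))" if "i < n" for i
    using J_elim[OF that, folded uv_def] h(4) by (rule cut1)
  \<comment> \<open>Away from \<open>y\<close> the steps along \<open>F\<close> and \<open>J\<close>
    are identities and \<open>xs\<close> agrees with \<open>ys\<close>, which forces the component
    of \<open>v\<close> to equal the variable.\<close>
  have yv: "\<Gamma> \<turnstile> Eq (Var (ys ! i)) (prj n i (Var v))" if i: "i < n" "ys ! i \<noteq> y" for i
  proof -
    have "\<Gamma> \<turnstile> Eq (prj n i (Var p)) (prj n i (Var u))"
      using F_elim_id[OF i, folded pu_def] h(3) by (rule cut1)
    then have "\<Gamma> \<turnstile> Eq (prj n i (Var p)) (prj n i (Var v))" using uv'[OF i(1)] by (rule eq_trans)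
    then have "\<Gamma> \<turnstile> Eq (Var (xs ! i)) (prj n i (Var v))" by (rule eq_trans[OF eq_sym[OF px[OF i(1)]]])
    then show ?thesis using xs(4)[of i] i n by simp
  qed
  have "\<Gamma> \<turnstile> Mem (pair (prj n k (Var p)) (prj n k (Var u))) (graph (comps f ! k))"
    using F_elim[OF k(1), folded pu_def] h(3) by (rule cut1)
  then have "\<Gamma> \<turnstile> Mem (pair (Var (xs ! k)) (prj n k (Var v))) (graph (comps f ! k))"
    using px[OF k(1)] uv'[OF k(1)] by (rule rel_cong)
  then have xv: "\<Gamma> \<turnstile> Mem (pair (Var x) (prj n k (Var v))) (graph f)"
    using k xs(4)[OF k'] comps_basic(3)[OF k'] by simp
  \<comment> \<open>The equations in this context identify \<theta> with \<open>M\<close>, so that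
    \<xi> becomes available. Its members are afterwards derived from \<Gamma> and one further
    equation.\<close>
  define \<Gamma>2 where "\<Gamma>2 = defs ys ss \<union> {M, Mem (pair (Var x) (Var y)) (graph f)}"
  have fM: "formula L M" using entails_wf[OF M] by simp
  have c2: "ctx \<Gamma>2" using ctx_defs[OF len wss tyss] fM fxy by (simp add: \<Gamma>2_def del: formula_Mem)
  have "\<Gamma>2 \<turnstile> Eq \<theta> M" unfolding M_def
  proof (rule msub_eq[OF len \<theta> tyss _ _ c2])
    show "wf_trm L s \<and> fv s \<inter> (bv \<theta> \<union> set ys) = {} \<and> bv s = {}" if "s \<in> set ss" for s
      using that wss[OF that] nv bv_subset_vars[of \<theta>] by (auto simp: ss_def)
    show "\<Gamma>2 \<turnstile> Eq (Var (ys ! i)) (ss ! i)" if "i < length ys" for i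
      using in_defs[OF len that] by (intro hyp[OF c2]) (simp add: \<Gamma>2_def)
  qed
  moreover have "\<Gamma>2 \<turnstile> M" by (rule hyp[OF c2]) (simp add: \<Gamma>2_def)
  ultimately have "\<Gamma>2 \<turnstile> \<theta>" by (rule eq_mp[OF eq_sym])
  moreover have "\<Gamma>2 \<turnstile> Mem (pair (Var x) (Var y)) (graph f)" by (rule hyp[OF c2]) (simp add: \<Gamma>2_def)
  ultimately have \<xi>2: "\<Gamma>2 \<turnstile> \<xi>" by (rule cut2[OF \<xi>])
  \<comment> \<open>The facts \<open>yv\<close> cover all equations of \<Gamma>2 except the one for
    \<open>y\<close>. That one is assumed, and then discharged because \<open>y\<close> is free
    neither in \<xi> nor in \<Gamma>.\<close>
  define Y where "Y = Eq (Var y) (prj n k (Var v) :: ('g, 'f) trm)"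
  have fY: "formula L Y" using prj_wf[OF k(1)] k ys by (simp add: Y_def)
  have cY: "ctx (insert Y \<Gamma>)" using fY c by simp
  have wk: "insert Y \<Gamma> \<turnstile> a" if "\<Gamma> \<turnstile> a" for a by (rule weaken[OF that _ cY]) auto
  have hY: "insert Y \<Gamma> \<turnstile> Eq (Var y) (prj n k (Var v))" by (rule hyp[OF cY]) (simp add: Y_def)
  have "insert Y \<Gamma> \<turnstile> \<xi>"
  proof (rule cut_set[OF \<xi>2 _ cY])
    fix d assume "d \<in> \<Gamma>2"
    then consider i where "i < n" "d = Eq (Var (ys ! i)) (prj n i (Var v))" | "d = M"
      | "d = Mem (pair (Var x) (Var y)) (graph f)"
      unfolding \<Gamma>2_def defs_def set_map2_nth[OF len] using n by (auto simp: ss_def)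
    then show "insert Y \<Gamma> \<turnstile> d"
    proof cases
      case (1 i)
      \<comment> \<open>As \<open>ys\<close> is distinct, \<open>k\<close> is the only coordinate of
        \<open>y\<close>.\<close>
      have "i = k" if "ys ! i = y" using that k 1(1) n ys(1) by (auto simp: nth_eq_iff_index_eq)
      then show ?thesis using 1 hY wk[OF yv[of i]] k(2) by (cases "ys ! i = y") auto
    next
      case 2
      then show ?thesis using wk M by simp
    next
      case 3
      have "insert Y \<Gamma> \<turnstile> Eq (Var x) (Var x)" using cY entails_wf[OF \<xi>] by (intro eq_reflI) auto
      with wk[OF xv] show ?thesis unfolding 3 using eq_sym[OF hY] by (rule rel_cong)
    qed
  qed
  then have "\<Gamma> \<turnstile> \<xi>" unfolding Y_def
    by (rule def_elim) (use ne yx xs(3) fvs in \<open>auto simp: \<Gamma>_def\<close>)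
  \<comment> \<open>The generic points \<open>v\<close> and \<open>u\<close> are quantified in turn,
    giving the existential statements to which membership in \<open>H\<close> and in
    \<open>G\<close> leads.\<close>
  then have "insert uv (insert vq {P, Q, pu}) \<turnstile> \<xi>" by (simp add: \<Gamma>_def insert_commute)
  then have "insert (Exists v (Conj uv vq)) {P, Q, pu} \<turnstile> \<xi>"
    by (intro Exists_left Conj_left) (use ne fvs fresh(1) wf_pq in auto)
  moreover have "{uq} \<turnstile> Exists v (Conj uv vq)" unfolding uq_def uv_def vq_def H_def
    by (rule comp_sfun_elim[OF rels_closed(2,1)])
      (use rels_types types wf_pq fresh used_vars(9) in \<open>auto simp: H_def\<close>)
  ultimately have "{uq, P, Q, pu} \<turnstile> \<xi>"
    by (elim cut_set) (use fm in \<open>auto intro: hyp weaken\<close>)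
  then have "insert pu (insert uq {P, Q}) \<turnstile> \<xi>" by (simp add: insert_commute)
  then have "insert (Exists u (Conj pu uq)) {P, Q} \<turnstile> \<xi>"
    by (intro Exists_left Conj_left) (use ne fvs fresh(1) wf_pq in auto)
  moreover have "{pq} \<turnstile> Exists u (Conj pu uq)" unfolding uq_def pu_def pq_def G_def
    by (rule comp_sfun_elim[OF rels_closed(3,4)])
      (use rels_types types wf_pq fresh used_vars(10) in \<open>auto simp: G_def\<close>)
  ultimately have pq: "{pq, P, Q} \<turnstile> \<xi>"
    by (elim cut_set) (use fm in \<open>auto intro: hyp weaken\<close>)
  define T where "T = translation ys f x y \<theta>"
  have fvT: "fv T \<subseteq> set xs" unfolding T_def translation_eq fv_rel[OF rels_closed(5)] by auto
  have cT: "ctx {P, Q, T}" using fm formula_translation by (simp add: T_def)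
  have hT: "{P, Q, T} \<turnstile> Eq (Var p) (tuple (map Var xs))" "{P, Q, T} \<turnstile> Eq (Var q) Tru"
    "{P, Q, T} \<turnstile> Mem (pair (tuple (map Var xs)) Tru) (graph G)"
    by (rule hyp[OF cT]; simp add: P_def Q_def T_def translation_eq)+
  \<comment> \<open>The translation speaks of the actual tuple and \<open>Tru\<close>;
    \<open>P\<close> and \<open>Q\<close> carry it to the fresh \<open>p\<close> and
    \<open>q\<close>, after which both equations are discharged.\<close>
  have "{P, Q, T} \<turnstile> pq" unfolding pq_def
    using hT(3) eq_sym[OF hT(1)] eq_sym[OF hT(2)] by (rule rel_cong)
  then have "insert P {Q, T} \<turnstile> \<xi>"
    by (intro cut_set[OF pq _ cT]) (use hyp[OF cT] in auto)
  then have "insert Q {T} \<turnstile> \<xi>" unfolding P_def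
    by (rule def_elim) (use ne fvs fvT fresh(1) in auto)
  then have "{T} \<turnstile> \<xi>" unfolding Q_def
    by (rule def_elim) (use ne fvs fvT fresh(1) in auto)
  then show ?thesis by (simp add: T_def)
qed

end

lemma fresh_quadruple:
  assumes "finite U"
  obtains p u v q where "distinct [p, u, v, q]" "{p, u, v, q} \<inter> (used_vars \<union> U) = {}"
    "vty p = prod_ty (map vty xs)" "vty u = prod_ty (map vty ys)"
    "vty v = prod_ty (map vty ys)" "vty q = OmegaT"
proof -
  define As where "As = [prod_ty (map vty xs), prod_ty (map vty ys), prod_ty (map vty ys), OmegaT]"
  define us where "us = fresh_list As (used_vars \<union> U)"
  have us: "length us = 4" "map vty us = As" "distinct us" "set us \<inter> (used_vars \<union> U) = {}"
    using fresh_list_facts[of "used_vars \<union> U" As] used_vars(1) assms by (auto simp: us_def As_def)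
  from us(1) obtain p u v q where "us = [p, u, v, q]"
    by (auto simp: numeral_eq_Suc length_Suc_conv)
  then show ?thesis using that[of p u v q] us by (auto simp: As_def)
qed

lemma translation_intro:
  "{\<theta>, Mem (pair (Var x) (Var y)) (graph f)} \<turnstile> translation ys f x y \<theta>"
proof -
  obtain p u v q where "distinct [p, u, v, q]" "{p, u, v, q} \<inter> (used_vars \<union> {}) = {}"
    "vty p = prod_ty (map vty xs)" "vty u = prod_ty (map vty ys)"
    "vty v = prod_ty (map vty ys)" "vty q = OmegaT"
    using fresh_quadruple[of "{}"] by blast
  then show ?thesis by (rule translation_intro_fresh[OF _ _ _ _ _ _ refl])
qed

lemma translation_elim:
  assumes \<xi>: "{\<theta>, Mem (pair (Var x) (Var y)) (graph f)} \<turnstile> \<xi>" and yx: "y \<notin> fv \<xi>"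
  shows "{translation ys f x y \<theta>} \<turnstile> \<xi>"
proof -
  obtain p u v q where "distinct [p, u, v, q]" "{p, u, v, q} \<inter> (used_vars \<union> fv \<xi>) = {}"
    "vty p = prod_ty (map vty xs)" "vty u = prod_ty (map vty ys)"
    "vty v = prod_ty (map vty ys)" "vty q = OmegaT"
    using fresh_quadruple[of "fv \<xi>"] finite_fv by blast
  then show ?thesis by (rule translation_elim_fresh[OF _ _ _ _ _ _ refl \<xi> yx subset_refl])
qed

end

end

section \<open>Functoriality and adjointness\<close>

lemma category_preorder_cat:
  assumes "\<And>a. a \<in> P \<Longrightarrow> le a a" "\<And>a b c. le a b \<Longrightarrow> le b c \<Longrightarrow> le a c"
  shows "category (preorder_cat P le)"
  using assms by (auto simp: category_def preorder_cat_def hom_def; blast)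

lemma is_functor_preorder_cat:
  assumes "category (preorder_cat P le)" "category (preorder_cat Q le')"
    "\<And>a. a \<in> P \<Longrightarrow> T a \<in> Q" "\<And>a b. a \<in> P \<Longrightarrow> b \<in> P \<Longrightarrow> le a b \<Longrightarrow> le' (T a) (T b)"
  shows "is_functor (preorder_cat P le) (preorder_cat Q le') T (map_prod T T)"
  using assms unfolding is_functor_def by (auto simp: preorder_cat_def hom_def)

text \<open>Between two objects there is at most one arrow, so \<open>adj\<close> makes
  corresponding hom-sets empty or singletons together. The bijection is constant, and naturality
  compares arrows with the same ends.\<close>

lemma right_adjoint_preorder_cat:
  assumes T: "is_functor (preorder_cat P le) (preorder_cat Q le') T (map_prod T T)"
    and E: "is_functor (preorder_cat Q le') (preorder_cat P le) E (map_prod E E)"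
    and adj: "\<And>a b. a \<in> P \<Longrightarrow> b \<in> Q \<Longrightarrow> le' (T a) b \<longleftrightarrow> le a (E b)"
  shows "right_adjoint (preorder_cat P le) (preorder_cat Q le') T (map_prod T T) E (map_prod E E)"
proof -
  have TQ: "T a \<in> Q" if "a \<in> P" for a using T that by (auto simp: is_functor_def preorder_cat_def)
  have EP: "E b \<in> P" if "b \<in> Q" for b using E that by (auto simp: is_functor_def preorder_cat_def)
  have "bij_betw (\<lambda>_. (a, E b)) (hom (preorder_cat Q le') (T a) b) (hom (preorder_cat P le) a (E b))"
    if "a \<in> P" "b \<in> Q" for a b
    using that TQ EP adj[OF that]
    by (auto simp: bij_betw_def inj_on_def hom_def preorder_cat_def image_iff)
  then show ?thesis unfolding right_adjoint_def
    by (intro conjI T E exI[of _ "\<lambda>a b _. (a, E b)"]) (auto simp: hom_def preorder_cat_def)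
qed

theorem theorem2p5:
  fixes L :: "('g, 'f) language"
    and S :: "('g, 'f) sequent set"
    and f :: "('g, 'f) sfun"
    and A B :: "'g ty"
    and x y :: "'g var"
    and ys :: "('g, 'f) trm \<Rightarrow> 'g var list"
    and T E :: "('g, 'f) trm \<Rightarrow> ('g, 'f) trm"
  assumes "local_set_theory L S"
    and "nullstellensatz L"
    and "S_function L S f"
    and "ty_of (src f) = PowT A"
    and "ty_of (tgt f) = PowT B"
    and "vty x = A" and "vty y = B" and "x \<noteq> y"
    and "\<And>\<theta>. formula L \<theta> \<Longrightarrow> admissible_seq L y \<theta> (ys \<theta>)"
  defines "T \<equiv> \<lambda>\<theta>. translation (ys \<theta>) f x y \<theta>"
    and "E \<equiv> \<lambda>\<xi>. E_map f x y \<xi>"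
  shows "is_functor (F_cat L S) (F_cat L S) T (map_prod T T) \<and>
         right_adjoint (F_cat L S) (F_cat_without L S y) T (map_prod T T) E (map_prod E E)"
proof -
  interpret lst L S by unfold_locales (use assms in auto)
  have types: "vty x = elem_ty (src f)" "vty y = elem_ty (tgt f)"
    using assms(4-7) by (simp_all add: elem_ty_def)
  note clf = S_function_closed_rel[OF assms(3)]
  define R where "R = Mem (pair (Var x) (Var y)) (graph f)"
  have R: "formula L R"
    unfolding R_def formula_rel[OF clf(1)] using types closed_rel_wf_ty[OF clf(1)] by simp
  have T_formula: "formula L (T a)" "y \<notin> fv (T a)" if "formula L a" for a
    using formula_translation[OF assms(3) types assms(8) that assms(9)[OF that]]
      fv_translation[OF assms(3) types assms(8) that assms(9)[OF that]] by (simp_all add: T_def)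
  have unit: "{a, R} \<turnstile> T a" if "formula L a" for a
    using translation_intro[OF assms(3) types assms(8) that assms(9)[OF that]]
    by (simp add: T_def R_def)
  have univ: "{T a} \<turnstile> b" if "formula L a" "{a, R} \<turnstile> b" "y \<notin> fv b" for a b
    using translation_elim[OF assms(3) types assms(8) that(1) assms(9)[OF that(1)]] that(2,3)
    by (simp add: T_def R_def)
  have E_eq: "E b = Imp R b" for b by (simp add: E_def E_map_def R_def)
  have hyps: "{a, R} \<turnstile> a" "{a, R} \<turnstile> R" if "formula L a" for a
    using that R by (auto intro: hyp)
  \<comment> \<open>The sequences \<open>ys a\<close> and \<open>ys b\<close> may differ, so the two
    translations are compared only through \<open>unit\<close> and \<open>univ\<close>.\<close>
  have T_mono: "{T a} \<turnstile> T b" if "formula L a" "formula L b" "{a} \<turnstile> b" for a b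
    by (rule univ[OF that(1) cut2[OF unit[OF that(2)] cut1[OF that(3)]] T_formula(2)])
      (use hyps that in auto)
  have E_mono: "{E a} \<turnstile> E b" if "formula L a" "{a} \<turnstile> b" for a b
  proof -
    have c: "ctx {R, E a}" using R that by (simp add: E_eq)
    have "{R, E a} \<turnstile> R" "{R, E a} \<turnstile> Imp R a" by (rule hyp[OF c]; simp add: E_eq)+
    then have "{R, E a} \<turnstile> a" using ImpE by blast
    then have "insert R {E a} \<turnstile> b" by (rule cut1[OF that(2)])
    then show ?thesis unfolding E_eq[of b] by (rule ImpI)
  qed
  \<comment> \<open>Both sides are equivalent to \<open>{a, R} \<turnstile> b\<close>: on the left
    by \<open>unit\<close> and \<open>univ\<close>, on the right by the rules for
    implication.\<close>
  have adj: "{T a} \<turnstile> b \<longleftrightarrow> {a} \<turnstile> E b" if "formula L a" "y \<notin> fv b" for a b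
  proof
    assume "{T a} \<turnstile> b"
    then have "{a, R} \<turnstile> b" using unit[OF that(1)] by (rule cut1)
    then have "insert R {a} \<turnstile> b" by (simp add: insert_commute)
    then show "{a} \<turnstile> E b" unfolding E_eq by (rule ImpI)
  next
    assume "{a} \<turnstile> E b"
    then have "{a, R} \<turnstile> Imp R b" unfolding E_eq using hyps(1)[OF that(1)] by (rule cut1)
    then have "{a, R} \<turnstile> b" using hyps(2)[OF that(1)] by (rule ImpE)
    then show "{T a} \<turnstile> b" using univ that by blast
  qed
  \<comment> \<open>The conjunct \<open>True\<close> matches the trivial predicate in the definition
    of \<open>F_cat\<close>.\<close>
  define P :: "('g, 'f) trm set" where "P = {a. formula L a \<and> True}"
  define Q where "Q = {a. formula L a \<and> y \<notin> fv a}"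
  define le where "le = (\<lambda>a b. {a} \<turnstile> b)"
  have cats: "F_cat L S = preorder_cat P le" "F_cat_without L S y = preorder_cat Q le"
    by (simp_all add: F_cat_def F_cat_without_def formula_cat_def P_def Q_def le_def)
  have cat: "category (preorder_cat V le)" if "V \<subseteq> P" for V
    by (rule category_preorder_cat) (use that in \<open>auto simp: le_def P_def intro: tautology cut1\<close>)
  have QP: "Q \<subseteq> P" by (auto simp: P_def Q_def)
  have "is_functor (preorder_cat P le) (preorder_cat P le) T (map_prod T T)"
    by (rule is_functor_preorder_cat) (use cat T_formula T_mono in \<open>auto simp: P_def le_def\<close>)
  moreover have "right_adjoint (preorder_cat P le) (preorder_cat Q le) T (map_prod T T) E (map_prod E E)"
  proof (rule right_adjoint_preorder_cat)
    show "is_functor (preorder_cat P le) (preorder_cat Q le) T (map_prod T T)"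
      by (rule is_functor_preorder_cat[OF cat cat])
        (use QP T_formula T_mono in \<open>auto simp: P_def Q_def le_def\<close>)
    \<comment> \<open>The variable \<open>y\<close> is free in \<open>R\<close>, hence in every
      \<open>E b\<close>; the values belong to the class of all formulae \<open>P\<close>.\<close>
    show "is_functor (preorder_cat Q le) (preorder_cat P le) E (map_prod E E)"
      by (rule is_functor_preorder_cat[OF cat cat])
        (use QP R E_mono in \<open>auto simp: P_def Q_def le_def E_eq\<close>)
  qed (use adj in \<open>auto simp: P_def Q_def le_def\<close>)
  ultimately show ?thesis by (simp add: cats)
qed

end
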